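(* Let $m\in\mathbb{N}$, $\nu_j\in(0,1)$ and $\lambda_j>0$ for $j=1,\dots,m$. Let $\mathcal{H}^{\nu_1,\dots,\nu_m}(t)=\sum_{j=1}^m \lambda_j^{1/\nu_j}H_j^{\nu_j}(t)$, $t>0$, where $H_j^{\nu_j}$ are independent stable subordinators of order $\nu_j$, and let $\mathcal{L}^{\nu_1,\dots,\nu_m}(t)=\inf\{s>0:\mathcal{H}^{\nu_1,\dots,\nu_m}(s)\ge t\}$, $t>0$. (i) The solution to the problem $$\begin{cases}\dfrac{\partial}{\partial t}h(x,t)=-\displaystyle\sum_{j=1}^m\lambda_j\dfrac{\partial^{\nu_j}}{\partial x^{\nu_j}}h(x,t), & x>0,\ t>0,\\ h(x,0)=\delta(x),\\ h(0,t)=0,\end{cases}$$ is given by the probability density $h(x,t)$ of $\mathcal{H}^{\nu_1,\dots,\nu_m}(t)$. (ii) The solution to the problem $$\begin{cases}\displaystyle\sum_{j=1}^m\lambda_j\dfrac{\partial^{\nu_j}}{\partial t^{\nu_j}}l(x,t)=-\dfrac{\partial}{\partial x}l(x,t), & x>0,\ t>0,\\ l(0,t)=\displaystyle\sum_{j=1}^m\lambda_j\dfrac{t^{-\nu_j}}{\Gamma(1-\nu_j)},\end{cases}$$ is given by the probability density $l(x,t)$ (in the variable $x$) of $\mathcal{L}^{\nu_1,\dots,\nu_m}(t)$. In both problems the fractional derivatives are Riemann-Liouville derivatives.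
   Context: A stable subordinator $H^\nu(t)$, $t>0$, of order $\nu\in(0,1)$ is the nonnegative process with stationary independent increments, started at $0$, with $\mathbb{E}e^{-\mu H^\nu(t)}=e^{-t\mu^\nu}$ for $\mu>0$; equivalently $\mathbb{E}e^{i\xi H^\nu(t)}=e^{-t(-i\xi)^\nu}$, where $(-i\xi)^\nu=(|\xi|e^{-i\frac{\pi}{2}\mathrm{sign}(\xi)})^\nu=|\xi|^\nu e^{-i\frac{\pi\nu}{2}\mathrm{sign}(\xi)}$. For $\nu\in(0,1)$ the Riemann-Liouville derivative is $\frac{\partial^\nu}{\partial x^\nu}f(x)=\frac{1}{\Gamma(1-\nu)}\frac{d}{dx}\int_0^x\frac{f(s)}{(x-s)^{\nu}}\,ds$. "Solution" is understood at the level of transforms, as is done throughout the paper. The Fourier transform is $\widehat u(\xi)=\int e^{i\xi x}u(x)\,dx$ and the Laplace transform is $\widetilde u(\mu)=\int_0^\infty e^{-\mu t}u(t)\,dt$, and the Riemann-Liouville derivative of order $\nu$ corresponds to multiplication by $(-i\xi)^\nu$ under the Fourier transform and by $\mu^\nu$ under the Laplace transform. In (i), $h$ solves the problem when its Fourier transform in $x$ (with $h$ extended by $0$ to $x<0$) satisfies the transformed equation with $\widehat h(\xi,0)=1$. In (ii), $l$ solves the problem when its double Laplace transform in $(x,t)$ satisfies the transformed equation, the Laplace transform in $x$ of $\partial l/\partial x$ producing the boundary value $l(0,t)$. Here $\delta$ is the Dirac delta. *)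

theory Defs
  imports "HOL-Probability.Probability"
begin

section \<open>Stable subordinators\<close>

text \<open>
  The paths are almost surely right-continuous with left limits, as usual for processes with
  stationary independent increments; without this the hitting times below would not be
  determined by the law of the process. Monotonicity of the paths is not assumed: it follows from
  nonnegativity, stationarity and right-continuity.
\<close>

definition stable_subordinator :: "'a measure \<Rightarrow> real \<Rightarrow> (real \<Rightarrow> 'a \<Rightarrow> real) \<Rightarrow> bool" where
  "stable_subordinator M \<nu> H \<longleftrightarrow>
     (\<forall>t\<ge>0. H t \<in> borel_measurable M) \<and>
     (AE \<omega> in M. H 0 \<omega> = 0) \<and>
     (AE \<omega> in M. \<forall>t\<ge>0. 0 \<le> H t \<omega>) \<and>
     (AE \<omega> in M. \<forall>t\<ge>0. continuous (at_right t) (\<lambda>s. H s \<omega>)) \<and>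
     (AE \<omega> in M. \<forall>t>0. \<exists>y. ((\<lambda>s. H s \<omega>) \<longlongrightarrow> y) (at_left t)) \<and>
     (\<forall>s\<ge>0. \<forall>t\<ge>0. distr M borel (\<lambda>\<omega>. H (s + t) \<omega> - H s \<omega>) =
                    distr M borel (\<lambda>\<omega>. H t \<omega> - H 0 \<omega>)) \<and>
     (\<forall>n. \<forall>\<tau> :: nat \<Rightarrow> real. 0 \<le> \<tau> 0 \<and> (\<forall>i<n. \<tau> i \<le> \<tau> (Suc i)) \<longrightarrow>
        prob_space.indep_vars M (\<lambda>_. borel) (\<lambda>i \<omega>. H (\<tau> (Suc i)) \<omega> - H (\<tau> i) \<omega>) {..<n}) \<and>
     (\<forall>t>0. \<forall>\<mu>>0. (LINT \<omega>|M. exp (- \<mu> * H t \<omega>)) = exp (- t * \<mu> powr \<nu>))"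

text \<open>Joint independence of whole processes, i.e. of the sigma-algebras they generate.\<close>

definition independent_processes ::
    "'a measure \<Rightarrow> nat set \<Rightarrow> (nat \<Rightarrow> real \<Rightarrow> 'a \<Rightarrow> real) \<Rightarrow> bool" where
  "independent_processes M J H \<longleftrightarrow>
     prob_space.indep_vars M (\<lambda>_. \<Pi>\<^sub>M t\<in>{0::real..}. (borel :: real measure))
       (\<lambda>j \<omega>. \<lambda>t\<in>{0..}. H j t \<omega>) J"

definition subordinator_sum ::
    "nat \<Rightarrow> (nat \<Rightarrow> real) \<Rightarrow> (nat \<Rightarrow> real) \<Rightarrow> (nat \<Rightarrow> real \<Rightarrow> 'a \<Rightarrow> real) \<Rightarrow> real \<Rightarrow> 'a \<Rightarrow> real" where
  "subordinator_sum m \<nu> lam H t \<omega> = (\<Sum>j=1..m. lam j powr (1 / \<nu> j) * H j t \<omega>)"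

definition inverse_process :: "(real \<Rightarrow> 'a \<Rightarrow> real) \<Rightarrow> real \<Rightarrow> 'a \<Rightarrow> real" where
  "inverse_process X t \<omega> = Inf {s. s > 0 \<and> X s \<omega> \<ge> t}"

definition zero_ext :: "(real \<Rightarrow> real) \<Rightarrow> real \<Rightarrow> real" where
  "zero_ext f x = (if 0 \<le> x then f x else 0)"

text \<open>Nonnegativity is explicit since \<^const>\<open>ennreal\<close> maps negative numbers to 0.\<close>

definition prob_density :: "'a measure \<Rightarrow> ('a \<Rightarrow> real) \<Rightarrow> (real \<Rightarrow> real) \<Rightarrow> bool" where
  "prob_density M X f \<longleftrightarrow> (\<forall>x. 0 \<le> f x) \<and> distributed M lborel X (\<lambda>x. ennreal (f x))"

section \<open>The two problems at the level of transforms\<close>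

definition fourier :: "(real \<Rightarrow> real) \<Rightarrow> real \<Rightarrow> complex" where
  "fourier f \<xi> = (LINT x|lborel. exp (\<i> * complex_of_real (\<xi> * x)) * complex_of_real (f x))"

definition laplace :: "(real \<Rightarrow> real) \<Rightarrow> real \<Rightarrow> real" where
  "laplace f \<mu> = (LINT t:{0<..}|lborel. exp (- \<mu> * t) * f t)"

definition double_laplace :: "(real \<Rightarrow> real \<Rightarrow> real) \<Rightarrow> real \<Rightarrow> real \<Rightarrow> real" where
  "double_laplace l \<gamma> \<mu> = laplace (\<lambda>t. laplace (\<lambda>x. l x t) \<gamma>) \<mu>"

text \<open>
  The problem \<open>\<partial>h/\<partial>t = - \<Sum>\<^sub>j \<lambda>\<^sub>j \<partial>\<^sup>\<nu>h/\<partial>x\<^sup>\<nu>\<close> (with \<open>\<nu> = \<nu>\<^sub>j\<close>),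
  \<open>h(x,0) = \<delta>(x)\<close>, \<open>h(0,t) = 0\<close>, Fourier transformed in \<open>x\<close> after extending \<open>h\<close> by 0 to
  \<open>x < 0\<close>. The Riemann-Liouville derivative of order \<open>\<nu>\<close> becomes multiplication by
  \<open>(-i \<xi>)\<^sup>\<nu> = |\<xi>|\<^sup>\<nu> exp (- i \<pi> \<nu> sgn \<xi> / 2)\<close>, which is the principal branch used by
  complex \<open>powr\<close>. The initial value has transform 1, attained as \<open>t\<close> tends to 0 from the right.
\<close>

definition solves_space_problem ::
    "nat \<Rightarrow> (nat \<Rightarrow> real) \<Rightarrow> (nat \<Rightarrow> real) \<Rightarrow> (real \<Rightarrow> real \<Rightarrow> real) \<Rightarrow> bool" where
  "solves_space_problem m \<nu> lam h \<longleftrightarrow>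
     (\<forall>t>0. h 0 t = 0) \<and>
     (\<forall>t>0. integrable lborel (zero_ext (\<lambda>x. h x t))) \<and>
     (\<forall>\<xi>. \<forall>t>0.
        ((\<lambda>s. fourier (zero_ext (\<lambda>x. h x s)) \<xi>) has_vector_derivative
           - (\<Sum>j=1..m. complex_of_real (lam j) *
                 (- \<i> * complex_of_real \<xi>) powr complex_of_real (\<nu> j) *
                 fourier (zero_ext (\<lambda>x. h x t)) \<xi>)) (at t)) \<and>
     (\<forall>\<xi>. ((\<lambda>t. fourier (zero_ext (\<lambda>x. h x t)) \<xi>) \<longlongrightarrow> 1) (at_right 0))"

text \<open>
  The problem \<open>\<Sum>\<^sub>j \<lambda>\<^sub>j \<partial>\<^sup>\<nu>l/\<partial>t\<^sup>\<nu> = - \<partial>l/\<partial>x\<close> (with \<open>\<nu> = \<nu>\<^sub>j\<close>) with the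
  prescribed boundary values \<open>l(0,t)\<close>, Laplace transformed in \<open>x\<close> (variable \<open>\<gamma>\<close>) and in \<open>t\<close>
  (variable \<open>\<mu>\<close>). The transform in \<open>x\<close> of \<open>\<partial>l/\<partial>x\<close> is \<open>\<gamma>\<close> times that of \<open>l\<close>, minus
  \<open>l(0,t)\<close>.
\<close>

definition solves_time_problem ::
    "nat \<Rightarrow> (nat \<Rightarrow> real) \<Rightarrow> (nat \<Rightarrow> real) \<Rightarrow> (real \<Rightarrow> real \<Rightarrow> real) \<Rightarrow> bool" where
  "solves_time_problem m \<nu> lam l \<longleftrightarrow>
     (\<forall>t>0. l 0 t = (\<Sum>j=1..m. lam j * (t powr (- \<nu> j) / Gamma (1 - \<nu> j)))) \<and>
     (\<forall>\<gamma>>0. \<forall>\<mu>>0. set_integrable (lborel \<Otimes>\<^sub>M lborel) ({0<..} \<times> {0<..})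
        (\<lambda>(x, t). exp (- \<gamma> * x - \<mu> * t) * l x t)) \<and>
     (\<forall>\<gamma>>0. \<forall>\<mu>>0.
        (\<Sum>j=1..m. lam j * (\<mu> powr \<nu> j * double_laplace l \<gamma> \<mu>)) =
          - (\<gamma> * double_laplace l \<gamma> \<mu> - laplace (\<lambda>t. l 0 t) \<mu>))"

end

theory Submission
  imports Defs "HOL-Complex_Analysis.Conformal_Mappings" "HOL-Real_Asymp.Real_Asymp"
begin

text \<open>
  Let \<open>\<psi>(z) = \<Sum>\<^sub>j \<lambda>\<^sub>j z\<^sup>\<nu>\<close> (with \<open>\<nu> = \<nu>\<^sub>j\<close>), so that the sum at time \<open>y\<close> has Laplace transform
  \<open>exp (- y \<psi>(\<mu>))\<close>. By analytic continuation its characteristic function is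
  \<open>exp (- y \<psi>(- i \<xi>))\<close>, which is integrable; Fourier inversion gives a continuous density \<open>h(s, y)\<close>,
  and the transformed space problem is a linear ordinary differential equation in time.

  The density of the inverse at time \<open>t\<close> is the convolution
  \<open>l(y, t) = \<integral> h(t - r, y) k(r) dr\<close>, where \<open>k(r) = \<Sum>\<^sub>j \<lambda>\<^sub>j r\<^sup>-\<^sup>\<nu> / \<Gamma>(1 - \<nu>)\<close> is the tail of the Levy measure.
  Indeed \<open>\<integral>\<^sub>0\<^sup>x l(y, t) dy\<close> and the probability that the sum at time \<open>x\<close> is at least \<open>t\<close> have the same
  Laplace transform in \<open>t\<close>, and both are continuous in \<open>t\<close>. The boundary value \<open>l(0+, t) = k(t)\<close> rests on the
  bound \<open>h(s, y) \<le> C / s\<close> uniformly in \<open>y\<close>, which controls the singularity of \<open>k\<close> at 0, while the law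
  of the sum at time \<open>y\<close> concentrates at 0 as \<open>y\<close> tends to 0. Uniqueness is injectivity of the Fourier
  and of the double Laplace transform.
\<close>

section \<open>Fourier and Laplace transforms\<close>

text \<open>The hypotheses give only real Laplace transforms and the density has no closed formula
  in general, so everything is read off the exponent. The decisive fact is that \<nu> < 1 keeps (-i
  \<xi>)^\<nu> strictly inside the right half-plane. Positivity of the real part makes the
  characteristic function integrable; and since each term of the derivative of \<psi> is at most its
  real part divided by \<open>cos_min\<close>, the bound C / s holds with C = 1 / (pi * cos_min).
  Uniformity in y is essential: the supremum of the density blows up as y tends to 0, just where the
  boundary value is read off. The convolution is forced by transforms: k has Laplace transform
  \<psi>(\<mu>) / \<mu>, and the y-derivative of (1 - exp (- y \<psi>(\<mu>))) / \<mu> is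
  \<psi>(\<mu>) / \<mu> times exp (- y \<psi>(\<mu>)). Two measure-theoretic obstacles remain. The
  hitting time is an infimum over uncountably many times, controlled only outside a null set, hence
  the completion of \<open>M\<close>. And a density is fixed only almost everywhere, so its value at
  0 says something only together with right-continuity there.\<close>

lemma integral_dominated_convergence_within:
  fixes s :: "'b::first_countable_topology \<Rightarrow> 'a \<Rightarrow> 'c::{banach, second_countable_topology}"
  assumes "f \<in> borel_measurable M" "\<And>y. y \<in> S - {a} \<Longrightarrow> s y \<in> borel_measurable M" "integrable M w"
    and lim: "AE x in M. ((\<lambda>y. s y x) \<longlongrightarrow> f x) (at a within S)"
    and bound: "\<And>y. y \<in> S - {a} \<Longrightarrow> AE x in M. norm (s y x) \<le> w x"
  shows "((\<lambda>y. integral\<^sup>L M (s y)) \<longlongrightarrow> integral\<^sup>L M f) (at a within S)"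
  unfolding tendsto_at_iff_sequentially comp_def
proof safe
  fix X assume X: "\<forall>i. X i \<in> S - {a}" and Xa: "X \<longlonglongrightarrow> a"
  show "(\<lambda>i. integral\<^sup>L M (s (X i))) \<longlonglongrightarrow> integral\<^sup>L M f"
  proof (rule integral_dominated_convergence[where w=w])
    show "AE x in M. (\<lambda>i. s (X i) x) \<longlonglongrightarrow> f x"
      using lim X Xa by (auto simp: tendsto_at_iff_sequentially comp_def elim!: AE_mp)
  qed (use assms X in auto)
qed

text \<open>Reduces to the uniqueness theorem for characteristic functions: the positive and
  negative parts of \<open>f\<close> have equal transforms, hence equal mass, and after division by
  that mass they are densities of probability laws.\<close>

lemma fourier_injective:
  fixes f :: "real \<Rightarrow> real"
  assumes f: "integrable lborel f" and fourier: "\<And>\<xi>. fourier f \<xi> = 0"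
  shows "AE x in lborel. f x = 0"
proof -
  define p n where "p x = max 0 (f x)" and "n x = max 0 (- f x)" for x
  have [measurable]: "f \<in> borel_measurable borel" using f by auto
  have [measurable]: "p \<in> borel_measurable borel" "n \<in> borel_measurable borel"
    unfolding p_def n_def by auto
  have p: "integrable lborel p" and n: "integrable lborel n"
    unfolding p_def n_def using f by (auto intro!: integrable_max)
  have nonneg: "p x \<ge> 0" "n x \<ge> 0" for x by (auto simp: p_def n_def)
  have f_eq: "f x = p x - n x" for x by (auto simp: p_def n_def)
  have int: "integrable lborel (\<lambda>x. exp (\<i> * complex_of_real (\<xi> * x)) * complex_of_real (g x))"
    if "integrable lborel g" for g \<xi>
  proof (rule Bochner_Integration.integrable_bound[OF that])
    show "(\<lambda>x. exp (\<i> * complex_of_real (\<xi> * x)) * complex_of_real (g x)) \<in> borel_measurable lborel"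
      using that by measurable
  qed (simp add: norm_mult)
  have eq: "fourier p \<xi> = fourier n \<xi>" for \<xi>
  proof -
    have "fourier f \<xi> = fourier p \<xi> - fourier n \<xi>"
      unfolding fourier_def using int[OF p] int[OF n]
      by (simp add: f_eq right_diff_distrib)
    then show ?thesis using fourier by simp
  qed
  have fourier0: "fourier g 0 = of_real (integral\<^sup>L lborel g)" for g
    by (simp add: fourier_def)
  \<comment> \<open>Both parts have this mass, by the transform at 0. Normalising needs it to be
    nonzero; if it is 0, both parts vanish almost everywhere.\<close>
  define c where "c = integral\<^sup>L lborel p"
  have c_n: "c = integral\<^sup>L lborel n"
    using eq[of 0] by (simp add: fourier0 c_def)
  have "c \<ge> 0" by (simp add: c_def nonneg)
  show ?thesis
  proof (cases "c = 0")
    case True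
    then have "AE x in lborel. p x = 0" "AE x in lborel. n x = 0"
      using p n nonneg integral_nonneg_eq_0_iff_AE[of lborel p] integral_nonneg_eq_0_iff_AE[of lborel n]
      by (auto simp: c_def[symmetric] c_n[symmetric])
    then show ?thesis by eventually_elim (simp add: f_eq)
  next
    case False
    then have "c > 0" using \<open>c \<ge> 0\<close> by simp
    define D where "D g = density lborel (\<lambda>x. ennreal (g x / c))" for g :: "real \<Rightarrow> real"
    have D: "real_distribution (D g)" "char (D g) t = fourier g t / c"
      if "integrable lborel g" "\<And>x. g x \<ge> 0" "integral\<^sup>L lborel g = c" for g t
    proof -
      have [measurable]: "g \<in> borel_measurable borel" using that by auto
      have "(\<integral>\<^sup>+ x. ennreal (g x / c) \<partial>lborel) = ennreal (\<integral>x. g x / c \<partial>lborel)"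
        using that \<open>c > 0\<close> by (intro nn_integral_eq_integral) auto
      also have "\<dots> = 1" using that \<open>c > 0\<close> by simp
      finally have "prob_space (D g)"
        by (intro prob_spaceI) (simp add: D_def emeasure_density)
      then show "real_distribution (D g)"
        by (simp add: real_distribution_def real_distribution_axioms_def D_def)
      have "char (D g) t = (CLINT x|lborel. (g x / c) *\<^sub>R iexp (t * x))"
        unfolding char_def D_def using that \<open>c > 0\<close> by (subst integral_density) auto
      also have "\<dots> = (CLINT x|lborel. iexp (t * x) * g x / c)"
        by (simp add: scaleR_conv_of_real mult_ac)
      also have "\<dots> = fourier g t / c"
        unfolding fourier_def by simp
      finally show "char (D g) t = fourier g t / c" .
    qed
    have "D p = D n"
      using D[OF p nonneg(1) c_def[symmetric]] D[OF n nonneg(2) c_n[symmetric]] eq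
      by (intro Levy_uniqueness) auto
    then have "AE x in lborel. ennreal (p x / c) = ennreal (n x / c)"
      unfolding D_def by (intro sigma_finite_measure.density_unique[OF sigma_finite_lborel]) auto
    then show ?thesis
    proof eventually_elim
      case (elim x)
      then have "p x / c = n x / c" using nonneg \<open>c > 0\<close> by (subst (asm) ennreal_inj) auto
      then show ?case using \<open>c > 0\<close> f_eq by simp
    qed
  qed
qed

lemma halfplane_convex: "convex {z::complex. Re z > r}"
  by (rule convex_halfspace_Re_gt)

text \<open>Differentiating a Laplace transform brings down a factor x; giving up half of the
  exponential rate absorbs it.\<close>

lemma mult_exp_neg_le:
  fixes r x :: real
  assumes "r > 0" "x \<ge> 0"
  shows "x * exp (- r * x) \<le> (2 / r) * exp (- (r / 2) * x)"
proof -
  have "(r / 2) * x \<le> exp ((r / 2) * x)"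
    using exp_ge_add_one_self[of "(r / 2) * x"] by linarith
  then have "x \<le> (2 / r) * exp ((r / 2) * x)"
    using assms by (simp add: field_simps)
  then have "x * exp (- r * x) \<le> (2 / r) * exp ((r / 2) * x) * exp (- r * x)"
    by (rule mult_right_mono) simp
  also have "\<dots> = (2 / r) * exp (- (r / 2) * x)"
    by (simp add: exp_add[symmetric] mult.assoc)
  finally show ?thesis .
qed

text \<open>Differentiation under the integral sign. It is stated for a general measure and weight
  because it serves twice: for probability laws with weight 1, and for Lebesgue measure with an
  arbitrary weight.\<close>

lemma laplace_transform_holomorphic:
  fixes X f :: "'a \<Rightarrow> real"
  assumes [measurable]: "X \<in> borel_measurable M" "f \<in> borel_measurable M"
    and nonneg: "AE \<omega> in M. X \<omega> \<ge> 0"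
    and int: "\<And>\<mu>. \<mu> > 0 \<Longrightarrow> integrable M (\<lambda>\<omega>. exp (- \<mu> * X \<omega>) * f \<omega>)"
  shows "(\<lambda>z. LINT \<omega>|M. exp (- z * complex_of_real (X \<omega>)) * complex_of_real (f \<omega>))
     holomorphic_on {z. Re z > 0}"
    (is "?F holomorphic_on _")
proof (rule holomorphic_onI, rule field_differentiable_at_within)
  fix z :: complex assume "z \<in> {z. Re z > 0}"
  \<comment> \<open>Half the real part leaves an open convex neighbourhood of \<open>z\<close> on
    which one decay rate \<open>r\<close> is valid.\<close>
  define r where "r = Re z / 2"
  have r: "r > 0" using \<open>z \<in> _\<close> by (auto simp: r_def)
  define S where "S = {y. Re y > r}"
  have S: "open S" "z \<in> S" "convex S"
    unfolding S_def using r by (simp_all only: open_halfspace_Re_gt halfplane_convex) (simp add: r_def)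
  have norm_e: "norm (exp (- y * complex_of_real x)) \<le> exp (- r * x)" if "y \<in> S" "x \<ge> 0" for y x
    using that by (simp add: S_def mult_right_mono)
  have int_e: "integrable M (\<lambda>\<omega>. exp (- y * complex_of_real (X \<omega>)) * complex_of_real (f \<omega>))"
    if "y \<in> S" for y
  proof (rule Bochner_Integration.integrable_bound[OF int[OF r]])
    show "AE \<omega> in M. norm (exp (- y * complex_of_real (X \<omega>)) * complex_of_real (f \<omega>))
            \<le> norm (exp (- r * X \<omega>) * f \<omega>)"
      using nonneg
    proof eventually_elim
      case (elim \<omega>)
      then show ?case using mult_right_mono[OF norm_e[OF that elim], of "\<bar>f \<omega>\<bar>"]
        by (simp add: norm_mult abs_mult)
    qed
  qed measurable
  define d where "d y \<omega> = ((exp (- y * complex_of_real (X \<omega>)) * complex_of_real (f \<omega>)) -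
     (exp (- z * complex_of_real (X \<omega>)) * complex_of_real (f \<omega>))) / (y - z)" for y \<omega>
  define d' where "d' \<omega> = - complex_of_real (X \<omega>) * exp (- z * complex_of_real (X \<omega>)) * complex_of_real (f \<omega>)" for \<omega>
  have "((\<lambda>y. LINT \<omega>|M. d y \<omega>) \<longlongrightarrow> (LINT \<omega>|M. d' \<omega>)) (at z within S)"
  proof (rule integral_dominated_convergence_within)
    show "d y \<in> borel_measurable M" "d' \<in> borel_measurable M" for y
      unfolding d_def d'_def by measurable
    show "integrable M (\<lambda>\<omega>. (2 / r) * \<bar>exp (- (r / 2) * X \<omega>) * f \<omega>\<bar>)"
      using int[of "r / 2"] r by (intro integrable_mult_right integrable_abs) auto
    have "((\<lambda>y. exp (- y * complex_of_real x) * c) has_field_derivative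
        - complex_of_real x * exp (- z * complex_of_real x) * c) (at z within S)" for c x
      by (auto intro!: derivative_eq_intros)
    then show "AE \<omega> in M. ((\<lambda>y. d y \<omega>) \<longlongrightarrow> d' \<omega>) (at z within S)"
      unfolding d_def d'_def has_field_derivative_iff by auto
    fix y assume y: "y \<in> S - {z}"
    show "AE \<omega> in M. norm (d y \<omega>) \<le> (2 / r) * \<bar>exp (- (r / 2) * X \<omega>) * f \<omega>\<bar>"
      using nonneg
    proof eventually_elim
      case (elim \<omega>)
      \<comment> \<open>Mean value inequality on the convex set \<open>S\<close>. The resulting
        factor \<open>X \<omega>\<close> is then traded for half the decay rate, so that the bound
        stays integrable and does not depend on \<open>y\<close>.\<close>
      have "norm (exp (- y * complex_of_real (X \<omega>)) - exp (- z * complex_of_real (X \<omega>)))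
        \<le> X \<omega> * exp (- r * X \<omega>) * norm (y - z)"
      proof (rule field_differentiable_bound[OF S(3),
            where f' = "\<lambda>y. - complex_of_real (X \<omega>) * exp (- y * complex_of_real (X \<omega>))"])
        show "norm (- complex_of_real (X \<omega>) * exp (- w * complex_of_real (X \<omega>))) \<le> X \<omega> * exp (- r * X \<omega>)"
          if "w \<in> S" for w
          using norm_e[OF that elim] elim by (simp add: norm_mult mult_left_mono)
      qed (use y S in \<open>auto intro!: derivative_eq_intros\<close>)
      also have "\<dots> \<le> (2 / r) * exp (- (r / 2) * X \<omega>) * norm (y - z)"
        by (intro mult_right_mono mult_exp_neg_le r elim) auto
      finally have "norm (exp (- y * complex_of_real (X \<omega>)) - exp (- z * complex_of_real (X \<omega>))) * \<bar>f \<omega>\<bar>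
         \<le> (2 / r) * exp (- (r / 2) * X \<omega>) * norm (y - z) * \<bar>f \<omega>\<bar>"
        by (rule mult_right_mono) simp
      then have "norm ((exp (- y * complex_of_real (X \<omega>)) - exp (- z * complex_of_real (X \<omega>))) * f \<omega>)
         \<le> ((2 / r) * \<bar>exp (- (r / 2) * X \<omega>) * f \<omega>\<bar>) * norm (y - z)"
        by (simp only: norm_mult norm_of_real abs_mult abs_exp_cancel mult_ac)
      then have "norm ((exp (- y * complex_of_real (X \<omega>)) - exp (- z * complex_of_real (X \<omega>))) * f \<omega>) / norm (y - z)
         \<le> ((2 / r) * \<bar>exp (- (r / 2) * X \<omega>) * f \<omega>\<bar>)"
        using y by (subst pos_divide_le_eq) auto
      then show ?case
        by (simp only: d_def norm_divide left_diff_distrib)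
    qed
  qed
  moreover have "(LINT \<omega>|M. d y \<omega>) = (?F y - ?F z) / (y - z)" if "y \<in> S" for y
    unfolding d_def using int_e[OF that] int_e[OF S(2)] by simp
  ultimately have "((\<lambda>y. (?F y - ?F z) / (y - z)) \<longlongrightarrow> (LINT \<omega>|M. d' \<omega>)) (at z within S)"
    by (rule Lim_transform_within[OF _ zero_less_one])
  then have "(?F has_field_derivative (LINT \<omega>|M. d' \<omega>)) (at z within S)"
    by (simp add: has_field_derivative_iff)
  then show "?F field_differentiable at z"
    unfolding at_within_open[OF S(2,1)] field_differentiable_def by blast
qed

text \<open>The identity theorem, with 1 as accumulation point of the points of agreement. Rational
  points are enough for this, and being countable they allow exceptional null sets to be merged
  later.\<close>

lemma halfplane_identity:
  assumes "f holomorphic_on {z. Re z > 0}" "g holomorphic_on {z. Re z > 0}"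
    and eq: "\<And>x::real. x > 0 \<Longrightarrow> x \<in> \<rat> \<Longrightarrow> f (of_real x) = g (of_real x)" and "Re z > 0"
  shows "f z = g z"
proof -
  have "f z - g z = 0"
  proof (rule analytic_continuation[where f = "\<lambda>z. f z - g z" and S = "{z. Re z > 0}" and U = "complex_of_real ` ({0<..} \<inter> \<rat>)" and \<xi> = 1])
    show "(\<lambda>z. f z - g z) holomorphic_on {z. Re z > 0}"
      using assms by (intro holomorphic_intros)
    show "1 islimpt complex_of_real ` ({0<..} \<inter> \<rat>)"
    proof (rule islimpt_sequential[THEN iffD2], intro exI conjI allI)
      show "complex_of_real (1 + inverse (real (Suc n))) \<in> complex_of_real ` ({0<..} \<inter> \<rat>) - {1}" for n
        by (auto simp: of_real_eq_1_iff simp del: of_real_add of_real_inverse of_nat_Suc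
          intro!: imageI add_pos_pos Rats_add Rats_inverse Rats_of_nat)
      have "(\<lambda>n. complex_of_real (1 + inverse (real (Suc n)))) \<longlonglongrightarrow> of_real (1 + 0)"
        by (intro tendsto_of_real tendsto_add tendsto_const LIMSEQ_inverse_real_of_nat)
      then show "(\<lambda>n. complex_of_real (1 + inverse (real (Suc n)))) \<longlonglongrightarrow> 1" by simp
    qed
  qed (use assms in \<open>auto simp: open_halfspace_Re_gt intro!: convex_connected halfplane_convex\<close>)
  then show ?thesis by simp
qed

text \<open>Vanishing at rational points spreads to the half-plane by holomorphy; on the line Re z =
  1 the Laplace transform is the Fourier transform of exp (- t) f t.\<close>

lemma laplace_injective:
  fixes f :: "real \<Rightarrow> real"
  assumes int: "\<And>\<mu>. \<mu> > 0 \<Longrightarrow> \<mu> \<in> \<rat> \<Longrightarrow> set_integrable lborel {0<..} (\<lambda>t. exp (- \<mu> * t) * f t)"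
    and zero: "\<And>\<mu>. \<mu> > 0 \<Longrightarrow> \<mu> \<in> \<rat> \<Longrightarrow> laplace f \<mu> = 0"
  shows "AE t in lborel. t > 0 \<longrightarrow> f t = 0"
proof -
  define g where "g t = indicator {0<..} t * f t" for t
  have int'': "integrable lborel (\<lambda>t. exp (- \<mu> * t) * g t)" if "\<mu> > 0" "\<mu> \<in> \<rat>" for \<mu>
    using int[OF that] unfolding set_integrable_def g_def by (simp add: mult_ac)
  \<comment> \<open>Measurability of \<open>g\<close> is recovered from the integrable function at
    \<mu> = 1 by cancelling the exponential weight.\<close>
  have "(\<lambda>t. exp (1 * t) * (exp (- 1 * t) * g t)) \<in> borel_measurable lborel"
    by (rule borel_measurable_times[OF _ borel_measurable_integrable[OF int'']]) simp_all
  moreover have "(\<lambda>t. exp (1 * t) * (exp (- 1 * t) * g t)) = g"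
    by (simp add: mult.assoc[symmetric] exp_add[symmetric])
  ultimately have g_meas[measurable]: "g \<in> borel_measurable borel"
    by simp
  have int': "integrable lborel (\<lambda>t. exp (- \<mu> * t) * g t)" if pos: "\<mu> > 0" for \<mu>
  proof -
    \<comment> \<open>Since \<open>g\<close> lives on t > 0, a rational rate below \<mu> gives a
      dominating integrable function.\<close>
    obtain q :: real where q: "q \<in> \<rat>" "0 < q" "q < \<mu>" using Rats_dense_in_real[OF pos] by blast
    show ?thesis
    proof (rule Bochner_Integration.integrable_bound[OF int''[OF q(2,1)]])
      have "\<bar>exp (- \<mu> * t) * g t\<bar> \<le> \<bar>exp (- q * t) * g t\<bar>" for t
        using q by (cases "t > 0") (auto simp: abs_mult g_def intro!: mult_right_mono)
      then show "AE t in lborel. norm (exp (- \<mu> * t) * g t) \<le> norm (exp (- q * t) * g t)"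
        by simp
    qed measurable
  qed
  \<comment> \<open>The holomorphy lemma asks for a nonnegative variable. Truncating t at 0 changes
    nothing because \<open>g\<close> vanishes there.\<close>
  define X :: "real \<Rightarrow> real" where "X t = max 0 t" for t
  have Xg: "exp (- z * complex_of_real (X t)) * complex_of_real (g t) = exp (- z * complex_of_real t) * complex_of_real (g t)"
    "exp (- \<mu> * X t) * g t = exp (- \<mu> * t) * g t" for z \<mu> t
    by (auto simp: g_def X_def max_def indicator_def)
  define F where "F z = (LINT t|lborel. exp (- z * complex_of_real (X t)) * complex_of_real (g t))" for z
  have "F holomorphic_on {z. Re z > 0}"
    unfolding F_def[abs_def]
    by (rule laplace_transform_holomorphic) (simp_all only: Xg int', simp_all add: X_def[abs_def])
  moreover have "F (of_real \<mu>) = 0" if "\<mu> > 0" "\<mu> \<in> \<rat>" for \<mu>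
  proof -
    have "F (of_real \<mu>) = (LINT t|lborel. complex_of_real (exp (- \<mu> * t) * g t))"
      unfolding F_def Xg by (simp add: exp_of_real[symmetric])
    also have "\<dots> = of_real (laplace f \<mu>)"
      unfolding laplace_def set_lebesgue_integral_def integral_complex_of_real g_def by (simp add: mult_ac)
    finally show ?thesis using zero[OF that] by simp
  qed
  ultimately have F0: "F z = 0" if "Re z > 0" for z
    using halfplane_identity[of F "\<lambda>_. 0" z] that by auto
  have "fourier (\<lambda>t. exp (- t) * g t) \<xi> = F (1 - \<i> * of_real \<xi>)" for \<xi>
    unfolding fourier_def F_def Xg
    by (simp add: left_diff_distrib exp_diff exp_minus exp_of_real[symmetric] field_simps)
  then have "AE t in lborel. exp (- t) * g t = 0"
    using int'[of 1] F0 by (intro fourier_injective) auto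
  then show ?thesis by eventually_elim (auto simp: g_def)
qed


section \<open>Fourier inversion for laws with integrable characteristic function\<close>

text \<open>Half-open intervals are what the inversion formula delivers. They increase to open
  half-lines, so continuity from below leads to the uniqueness criterion on half-lines.\<close>

lemma measure_eqI_Ioc:
  fixes M N :: "real measure"
  assumes sets: "sets M = sets borel" "sets N = sets borel"
    and "finite_measure M" "\<And>a b. a \<le> b \<Longrightarrow> emeasure M {a<..b} = emeasure N {a<..b}"
  shows "M = N"
proof (rule measure_eqI_lessThan[OF sets])
  interpret M: finite_measure M by fact
  show "emeasure M {x<..} < \<infinity>" for x
    by (simp add: less_top[symmetric])
  fix x :: real
  have U: "{x<..} = (\<Union>i::nat. {x<..x + real i})"
  proof safe
    fix y assume "y > x"
    obtain i :: nat where "y - x \<le> real i" using real_arch_simple by blast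
    then have "y \<in> {x<..x + real i}" using \<open>y > x\<close> by auto
    then show "y \<in> (\<Union>i. {x<..x + real i})" by blast
  qed auto
  have *: "(SUP i. emeasure K {x<..x + real i}) = emeasure K {x<..}" if "sets K = sets borel" for K
  proof -
    have "{x<..x + real i} \<in> sets K" for i unfolding that by simp
    then have "range (\<lambda>i::nat. {x<..x + real i}) \<subseteq> sets K" by blast
    moreover have "incseq (\<lambda>i::nat. {x<..x + real i})"
      by (rule incseq_SucI, rule subsetI) simp
    ultimately show ?thesis
      unfolding U by (rule SUP_emeasure_incseq)
  qed
  have "emeasure M {x<..x + real i} = emeasure N {x<..x + real i}" for i
    by (intro assms) simp
  then show "emeasure M {x<..} = emeasure N {x<..}"
    by (simp only: *[OF sets(1), symmetric] *[OF sets(2), symmetric])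
qed

text \<open>Rewrites the kernel of Levy's inversion formula as an integral over the interval, which
  is what lets Fubini produce a density.\<close>

lemma integral_iexp_interval:
  fixes a b t :: real
  assumes "a \<le> b" "t \<noteq> 0"
  shows "(LINT x|lborel. indicator {a..b} x *\<^sub>R iexp (- (x * t))) = (iexp (- (t * a)) - iexp (- (t * b))) / (\<i> * t)"
proof -
  have "(LINT x|lborel. indicator {a..b} x *\<^sub>R iexp (- (x * t)))
      = (\<i> / t) * iexp (- (t * b)) - (\<i> / t) * iexp (- (t * a))"
  proof (rule integral_FTC_Icc[OF assms(1)])
    fix x
    show "((\<lambda>x. \<i> / complex_of_real t * iexp (- (t * x))) has_vector_derivative iexp (- (x * t))) (at x within {a..b})"
    proof -
      have "((\<lambda>z. \<i> / complex_of_real t * exp (- (\<i> * (t * z)))) has_field_derivative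
          exp (- (\<i> * (t * complex_of_real x)))) (at (of_real x))"
        using assms by (auto intro!: derivative_eq_intros simp: field_simps)
      then have "((\<lambda>x. \<i> / complex_of_real t * exp (- (\<i> * (t * complex_of_real x)))) has_vector_derivative
          exp (- (\<i> * (t * complex_of_real x)))) (at x within {a..b})"
        by (rule has_vector_derivative_real_field)
      then show ?thesis by (simp add: mult_ac)
    qed
  qed (auto intro!: continuous_intros)
  also have "\<dots> = (iexp (- (t * a)) - iexp (- (t * b))) / (\<i> * t)"
    using assms by (simp add: field_simps)
  finally show ?thesis .
qed

text \<open>The inverse Fourier integral with the sign convention of \<open>char\<close>. For a
  characteristic function its value is already real, by conjugate symmetry; \<open>Re\<close> only
  fixes the type.\<close>

definition inversion_density :: "(real \<Rightarrow> complex) \<Rightarrow> real \<Rightarrow> real" where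
  "inversion_density \<phi> x = Re (LINT t|lborel. iexp (- (x * t)) * \<phi> t) / (2 * pi)"

lemma integrable_iexp_mult:
  assumes "integrable lborel \<phi>"
  shows "integrable lborel (\<lambda>t. iexp (- (x * t)) * \<phi> t)"
proof (rule Bochner_Integration.integrable_bound[OF assms])
  show "(\<lambda>t. iexp (- (x * t)) * \<phi> t) \<in> borel_measurable lborel"
    using assms by measurable
qed (simp add: norm_mult)

lemma continuous_inversion_density:
  assumes "integrable lborel \<phi>"
  shows "continuous_on A (inversion_density \<phi>)"
proof -
  have "isCont (\<lambda>x. LINT t|lborel. iexp (- (x * t)) * \<phi> t) x" for x
    unfolding isCont_def
    by (rule integral_dominated_convergence_within[where w = "\<lambda>t. norm (\<phi> t)"])
      (use assms integrable_iexp_mult[OF assms] in \<open>auto simp: norm_mult intro!: tendsto_intros\<close>)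
  then have "isCont (inversion_density \<phi>) x" for x
    unfolding inversion_density_def by (intro continuous_intros) auto
  then show ?thesis by (simp add: continuous_at_imp_continuous_on)
qed

lemma inversion_density_le:
  assumes "integrable lborel \<phi>"
  shows "\<bar>inversion_density \<phi> x\<bar> \<le> (LINT t|lborel. norm (\<phi> t)) / (2 * pi)"
proof -
  have "\<bar>Re (LINT t|lborel. iexp (- (x * t)) * \<phi> t)\<bar> \<le> norm (LINT t|lborel. iexp (- (x * t)) * \<phi> t)"
    by (rule abs_Re_le_cmod)
  also have "\<dots> \<le> (LINT t|lborel. norm (iexp (- (x * t)) * \<phi> t))"
    by (rule integral_norm_bound)
  finally show ?thesis by (simp add: inversion_density_def norm_mult divide_right_mono)
qed

context real_distribution
begin

text \<open>Levy's formula gives a limit of truncated integrals. Integrability of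
  \<open>char M\<close> turns the limit into a full integral, and then the kernel is expanded over
  the interval and the order of integration exchanged. The endpoints must not be atoms, as in Levy's
  formula.\<close>

lemma measure_Ioc_eq_integral:
  assumes int: "integrable lborel (char M)" and "a \<le> b" "measure M {a} = 0" "measure M {b} = 0"
  shows "measure M {a<..b} = (LINT x:{a..b}|lborel. inversion_density (char M) x)"
proof -
  let ?k = "\<lambda>t. (iexp (- (t * a)) - iexp (- (t * b))) / (\<i> * t)"
  \<comment> \<open>The kernel is bounded by the length of the interval, so a multiple of the
    modulus of \<open>char M\<close> dominates all truncations.\<close>
  have k: "norm (?k t) \<le> b - a" if "t \<noteq> 0" for t
    using Levy_Inversion_aux2[of "-b" "-a" t] assms(2) that by simp
  have ck: "AE t in lborel. norm (?k t * char M t) \<le> (b - a) * norm (char M t)"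
    using AE_lborel_singleton[of "0::real"]
    by eventually_elim (simp only: norm_mult, intro mult_right_mono k norm_ge_zero)
  have [measurable]: "?k \<in> borel_measurable borel" by measurable
  have "(\<lambda>T. 1 / (2 * pi) * (CLBINT t=-ereal (real T)..ereal (real T). ?k t * char M t))
      \<longlonglongrightarrow> 1 / (2 * pi) * (LINT t|lborel. ?k t * char M t)"
  proof (intro tendsto_mult tendsto_const)
    have "(CLBINT t=-ereal (real T)..ereal (real T). ?k t * char M t)
        = (LINT t|lborel. indicator {- real T<..<real T} t *\<^sub>R (?k t * char M t))" for T
      by (simp add: interval_lebesgue_integral_def set_lebesgue_integral_def einterval_def greaterThanLessThan_def
        greaterThan_def lessThan_def Int_def)
    moreover have "(\<lambda>T. LINT t|lborel. indicator {- real T<..<real T} t *\<^sub>R (?k t * char M t))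
      \<longlonglongrightarrow> (LINT t|lborel. ?k t * char M t)"
    proof (rule integral_dominated_convergence[where w = "\<lambda>t. (b - a) * norm (char M t)"])
      show "AE t in lborel. (\<lambda>T. indicator {- real T<..<real T} t *\<^sub>R (?k t * char M t)) \<longlonglongrightarrow> ?k t * char M t"
      proof (rule AE_I2, rule tendsto_eventually)
        fix t :: real
        obtain N :: nat where "\<bar>t\<bar> < real N" using reals_Archimedean2 by blast
        then show "\<forall>\<^sub>F T in sequentially. indicator {- real T<..<real T} t *\<^sub>R (?k t * char M t) = ?k t * char M t"
          by (intro eventually_sequentiallyI[of N]) (simp add: indicator_def abs_less_iff)
      qed
      show "AE t in lborel. norm (indicator {- real T<..<real T} t *\<^sub>R (?k t * char M t)) \<le> (b - a) * norm (char M t)" for T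
        using ck by eventually_elim (use assms(2) in \<open>auto simp: indicator_def\<close>)
    qed (use int in auto)
    ultimately show "(\<lambda>T. CLBINT t=-ereal (real T)..ereal (real T). ?k t * char M t) \<longlonglongrightarrow> (LINT t|lborel. ?k t * char M t)"
      by simp
  qed
  then have 1: "complex_of_real (measure M {a<..b}) = 1 / (2 * pi) * (LINT t|lborel. ?k t * char M t)"
    using Levy_Inversion[OF assms(2-4)] LIMSEQ_unique by auto
  have "(LINT t|lborel. ?k t * char M t) = (LINT t|lborel. (LINT x|lborel. indicator {a..b} x *\<^sub>R iexp (- (x * t)) * char M t))"
  proof (rule integral_cong_AE)
    show "AE t in lborel. ?k t * char M t = (LINT x|lborel. indicator {a..b} x *\<^sub>R iexp (- (x * t)) * char M t)"
      using AE_lborel_singleton[of "0::real"]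
    proof eventually_elim
      case (elim t)
      have "(LINT x|lborel. indicator {a..b} x *\<^sub>R iexp (- (x * t)) * char M t)
          = (LINT x|lborel. indicator {a..b} x *\<^sub>R iexp (- (x * t))) * char M t"
        by (rule integral_mult_left_zero)
      then show ?case
        by (simp only: integral_iexp_interval[OF assms(2) elim])
    qed
  qed measurable
  also have "\<dots> = (LINT x|lborel. (LINT t|lborel. indicator {a..b} x *\<^sub>R iexp (- (x * t)) * char M t))"
  proof (rule lborel_pair.Fubini_integral, rule lborel_pair.Fubini_integrable)
    have "norm (indicator {a..b} x *\<^sub>R iexp (- (x * t)) * char M t) = indicator {a..b} x * norm (char M t)" for x t
      by (simp add: norm_mult indicator_def)
    then show "integrable lborel (\<lambda>x. LINT t|lborel. norm (case (x, t) of (x, t) \<Rightarrow> indicator {a..b} x *\<^sub>R iexp (- (x * t)) * char M t))"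
      by (simp only: prod.case integral_mult_right_zero)
        (intro integrable_mult_left integrable_real_indicator, simp_all add: emeasure_lborel_Icc_eq)
    show "AE x in lborel. integrable lborel (\<lambda>t. case (x, t) of (x, t) \<Rightarrow> indicator {a..b} x *\<^sub>R iexp (- (x * t)) * char M t)"
      using integrable_iexp_mult[OF int] by (auto simp: mult_scaleR_left)
  qed measurable
  also have "\<dots> = (LINT x|lborel. indicator {a..b} x *\<^sub>R (LINT t|lborel. iexp (- (x * t)) * char M t))"
    by (simp add: mult_scaleR_left)
  finally have 2: "complex_of_real (measure M {a<..b}) =
      1 / (2 * pi) * (LINT x|lborel. indicator {a..b} x *\<^sub>R (LINT t|lborel. iexp (- (x * t)) * char M t))"
    unfolding 1 by simp
  have cont: "isCont (\<lambda>x. LINT t|lborel. iexp (- (x * t)) * char M t) x" for x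
    unfolding isCont_def
    by (rule integral_dominated_convergence_within[where w = "\<lambda>t. norm (char M t)"])
      (use int integrable_iexp_mult[OF int] in \<open>auto simp: norm_mult intro!: tendsto_intros\<close>)
  then have "integrable lborel (\<lambda>x. indicator {a..b} x *\<^sub>R (LINT t|lborel. iexp (- (x * t)) * char M t))"
    by (intro borel_integrable_compact continuous_at_imp_continuous_on) auto
  then have "Re (LINT x|lborel. indicator {a..b} x *\<^sub>R (LINT t|lborel. iexp (- (x * t)) * char M t))
    = (LINT x|lborel. indicator {a..b} x *\<^sub>R Re (LINT t|lborel. iexp (- (x * t)) * char M t))"
    by (subst integral_Re[symmetric]) auto
  moreover have "measure M {a<..b} = Re (complex_of_real (measure M {a<..b}))" by simp
  ultimately show ?thesis
    unfolding 2 by (simp add: set_lebesgue_integral_def inversion_density_def)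
qed

text \<open>Atoms are countable while an interval is not; thus intervals admissible for the
  inversion formula exist near any point.\<close>

lemma nonatom_between:
  assumes "a < b"
  obtains x where "a < x" "x < b" "measure M {x} = 0"
proof -
  have "countable {x. measure M {x} \<noteq> 0}" by (rule countable_support)
  then have "uncountable ({a<..<b} - {x. measure M {x} \<noteq> 0})"
    using assms by (intro uncountable_minus_countable) (auto simp: uncountable_open_interval)
  then have "{a<..<b} - {x. measure M {x} \<noteq> 0} \<noteq> {}" by (metis countable_empty)
  then show ?thesis using that by auto
qed

text \<open>A negative value would persist on a neighbourhood by continuity, and an interval between
  two non-atoms inside it would have negative probability.\<close>

lemma inversion_density_nonneg:
  assumes int: "integrable lborel (char M)"
  shows "inversion_density (char M) x \<ge> 0"
proof (rule ccontr)
  let ?h = "inversion_density (char M)"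
  assume "\<not> ?h x \<ge> 0"
  then have neg: "?h x < 0" by simp
  have "isCont ?h x"
    using continuous_inversion_density[OF int, of UNIV] by (simp add: continuous_on_eq_continuous_at)
  then have "\<forall>\<^sub>F y in at x. ?h y < 0"
    using neg by (intro order_tendstoD(2)) (auto simp: isCont_def)
  then obtain d where d: "d > 0" "\<And>y. y \<noteq> x \<Longrightarrow> dist y x < d \<Longrightarrow> ?h y < 0"
    unfolding eventually_at by auto
  have d': "?h y < 0" if "\<bar>y - x\<bar> < d" for y
    using d(2)[of y] neg that by (cases "y = x") (auto simp: dist_real_def)
  obtain a where a: "x - d < a" "a < x" "measure M {a} = 0" using nonatom_between[of "x - d" x] d by auto
  obtain b where b: "x < b" "b < x + d" "measure M {b} = 0" using nonatom_between[of x "x + d"] d by auto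
  have meas: "set_integrable lborel {a..b} ?h"
    unfolding set_integrable_def by (intro borel_integrable_compact continuous_inversion_density int) auto
  have "(LINT y:{a..b}|lborel. ?h y) = 0"
  proof (rule antisym)
    have "0 \<le> (LINT y|lborel. - (indicator {a..b} y *\<^sub>R ?h y))"
      by (rule Bochner_Integration.integral_nonneg) (use a b d' in \<open>auto simp: indicator_def intro!: less_imp_le\<close>)
    then show "(LINT y:{a..b}|lborel. ?h y) \<le> 0"
      by (simp add: set_lebesgue_integral_def)
    show "0 \<le> (LINT y:{a..b}|lborel. ?h y)"
      using measure_Ioc_eq_integral[OF int _ a(3) b(3)] a b measure_nonneg[of M "{a<..b}"] by auto
  qed
  then have "integral\<^sup>L lborel (\<lambda>y. - (indicator {a..b} y *\<^sub>R ?h y)) = 0"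
    by (simp add: set_lebesgue_integral_def)
  moreover have "integral\<^sup>L lborel (\<lambda>y. - (indicator {a..b} y *\<^sub>R ?h y)) = 0 \<longleftrightarrow>
      (AE y in lborel. - (indicator {a..b} y *\<^sub>R ?h y) = 0)"
    using meas unfolding set_integrable_def
    by (intro integral_nonneg_eq_0_iff_AE)
      (use a b d' in \<open>auto simp: indicator_def intro!: less_imp_le\<close>)
  ultimately have "AE y in lborel. indicator {a..b} y *\<^sub>R ?h y = 0" by simp
  then have "AE y in lborel. y \<notin> {a..b}"
  proof eventually_elim
    case (elim y)
    then show ?case using a b d'[of y] by (cases "y \<in> {a..b}") (auto simp: abs_less_iff)
  qed
  then have "emeasure lborel {a..b} = 0"
    by (subst (asm) AE_iff_measurable[where N = "{a..b}"]) auto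
  then show False using a b by simp
qed

text \<open>The inversion density is bounded, so short intervals around a point, with non-atomic
  endpoints, have small mass.\<close>

lemma no_atom_of_integrable_char:
  assumes int: "integrable lborel (char M)"
  shows "measure M {x} = 0"
proof -
  define B where "B = (LINT t|lborel. norm (char M t)) / (2 * pi)"
  have B: "\<bar>inversion_density (char M) y\<bar> \<le> B" for y
    unfolding B_def by (rule inversion_density_le[OF int])
  then have "B \<ge> 0" by (meson abs_ge_zero order_trans)
  have "measure M {x} \<le> 0 + e" if "e > 0" for e
  proof -
    \<comment> \<open>Chosen so that an interval of length at most 2 d has mass at most 2 d (B + 1)
      = e; the added 1 avoids division by zero when B = 0.\<close>
    define d where "d = e / (2 * (B + 1))"
    have d: "d > 0" using that \<open>B \<ge> 0\<close> by (simp add: d_def)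
    obtain a where a: "x - d < a" "a < x" "measure M {a} = 0" using nonatom_between[of "x - d" x] d by auto
    obtain b where b: "x < b" "b < x + d" "measure M {b} = 0" using nonatom_between[of x "x + d"] d by auto
    have "measure M {x} \<le> measure M {a<..b}" using a b by (intro finite_measure_mono) auto
    also have "\<dots> = (LINT x:{a..b}|lborel. inversion_density (char M) x)"
      using a b by (intro measure_Ioc_eq_integral int) auto
    also have "\<dots> \<le> (LINT x:{a..b}|lborel. B)"
      unfolding set_lebesgue_integral_def
    proof (intro integral_mono borel_integrable_compact continuous_inversion_density int continuous_on_const)
      show "indicator {a..b} y *\<^sub>R inversion_density (char M) y \<le> indicator {a..b} y *\<^sub>R B" for y
        using B[of y] by (simp add: indicator_def abs_le_iff)
    qed auto
    also have "\<dots> = (b - a) * B" using a b by (simp add: set_lebesgue_integral_def)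
    also have "\<dots> \<le> 2 * d * (B + 1)" using a b \<open>B \<ge> 0\<close> by (intro mult_mono) auto
    also have "\<dots> = e" using \<open>B \<ge> 0\<close> by (simp add: d_def add_nonneg_eq_0_iff field_simps)
    finally show ?thesis by simp
  qed
  then have "measure M {x} \<le> 0" by (rule field_le_epsilon)
  then show ?thesis using measure_nonneg[of M "{x}"] by linarith
qed

text \<open>With atoms excluded the inversion formula covers every half-open interval, and these
  determine the law. Open and closed left endpoints differ by a Lebesgue null set.\<close>

theorem density_of_integrable_char:
  assumes int: "integrable lborel (char M)"
  shows "M = density lborel (\<lambda>x. ennreal (inversion_density (char M) x))"
proof (rule measure_eqI_Ioc)
  have [measurable]: "inversion_density (char M) \<in> borel_measurable borel"
    by (intro borel_measurable_continuous_onI continuous_inversion_density int)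
  fix a b :: real assume "a \<le> b"
  have "emeasure M {a<..b} = ennreal (LINT x|lborel. indicator {a..b} x *\<^sub>R inversion_density (char M) x)"
    using measure_Ioc_eq_integral[OF int \<open>a \<le> b\<close>] no_atom_of_integrable_char[OF int]
    by (simp add: emeasure_eq_measure set_lebesgue_integral_def)
  also have "\<dots> = (\<integral>\<^sup>+x. ennreal (indicator {a..b} x *\<^sub>R inversion_density (char M) x) \<partial>lborel)"
    using inversion_density_nonneg[OF int]
    by (intro nn_integral_eq_integral[symmetric] borel_integrable_compact continuous_inversion_density int)
      (auto simp: indicator_def)
  also have "\<dots> = (\<integral>\<^sup>+x. ennreal (inversion_density (char M) x) * indicator {a<..b} x \<partial>lborel)"
  proof (rule nn_integral_cong_AE)
    show "AE x in lborel. ennreal (indicator {a..b} x *\<^sub>R inversion_density (char M) x)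
      = ennreal (inversion_density (char M) x) * indicator {a<..b} x"
      using AE_lborel_singleton[of a] by eventually_elim (auto simp: indicator_def)
  qed
  finally show "emeasure M {a<..b} = emeasure (density lborel (\<lambda>x. ennreal (inversion_density (char M) x))) {a<..b}"
    by (simp add: emeasure_density)
qed (use finite_measure_axioms in auto)

end


section \<open>Injectivity of the double Laplace transform\<close>

text \<open>Fubini on the quadrant. The iterated integral in \<open>double_laplace\<close> becomes
  an integral over the product, hence linear in \<open>f\<close>, and the slices that
  \<open>laplace_injective\<close> needs are integrable for almost every t.\<close>

lemma double_laplace_eq_integral:
  fixes f :: "real \<Rightarrow> real \<Rightarrow> real"
  assumes "set_integrable (lborel \<Otimes>\<^sub>M lborel) ({0<..} \<times> {0<..}) (\<lambda>(x, t). exp (- \<gamma> * x - \<mu> * t) * f x t)"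
  shows "set_integrable lborel {0<..} (\<lambda>t. exp (- \<mu> * t) * laplace (\<lambda>x. f x t) \<gamma>)"
    and "double_laplace f \<gamma> \<mu> = (LINT p:{0<..} \<times> {0<..}|lborel \<Otimes>\<^sub>M lborel. case p of (x, t) \<Rightarrow> exp (- \<gamma> * x - \<mu> * t) * f x t)"
    and "AE t in lborel. t > 0 \<longrightarrow> set_integrable lborel {0<..} (\<lambda>x. exp (- \<gamma> * x) * f x t)"
proof -
  define k where "k x t = indicator ({0<..} \<times> {0<..}) (x, t) *\<^sub>R (exp (- \<gamma> * x - \<mu> * t) * f x t)" for x t
  have k_fun: "(\<lambda>(x, t). k x t) = (\<lambda>p. indicator ({0<..} \<times> {0<..}) p *\<^sub>R (case p of (x, t) \<Rightarrow> exp (- \<gamma> * x - \<mu> * t) * f x t))"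
    by (auto simp: fun_eq_iff k_def)
  have k: "integrable (lborel \<Otimes>\<^sub>M lborel) (\<lambda>(x, t). k x t)"
    using assms unfolding set_integrable_def k_fun .
  have k_eq: "k x t = indicator {0<..} t *\<^sub>R (exp (- \<mu> * t) * (indicator {0<..} x *\<^sub>R (exp (- \<gamma> * x) * f x t)))" for x t
    by (auto simp: k_def indicator_def mult_exp_exp[symmetric] exp_diff exp_minus field_simps)
  have inner: "(LINT x|lborel. k x t) = indicator {0<..} t *\<^sub>R (exp (- \<mu> * t) * laplace (\<lambda>x. f x t) \<gamma>)" for t
    unfolding k_eq laplace_def set_lebesgue_integral_def by simp
  show "set_integrable lborel {0<..} (\<lambda>t. exp (- \<mu> * t) * laplace (\<lambda>x. f x t) \<gamma>)"
    using lborel_pair.integrable_snd[OF k] unfolding set_integrable_def inner .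
  have "double_laplace f \<gamma> \<mu> = (LINT t|lborel. LINT x|lborel. k x t)"
    unfolding inner double_laplace_def laplace_def[of _ \<mu>] set_lebesgue_integral_def ..
  also have "\<dots> = integral\<^sup>L (lborel \<Otimes>\<^sub>M lborel) (\<lambda>(x, t). k x t)"
    by (rule lborel_pair.integral_snd[OF k])
  finally show "double_laplace f \<gamma> \<mu> = (LINT p:{0<..} \<times> {0<..}|lborel \<Otimes>\<^sub>M lborel. case p of (x, t) \<Rightarrow> exp (- \<gamma> * x - \<mu> * t) * f x t)"
    unfolding set_lebesgue_integral_def k_fun .
  show "AE t in lborel. t > 0 \<longrightarrow> set_integrable lborel {0<..} (\<lambda>x. exp (- \<gamma> * x) * f x t)"
    using lborel_pair.AE_integrable_snd[OF k]
  proof eventually_elim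
    case (elim t)
    show ?case
    proof
      assume "t > 0"
      then have "(\<lambda>x. k x t) = (\<lambda>x. exp (- \<mu> * t) * (indicator {0<..} x *\<^sub>R (exp (- \<gamma> * x) * f x t)))"
        by (simp add: k_eq)
      then show "set_integrable lborel {0<..} (\<lambda>x. exp (- \<gamma> * x) * f x t)"
        using elim unfolding set_integrable_def by simp
    qed
  qed
qed

text \<open>Injectivity in t for each fixed \<gamma> leaves a null set depending on \<gamma>;
  restricting to rational \<gamma> gives one null set of t outside which injectivity in x
  applies.\<close>

lemma double_laplace_injective:
  fixes f :: "real \<Rightarrow> real \<Rightarrow> real"
  assumes int: "\<And>\<gamma> \<mu>. \<gamma> > 0 \<Longrightarrow> \<mu> > 0 \<Longrightarrow>
      set_integrable (lborel \<Otimes>\<^sub>M lborel) ({0<..} \<times> {0<..}) (\<lambda>(x, t). exp (- \<gamma> * x - \<mu> * t) * f x t)"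
    and zero: "\<And>\<gamma> \<mu>. \<gamma> > 0 \<Longrightarrow> \<mu> > 0 \<Longrightarrow> double_laplace f \<gamma> \<mu> = 0"
  shows "AE (x, t) in lborel \<Otimes>\<^sub>M lborel. x > 0 \<and> t > 0 \<longrightarrow> f x t = 0"
proof -
  have "AE t in lborel. t > 0 \<longrightarrow> laplace (\<lambda>x. f x t) \<gamma> = 0" if "\<gamma> > 0" for \<gamma>
  proof (rule laplace_injective)
    fix \<mu> :: real assume "\<mu> > 0"
    show "set_integrable lborel {0<..} (\<lambda>t. exp (- \<mu> * t) * laplace (\<lambda>x. f x t) \<gamma>)"
      by (rule double_laplace_eq_integral(1)[OF int[OF that \<open>\<mu> > 0\<close>]])
    show "laplace (\<lambda>t. laplace (\<lambda>x. f x t) \<gamma>) \<mu> = 0"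
      using zero[OF that \<open>\<mu> > 0\<close>] by (simp add: double_laplace_def)
  qed
  then have "AE t in lborel. \<forall>\<gamma>\<in>{0<..} \<inter> \<rat>. t > 0 \<longrightarrow> laplace (\<lambda>x. f x t) \<gamma> = 0"
    by (subst AE_ball_countable) (auto intro: countable_Int2 countable_rat)
  moreover have "AE t in lborel. \<forall>\<gamma>\<in>{0<..} \<inter> \<rat>. t > 0 \<longrightarrow> set_integrable lborel {0<..} (\<lambda>x. exp (- \<gamma> * x) * f x t)"
    using double_laplace_eq_integral(3)[OF int[OF _ zero_less_one]]
    by (subst AE_ball_countable) (auto intro: countable_Int2 countable_rat)
  ultimately have AE: "AE t in lborel. t > 0 \<longrightarrow> (AE x in lborel. x > 0 \<longrightarrow> f x t = 0)"
  proof eventually_elim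
    case (elim t)
    then show ?case by (auto intro!: laplace_injective)
  qed
  \<comment> \<open>Passing from iterated to product null sets requires a measurable exceptional
    set. The function is recovered on the quadrant from the integrable kernel at \<gamma> = \<mu> =
    1 by cancelling the weight, and set to 0 elsewhere.\<close>
  define g where "g = (\<lambda>p :: real \<times> real. exp (fst p + snd p) * (indicator ({0<..} \<times> {0<..}) p *\<^sub>R (case p of (x, t) \<Rightarrow> exp (- 1 * x - 1 * t) * f x t)))"
  have [measurable]: "g \<in> borel_measurable (lborel \<Otimes>\<^sub>M lborel)"
    unfolding g_def using borel_measurable_integrable[OF int[OF zero_less_one zero_less_one, unfolded set_integrable_def]]
    by (intro borel_measurable_times) auto
  have g: "g (x, t) = 0 \<longleftrightarrow> (x > 0 \<and> t > 0 \<longrightarrow> f x t = 0)" for x t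
    by (auto simp: g_def indicator_def)
  have "AE t in lborel. AE x in lborel. g (x, t) = 0"
    using AE by eventually_elim (auto simp: g)
  moreover have sets: "{p \<in> space (lborel \<Otimes>\<^sub>M lborel). g p = 0} \<in> sets (lborel \<Otimes>\<^sub>M lborel)"
    by measurable
  ultimately have "AE x in lborel. AE t in lborel. g (x, t) = 0"
    by (subst lborel_pair.AE_commute) (simp_all only: prod.collapse)
  then have "AE p in lborel \<Otimes>\<^sub>M lborel. g p = 0"
    by (rule lborel_pair.AE_pair_measure[OF sets])
  then show ?thesis by eventually_elim (auto simp: g split: prod.splits)
qed

section \<open>The Laplace exponent\<close>

text \<open>Comparison with 1 / (1 + x^2). With n a \<ge> 2 and z = k |x|^a, the inequality (1 + z /
  n)^n \<le> exp z bounds x^2 by a constant times exp z when |x| > 1.\<close>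

lemma integrable_exp_neg_powr:
  fixes a k :: real
  assumes "a > 0" "k > 0"
  shows "integrable lborel (\<lambda>x. exp (- k * \<bar>x\<bar> powr a))"
proof -
  define n where "n = nat \<lceil>2 / a\<rceil>"
  have n: "n > 0" "real n * a \<ge> 2"
  proof -
    have "2 / a > 0" using assms by simp
    then show "n > 0" unfolding n_def by simp
    have "2 / a \<le> real n" unfolding n_def by linarith
    then show "real n * a \<ge> 2" using assms by (simp add: field_simps)
  qed
  \<comment> \<open>The constant for which (|x| powr a)^n equals K (z / n)^n.\<close>
  define K where "K = (real n / k) ^ n"
  have "K \<ge> 0" using assms by (simp add: K_def)
  have bound: "exp (- k * \<bar>x\<bar> powr a) \<le> (2 + 2 * K) * inverse (1 + x\<^sup>2)" for x :: real
  proof (cases "\<bar>x\<bar> \<le> 1")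
    case True
    then have "x\<^sup>2 \<le> 1" by (simp add: abs_square_le_1)
    then have "1 + x\<^sup>2 \<le> 2 + 2 * K" using \<open>K \<ge> 0\<close> by linarith
    then have "1 \<le> (2 + 2 * K) * inverse (1 + x\<^sup>2)"
      by (simp add: field_simps add_pos_nonneg)
    moreover have "exp (- k * \<bar>x\<bar> powr a) \<le> 1" using assms by simp
    ultimately show ?thesis by linarith
  next
    case False
    define z where "z = k * \<bar>x\<bar> powr a"
    have "z > 0" using False assms by (auto simp: z_def)
    have "x\<^sup>2 = \<bar>x\<bar> powr 2" using False by simp
    also have "\<dots> \<le> \<bar>x\<bar> powr (a * real n)" using n False by (intro powr_mono) (auto simp: mult_ac)
    also have "\<dots> = (\<bar>x\<bar> powr a) ^ n" using False by (simp add: powr_powr[symmetric] powr_realpow)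
    also have "\<dots> = K * (z / real n) ^ n"
    proof -
      have "(real n / k) * (z / real n) = \<bar>x\<bar> powr a" using assms n by (simp add: z_def)
      then show ?thesis unfolding K_def by (simp only: power_mult_distrib[symmetric])
    qed
    also have "(z / real n) ^ n \<le> (1 + z / real n) ^ n"
      using \<open>z > 0\<close> by (intro power_mono) auto
    also have "(1 + z / real n) ^ n \<le> exp z"
      using \<open>z > 0\<close> n by (intro exp_ge_one_plus_x_over_n_power_n) auto
    finally have 1: "x\<^sup>2 \<le> K * exp z" using \<open>K \<ge> 0\<close> by (simp add: mult_left_mono)
    have "x\<^sup>2 \<ge> 1" using False one_le_power[of "\<bar>x\<bar>" 2] by simp
    then have "1 + x\<^sup>2 \<le> 2 * (K * exp z)" using 1 by linarith
    also have "\<dots> \<le> (2 + 2 * K) * exp z" by (simp add: algebra_simps)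
    finally have "exp (- z) * (1 + x\<^sup>2) \<le> exp (- z) * ((2 + 2 * K) * exp z)"
      by (intro mult_left_mono) auto
    also have "\<dots> = 2 + 2 * K" by (simp add: exp_minus)
    finally have "exp (- z) \<le> (2 + 2 * K) / (1 + x\<^sup>2)"
      by (subst pos_le_divide_eq) (auto intro: add_pos_nonneg)
    then show ?thesis by (simp add: z_def divide_inverse)
  qed
  have "integrable lborel (\<lambda>x::real. inverse (1 + x\<^sup>2))"
    using integrable_inverse_1_plus_square by (simp add: set_integrable_def)
  then have "integrable lborel (\<lambda>x::real. (2 + 2 * K) * inverse (1 + x\<^sup>2))"
    by (rule integrable_mult_right)
  then show ?thesis
    by (rule Bochner_Integration.integrable_bound) (use bound in \<open>auto intro: order_trans[OF _ abs_ge_self]\<close>)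
qed

locale stable_sum =
  fixes m :: nat and \<nu> lam :: "nat \<Rightarrow> real"
  assumes m: "m \<ge> 1"
    and \<nu>: "\<And>j. j \<in> {1..m} \<Longrightarrow> 0 < \<nu> j \<and> \<nu> j < 1"
    and lam: "\<And>j. j \<in> {1..m} \<Longrightarrow> lam j > 0"
begin

definition psi :: "complex \<Rightarrow> complex" where
  "psi z = (\<Sum>j=1..m. complex_of_real (lam j) * z powr complex_of_real (\<nu> j))"

definition psi_real :: "real \<Rightarrow> real" where
  "psi_real \<mu> = (\<Sum>j=1..m. lam j * \<mu> powr \<nu> j)"

text \<open>The real part of \<open>psi\<close> on the negative imaginary axis: (-i \<xi>)^\<nu> has
  modulus \<xi>^\<nu> and argument - pi \<nu> / 2.\<close>

definition re_psi :: "real \<Rightarrow> real" where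
  "re_psi \<xi> = (\<Sum>j=1..m. lam j * cos (pi * \<nu> j / 2) * \<xi> powr \<nu> j)"

definition re_psi' :: "real \<Rightarrow> real" where
  "re_psi' \<xi> = (\<Sum>j=1..m. lam j * cos (pi * \<nu> j / 2) * (\<nu> j * \<xi> powr (\<nu> j - 1)))"

text \<open>The full complex derivative of \<open>psi\<close> along the imaginary axis, with respect
  to \<xi>; not an imaginary part.\<close>

definition im_psi' :: "real \<Rightarrow> complex" where
  "im_psi' \<xi> = (\<Sum>j=1..m. complex_of_real (lam j * (\<nu> j * \<xi> powr (\<nu> j - 1))) * exp (- \<i> * complex_of_real (pi * \<nu> j / 2)))"

text \<open>The smallest ratio of real part to modulus among the terms of the exponent; positive
  because every \<nu> is below 1.\<close>

definition cos_min :: real where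
  "cos_min = Min ((\<lambda>j. cos (pi * \<nu> j / 2)) ` {1..m})"

lemma cos_pos: "j \<in> {1..m} \<Longrightarrow> cos (pi * \<nu> j / 2) > 0"
  using \<nu>[of j] pi_gt_zero by (intro cos_gt_zero_pi) (auto simp: field_simps intro: order_less_trans[of _ 0])

lemma cos_min: "cos_min > 0" "j \<in> {1..m} \<Longrightarrow> cos_min \<le> cos (pi * \<nu> j / 2)"
  unfolding cos_min_def using m cos_pos by (auto simp: Min_gr_iff)

lemma psi_real_pos: "\<mu> > 0 \<Longrightarrow> psi_real \<mu> > 0"
  unfolding psi_real_def using m lam by (intro sum_pos) auto

lemma psi_of_real: "x \<ge> 0 \<Longrightarrow> psi (of_real x) = of_real (psi_real x)"
  by (simp add: psi_def psi_real_def powr_of_real)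

lemma holomorphic_psi: "psi holomorphic_on {z. Re z > 0}"
  unfolding psi_def[abs_def]
  by (intro holomorphic_intros) (auto simp: complex_nonpos_Reals_iff)

text \<open>Besides the slit plane the point 0 is allowed, where the powers are continuous because
  their exponents are positive. The imaginary axis passes through it.\<close>

lemma tendsto_psi:
  assumes "z \<notin> \<real>\<^sub>\<le>\<^sub>0 \<or> z = 0" "(f \<longlongrightarrow> z) F"
  shows "((\<lambda>x. psi (f x)) \<longlongrightarrow> psi z) F"
  unfolding psi_def using assms \<nu> by (intro tendsto_intros) auto

lemma imag_nonpos: "- \<i> * complex_of_real \<xi> \<notin> \<real>\<^sub>\<le>\<^sub>0 \<or> - \<i> * complex_of_real \<xi> = 0"
  by (auto simp: complex_nonpos_Reals_iff)

text \<open>The principal logarithm of - i \<xi> is ln \<xi> - i pi / 2 for \<xi> > 0.\<close>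

lemma powr_imag:
  assumes "\<xi> > 0"
  shows "(- \<i> * complex_of_real \<xi>) powr complex_of_real a = of_real (\<xi> powr a) * exp (- \<i> * complex_of_real (pi * a / 2))"
proof -
  have "Ln (- \<i> * complex_of_real \<xi>) = of_real (ln \<xi>) + Ln (- \<i>)"
    using Ln_times_of_real[OF assms, of "- \<i>"] Ln_of_real[OF assms] by (simp add: mult.commute)
  then have "(- \<i> * complex_of_real \<xi>) powr complex_of_real a = exp (of_real a * (of_real (ln \<xi>) - \<i> * pi / 2))"
    using assms by (simp add: powr_def)
  also have "\<dots> = exp (of_real (a * ln \<xi>)) * exp (- \<i> * complex_of_real (pi * a / 2))"
    by (simp add: exp_add[symmetric] algebra_simps)
  also have "exp (of_real (a * ln \<xi>)) = complex_of_real (\<xi> powr a)"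
    using assms by (simp add: powr_def exp_of_real[symmetric])
  finally show ?thesis .
qed

lemma psi_imag:
  assumes "\<xi> > 0"
  shows "psi (- \<i> * of_real \<xi>) = (\<Sum>j=1..m. complex_of_real (lam j * \<xi> powr \<nu> j) * exp (- \<i> * complex_of_real (pi * \<nu> j / 2)))"
  unfolding psi_def by (intro sum.cong refl) (simp only: powr_imag[OF assms] of_real_mult mult.assoc)

lemma Re_exp_imag: "Re (exp (- \<i> * complex_of_real (pi * a / 2))) = cos (pi * a / 2)"
  by (simp add: Re_exp)

lemma psi_cnj: "psi (- \<i> * of_real (- \<xi>)) = cnj (psi (- \<i> * of_real \<xi>))"
proof -
  have "cnj ((- \<i> * complex_of_real \<xi>) powr complex_of_real a) = (- \<i> * of_real (- \<xi>)) powr complex_of_real a" for a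
    by (subst cnj_powr) auto
  then show ?thesis unfolding psi_def by simp
qed

lemma Re_psi_imag: "Re (psi (- \<i> * of_real \<xi>)) = re_psi \<bar>\<xi>\<bar>"
proof -
  have pos: "Re (psi (- \<i> * of_real \<xi>)) = re_psi \<xi>" if "\<xi> > 0" for \<xi>
    unfolding psi_imag[OF that] re_psi_def Re_sum
  proof (intro sum.cong refl)
    fix j
    have *: "Re (complex_of_real c * z) = c * Re z" for c z by simp
    show "Re (complex_of_real (lam j * \<xi> powr \<nu> j) * exp (- \<i> * complex_of_real (pi * \<nu> j / 2))) = lam j * cos (pi * \<nu> j / 2) * \<xi> powr \<nu> j"
      by (simp only: Re_exp_imag *) simp
  qed
  consider "\<xi> > 0" | "\<xi> = 0" | "- \<xi> > 0" by linarith
  then show ?thesis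
  proof cases
    case 1
    then show ?thesis using pos by simp
  next
    case 2
    then show ?thesis by (simp add: psi_def re_psi_def)
  next
    case 3
    then have "Re (psi (- \<i> * of_real \<xi>)) = Re (psi (- \<i> * of_real (- \<xi>)))"
      by (simp only: psi_cnj cnj.sel)
    also have "\<dots> = re_psi (- \<xi>)" by (rule pos[OF 3])
    finally show ?thesis using 3 by simp
  qed
qed

text \<open>All summands are nonnegative, so one power may be kept alone; its growth is all that
  integrability and the limit at infinity need.\<close>

lemma re_psi_ge:
  assumes "\<xi> \<ge> 0"
  shows "re_psi \<xi> \<ge> lam 1 * cos (pi * \<nu> 1 / 2) * \<xi> powr \<nu> 1"
  unfolding re_psi_def using m lam cos_pos
  by (intro member_le_sum mult_nonneg_nonneg powr_ge_zero) (auto intro!: less_imp_le)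

lemma lead_pos: "lam 1 * cos (pi * \<nu> 1 / 2) > 0" "\<nu> 1 > 0"
  using lam[of 1] cos_pos[of 1] \<nu>[of 1] m by auto

lemma measurable_re_psi [measurable]: "re_psi \<in> borel_measurable borel"
  "re_psi' \<in> borel_measurable borel" "im_psi' \<in> borel_measurable borel"
  unfolding re_psi_def[abs_def] re_psi'_def[abs_def] im_psi'_def[abs_def] by measurable

section \<open>The characteristic function and its oscillatory integral\<close>

text \<open>Defined from the exponent alone, before any law is given; that it is the characteristic
  function of the sum at time \<open>y\<close> is shown in \<open>char_P\<close>.\<close>

definition char_fun :: "real \<Rightarrow> real \<Rightarrow> complex" where
  "char_fun y \<xi> = exp (- of_real y * psi (- \<i> * of_real \<xi>))"

lemma norm_char_fun: "norm (char_fun y \<xi>) = exp (- y * re_psi \<bar>\<xi>\<bar>)"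
  unfolding char_fun_def norm_exp_eq_Re using Re_psi_imag[of \<xi>] by simp

lemma char_fun_cnj: "char_fun y (- \<xi>) = cnj (char_fun y \<xi>)"
  unfolding char_fun_def psi_cnj by (simp add: exp_cnj)

lemma isCont_char_fun: "isCont (\<lambda>p. char_fun (fst p) (snd p)) p"
  unfolding isCont_def char_fun_def
  by (intro tendsto_intros tendsto_psi imag_nonpos)

lemma measurable_char_fun [measurable]: "(\<lambda>(y, \<xi>). char_fun y \<xi>) \<in> borel_measurable (borel \<Otimes>\<^sub>M borel)"
  unfolding borel_prod case_prod_beta
  by (intro borel_measurable_continuous_onI continuous_at_imp_continuous_on ballI isCont_char_fun)

lemma measurable_cf' [measurable]: "char_fun y \<in> borel_measurable borel"
  using measurable_compose_Pair1[OF _ measurable_char_fun, of y] by simp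

lemma integrable_exp_re_psi:
  assumes "y > 0"
  shows "integrable lborel (\<lambda>\<xi>. exp (- y * re_psi \<bar>\<xi>\<bar>))"
proof (rule Bochner_Integration.integrable_bound)
  show "integrable lborel (\<lambda>\<xi>. exp (- (y * (lam 1 * cos (pi * \<nu> 1 / 2))) * \<bar>\<xi>\<bar> powr \<nu> 1))"
    using lead_pos assms by (intro integrable_exp_neg_powr) auto
  show "AE \<xi> in lborel. norm (exp (- y * re_psi \<bar>\<xi>\<bar>)) \<le>
      norm (exp (- (y * (lam 1 * cos (pi * \<nu> 1 / 2))) * \<bar>\<xi>\<bar> powr \<nu> 1))"
    using re_psi_ge assms by (auto simp: mult.assoc)
qed measurable

lemma integrable_char_fun: "y > 0 \<Longrightarrow> integrable lborel (char_fun y)"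
  by (rule Bochner_Integration.integrable_bound[OF integrable_exp_re_psi[of y]]) (auto simp: norm_char_fun)

lemma deriv_re_psi: "\<xi> > 0 \<Longrightarrow> (re_psi has_real_derivative re_psi' \<xi>) (at \<xi>)"
  unfolding re_psi_def[abs_def] re_psi'_def
  by (intro DERIV_sum DERIV_cmult has_real_derivative_powr)

lemma deriv_psi_imag:
  assumes "\<xi> > 0"
  shows "((\<lambda>\<xi>. psi (- \<i> * of_real \<xi>)) has_vector_derivative im_psi' \<xi>) (at \<xi>)"
proof (rule has_vector_derivative_transform_within_open[of "\<lambda>\<xi>. \<Sum>j=1..m. complex_of_real (lam j * \<xi> powr \<nu> j) * exp (- \<i> * complex_of_real (pi * \<nu> j / 2))" _ _ "{0<..}"])
  have "((\<lambda>\<xi>. complex_of_real (lam j * \<xi> powr \<nu> j) * exp (- \<i> * complex_of_real (pi * \<nu> j / 2))) has_vector_derivative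
     complex_of_real (lam j * (\<nu> j * \<xi> powr (\<nu> j - 1))) * exp (- \<i> * complex_of_real (pi * \<nu> j / 2))) (at \<xi>)" for j
    using assms
    by (intro has_vector_derivative_mult_left has_vector_derivative_of_real)
      (simp add: has_real_derivative_iff_has_vector_derivative[symmetric] DERIV_cmult has_real_derivative_powr)
  then show "((\<lambda>\<xi>. \<Sum>j=1..m. complex_of_real (lam j * \<xi> powr \<nu> j) * exp (- \<i> * complex_of_real (pi * \<nu> j / 2))) has_vector_derivative im_psi' \<xi>) (at \<xi>)"
    unfolding im_psi'_def by (intro has_vector_derivative_sum)
qed (use assms psi_imag in auto)

text \<open>Each term of the derivative has its real part equal to its modulus times a cosine, and
  all these cosines are at least \<open>cos_min\<close>.\<close>

lemma norm_im_psi':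
  assumes "\<xi> > 0"
  shows "norm (im_psi' \<xi>) \<le> re_psi' \<xi> / cos_min"
proof -
  have "norm (im_psi' \<xi>) \<le> (\<Sum>j=1..m. norm (complex_of_real (lam j * (\<nu> j * \<xi> powr (\<nu> j - 1))) * exp (- \<i> * complex_of_real (pi * \<nu> j / 2))))"
    unfolding im_psi'_def by (rule norm_sum)
  also have "\<dots> = (\<Sum>j=1..m. lam j * (\<nu> j * \<xi> powr (\<nu> j - 1)))"
    using lam \<nu> by (intro sum.cong refl) (auto simp: norm_mult less_imp_le abs_mult)
  also have "\<dots> \<le> (\<Sum>j=1..m. lam j * cos (pi * \<nu> j / 2) * (\<nu> j * \<xi> powr (\<nu> j - 1)) / cos_min)"
  proof (rule sum_mono)
    fix j assume j: "j \<in> {1..m}"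
    have "lam j * (\<nu> j * \<xi> powr (\<nu> j - 1)) * cos_min \<le> lam j * (\<nu> j * \<xi> powr (\<nu> j - 1)) * cos (pi * \<nu> j / 2)"
      using cos_min(2)[OF j] lam[OF j] \<nu>[OF j] by (intro mult_left_mono) auto
    then show "lam j * (\<nu> j * \<xi> powr (\<nu> j - 1)) \<le> lam j * cos (pi * \<nu> j / 2) * (\<nu> j * \<xi> powr (\<nu> j - 1)) / cos_min"
      using cos_min(1) by (simp add: pos_le_divide_eq mult_ac)
  qed
  also have "\<dots> = re_psi' \<xi> / cos_min"
    unfolding re_psi'_def by (simp add: sum_divide_distrib)
  finally show ?thesis .
qed

lemma re_psi'_nonneg: "\<xi> > 0 \<Longrightarrow> re_psi' \<xi> \<ge> 0"
  unfolding re_psi'_def using lam cos_pos \<nu> by (intro sum_nonneg mult_nonneg_nonneg) (auto intro: less_imp_le)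

lemma re_psi_at_top: "filterlim re_psi at_top at_top"
proof (rule filterlim_at_top_mono)
  show "filterlim (\<lambda>\<xi>. lam 1 * cos (pi * \<nu> 1 / 2) * \<xi> powr \<nu> 1) at_top at_top"
    using lead_pos by (intro filterlim_tendsto_pos_mult_at_top[OF tendsto_const] real_powr_at_top) auto
  show "\<forall>\<^sub>F \<xi> in at_top. lam 1 * cos (pi * \<nu> 1 / 2) * \<xi> powr \<nu> 1 \<le> re_psi \<xi>"
    using eventually_ge_at_top[of 0] by eventually_elim (rule re_psi_ge)
qed

lemma exp_re_psi_at_top:
  assumes "y > 0"
  shows "((\<lambda>\<xi>. exp (- y * re_psi \<xi>)) \<longlongrightarrow> 0) at_top"
proof -
  have "filterlim (\<lambda>\<xi>. y * re_psi \<xi>) at_top at_top"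
    using assms by (intro filterlim_tendsto_pos_mult_at_top[OF tendsto_const] re_psi_at_top) auto
  then have "filterlim (\<lambda>\<xi>. - (y * re_psi \<xi>)) at_bot at_top"
    by (simp add: filterlim_uminus_at_bot)
  then show ?thesis
    by (simp add: filterlim_compose[OF exp_at_bot])
qed

lemma re_psi_at_0: "(re_psi \<longlongrightarrow> 0) (at_right 0)"
proof -
  have "((\<lambda>\<xi>. \<Sum>j=1..m. lam j * cos (pi * \<nu> j / 2) * \<xi> powr \<nu> j) \<longlongrightarrow>
      (\<Sum>j=1..m. lam j * cos (pi * \<nu> j / 2) * 0 powr \<nu> j)) (at_right 0)"
    using \<nu> by (intro tendsto_intros) (auto simp: eventually_at_right_less intro: eventually_mono[OF eventually_at_right_less])
  then show ?thesis by (simp add: re_psi_def[abs_def])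
qed

text \<open>The integrand is the derivative of - exp (- y * re_psi), which rises from -1 to 0. That
  the total is 1 for every \<open>y\<close> is the source of the bound uniform in time.\<close>

lemma integral_re_psi':
  assumes "y > 0"
  shows "set_integrable lborel {0<..} (\<lambda>\<xi>. y * re_psi' \<xi> * exp (- y * re_psi \<xi>))"
    and "(LINT \<xi>:{0<..}|lborel. y * re_psi' \<xi> * exp (- y * re_psi \<xi>)) = 1"
proof -
  have d: "((\<lambda>\<xi>. - exp (- y * re_psi \<xi>)) has_real_derivative y * re_psi' \<xi> * exp (- y * re_psi \<xi>)) (at \<xi>)"
    if "\<xi> > 0" for \<xi>
    using deriv_re_psi[OF that] by (auto intro!: derivative_eq_intros)
  have c: "isCont (\<lambda>\<xi>. y * re_psi' \<xi> * exp (- y * re_psi \<xi>)) \<xi>" if "\<xi> > 0" for \<xi>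
  proof -
    have "isCont re_psi \<xi>" using deriv_re_psi[OF that] by (rule DERIV_isCont)
    moreover have "isCont re_psi' \<xi>"
      unfolding re_psi'_def[abs_def] using that by (intro continuous_intros) auto
    ultimately show ?thesis by (intro continuous_intros)
  qed
  have lim: "((\<lambda>\<xi>. - exp (- y * re_psi \<xi>)) \<longlongrightarrow> - 1) (at_right 0)"
    "((\<lambda>\<xi>. - exp (- y * re_psi \<xi>)) \<longlongrightarrow> - 0) at_top"
    using tendsto_minus[OF tendsto_exp[OF tendsto_mult[OF tendsto_const re_psi_at_0, of "- y"]]]
      tendsto_minus[OF exp_re_psi_at_top[OF assms]] by simp_all
  note FTC = interval_integral_FTC_nonneg[where a = "ereal 0" and b = \<infinity> and F = "\<lambda>\<xi>. - exp (- y * re_psi \<xi>)"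
      and f = "\<lambda>\<xi>. y * re_psi' \<xi> * exp (- y * re_psi \<xi>)" and A = "- 1" and B = "- 0"]
  have "set_integrable lborel (einterval (ereal 0) \<infinity>) (\<lambda>\<xi>. y * re_psi' \<xi> * exp (- y * re_psi \<xi>))"
    by (rule FTC(1)) (use d c lim assms re_psi'_nonneg in \<open>auto simp: ereal_tendsto_simps\<close>)
  moreover have "(LBINT \<xi>=ereal 0..\<infinity>. y * re_psi' \<xi> * exp (- y * re_psi \<xi>)) = - 0 - (- 1)"
    by (rule FTC(2)) (use d c lim assms re_psi'_nonneg in \<open>auto simp: ereal_tendsto_simps\<close>)
  ultimately show "set_integrable lborel {0<..} (\<lambda>\<xi>. y * re_psi' \<xi> * exp (- y * re_psi \<xi>))"
    "(LINT \<xi>:{0<..}|lborel. y * re_psi' \<xi> * exp (- y * re_psi \<xi>)) = 1"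
    by (simp_all add: interval_integral_to_infinity_eq)
qed

text \<open>Integration by parts in the inversion integral: the factor \<open>s\<close> is traded for the derivative of
  the exponent, whose integral against the modulus of the characteristic function is bounded
  independently of \<open>y\<close>.\<close>

lemma half_inversion_bound:
  assumes y: "y > 0" and s: "s > 0"
  shows "\<bar>Re (LINT \<xi>:{0<..}|lborel. iexp (- (s * \<xi>)) * char_fun y \<xi>)\<bar> \<le> 1 / (cos_min * s)"
proof -
  define E where "E \<xi> = iexp (- (s * \<xi>)) * char_fun y \<xi>" for \<xi>
  have E_exp: "E \<xi> = exp (- (\<i> * of_real s * of_real \<xi>) - of_real y * psi (- \<i> * of_real \<xi>))" for \<xi>
    by (simp add: E_def char_fun_def exp_add[symmetric] mult.assoc)
  have [measurable]: "E \<in> borel_measurable borel" unfolding E_def[abs_def] by measurable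
  have norm_E: "norm (E \<xi>) = exp (- y * re_psi \<bar>\<xi>\<bar>)" for \<xi>
    by (simp add: E_def norm_mult norm_char_fun del: of_real_mult of_real_minus)
  have E_int: "set_integrable lborel {0<..} E"
    using integrable_iexp_mult[OF integrable_char_fun[OF y], of s]
    unfolding set_integrable_def E_def by (intro integrable_mult_indicator) auto
  have P_int: "set_integrable lborel {0<..} (\<lambda>\<xi>. of_real y * im_psi' \<xi> * E \<xi>)"
    and P_bound: "norm (LINT \<xi>:{0<..}|lborel. of_real y * im_psi' \<xi> * E \<xi>) \<le> 1 / cos_min"
  proof -
    have le: "norm (of_real y * im_psi' \<xi> * E \<xi>) \<le> (y * re_psi' \<xi> * exp (- y * re_psi \<xi>)) / cos_min" if "\<xi> > 0" for \<xi>
    proof -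
      have "norm (of_real y * im_psi' \<xi> * E \<xi>) = y * norm (im_psi' \<xi>) * exp (- y * re_psi \<xi>)"
        using y that by (simp add: norm_mult norm_E)
      also have "\<dots> \<le> y * (re_psi' \<xi> / cos_min) * exp (- y * re_psi \<xi>)"
        using y that by (intro mult_right_mono mult_left_mono norm_im_psi') auto
      finally show ?thesis by simp
    qed
    have dom: "set_integrable lborel {0<..} (\<lambda>\<xi>. (y * re_psi' \<xi> * exp (- y * re_psi \<xi>)) / cos_min)"
      using integral_re_psi'(1)[OF y] by (rule set_integrable_divide) 
    show 1: "set_integrable lborel {0<..} (\<lambda>\<xi>. of_real y * im_psi' \<xi> * E \<xi>)"
      by (rule set_integrable_bound[OF dom])
        (simp add: set_borel_measurable_def, rule AE_I2, rule impI, simp only: greaterThan_iff real_norm_def,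
          rule order_trans[OF le abs_ge_self], assumption)
    have "norm (LINT \<xi>:{0<..}|lborel. of_real y * im_psi' \<xi> * E \<xi>)
        \<le> (LINT \<xi>:{0<..}|lborel. norm (of_real y * im_psi' \<xi> * E \<xi>))"
      by (rule set_integral_norm_bound[OF 1])
    also have "\<dots> \<le> (LINT \<xi>:{0<..}|lborel. (y * re_psi' \<xi> * exp (- y * re_psi \<xi>)) / cos_min)"
      using le by (intro set_integral_mono dom set_integrable_norm 1) auto
    also have "\<dots> = 1 / cos_min"
      using integral_re_psi'(2)[OF y] by simp
    finally show "norm (LINT \<xi>:{0<..}|lborel. of_real y * im_psi' \<xi> * E \<xi>) \<le> 1 / cos_min" .
  qed
  \<comment> \<open>The integrand is the derivative of \<open>E\<close>, which tends to 0 at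
    infinity and to 1 at 0. The powers in the exponent are not differentiable at 0, so the
    fundamental theorem is used on the open half-line with one-sided limits.\<close>
  have E_eq: "(LINT \<xi>:{0<..}|lborel. - (\<i> * of_real s) * E \<xi> - of_real y * im_psi' \<xi> * E \<xi>) = 0 - 1"
  proof -
    have int: "set_integrable lborel {0<..} (\<lambda>\<xi>. - (\<i> * of_real s) * E \<xi> - of_real y * im_psi' \<xi> * E \<xi>)"
      using E_int P_int by (intro set_integral_diff set_integrable_mult_right) auto
    have der: "(E has_vector_derivative - (\<i> * of_real s) * E \<xi> - of_real y * im_psi' \<xi> * E \<xi>) (at \<xi>)" if "\<xi> > 0" for \<xi>
    proof -
      have "((\<lambda>\<xi>. - (\<i> * of_real s * of_real \<xi>) - of_real y * psi (- \<i> * of_real \<xi>)) has_vector_derivative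
          - (\<i> * of_real s) - of_real y * im_psi' \<xi>) (at \<xi>)"
        by (rule derivative_eq_intros deriv_psi_imag[OF that] refl)+ (simp)
      then have "(exp \<circ> (\<lambda>\<xi>. - (\<i> * of_real s * of_real \<xi>) - of_real y * psi (- \<i> * of_real \<xi>)) has_vector_derivative
          (- (\<i> * of_real s) - of_real y * im_psi' \<xi>) * E \<xi>) (at \<xi>)"
        unfolding E_exp by (rule field_vector_diff_chain_at) (rule DERIV_exp)
      moreover have "exp \<circ> (\<lambda>\<xi>. - (\<i> * of_real s * of_real \<xi>) - of_real y * psi (- \<i> * of_real \<xi>)) = E"
        by (simp add: fun_eq_iff E_exp)
      ultimately show ?thesis by (simp add: left_diff_distrib)
    qed
    have cont: "isCont (\<lambda>\<xi>. - (\<i> * of_real s) * E \<xi> - of_real y * im_psi' \<xi> * E \<xi>) \<xi>" if "\<xi> > 0" for \<xi>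
    proof -
      have "isCont E \<xi>" using der[OF that] by (rule has_vector_derivative_continuous)
      moreover have "isCont im_psi' \<xi>"
        unfolding im_psi'_def[abs_def] using that by (intro continuous_intros) auto
      ultimately show ?thesis by (intro continuous_intros)
    qed
    have "(LBINT \<xi>=ereal 0..\<infinity>. - (\<i> * of_real s) * E \<xi> - of_real y * im_psi' \<xi> * E \<xi>) = 0 - 1"
    proof (rule interval_integral_FTC_integrable[where F = E])
      have "isCont E 0"
        unfolding E_exp isCont_def by (intro tendsto_intros tendsto_psi imag_nonpos)
      then have "(E \<longlongrightarrow> E 0) (at_right 0)"
        by (simp add: isCont_def filterlim_at_split)
      moreover have "E 0 = 1" by (simp add: E_exp psi_def)
      ultimately show "((E \<circ> real_of_ereal) \<longlongrightarrow> 1) (at_right (ereal 0))"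
        by (simp add: ereal_tendsto_simps)
      have "((\<lambda>\<xi>. norm (E \<xi>)) \<longlongrightarrow> 0) at_top"
        by (rule Lim_transform_eventually[OF exp_re_psi_at_top[OF y]])
          (use eventually_ge_at_top[of 0] in eventually_elim, simp add: norm_E)
      then show "((E \<circ> real_of_ereal) \<longlongrightarrow> 0) (at_left \<infinity>)"
        by (simp add: ereal_tendsto_simps tendsto_norm_zero_iff)
    qed (use der cont int in auto)
    then show ?thesis by (simp add: interval_integral_to_infinity_eq)
  qed
  define A where "A = (LINT \<xi>:{0<..}|lborel. E \<xi>)"
  define B where "B = (LINT \<xi>:{0<..}|lborel. of_real y * im_psi' \<xi> * E \<xi>)"
  have "- (\<i> * of_real s) * A - B = - 1"
    using E_eq unfolding A_def B_def
    by (simp only: set_integral_diff(2)[OF set_integrable_mult_right[OF E_int] P_int] set_integral_mult_right) simp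
  \<comment> \<open>The boundary term is real, so it disappears from the imaginary part, and what
    remains relates the real part of \<open>A\<close> to \<open>B\<close> divided by
    \<open>s\<close>.\<close>
  then have "Im (- (\<i> * of_real s) * A - B) = Im (- 1)" by (rule arg_cong)
  then have "s * Re A = - Im B" by simp
  then have "\<bar>Re A\<bar> = \<bar>Im B\<bar> / s"
    using s abs_mult[of s "Re A"] by (simp add: field_simps)
  also have "\<dots> \<le> norm B / s" using s by (intro divide_right_mono abs_Im_le_cmod) auto
  also have "\<dots> \<le> (1 / cos_min) / s"
    using P_bound s unfolding B_def by (intro divide_right_mono) auto
  finally show ?thesis unfolding A_def E_def by simp
qed

end

section \<open>Densities of the sum and of its inverse\<close>

text \<open>The set where the functions differ is open, and a nonempty open set is not
  negligible.\<close>

lemma continuous_AE_eq_imp_eq: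
  fixes f g :: "real \<Rightarrow> real"
  assumes "open U" "continuous_on U f" "continuous_on U g"
    and AE: "AE x in lborel. x \<in> U \<longrightarrow> f x = g x" and "x \<in> U"
  shows "f x = g x"
proof -
  define N where "N = U \<inter> (\<lambda>x. f x - g x) -` (- {0})"
  have "open N"
    unfolding N_def using assms by (intro continuous_open_preimage continuous_intros) auto
  then have [measurable]: "N \<in> sets borel" by simp
  have "AE x in lborel. x \<notin> N"
    using AE by eventually_elim (auto simp: N_def)
  then have "N \<in> null_sets lborel"
    by (subst (asm) AE_iff_null_sets[symmetric]) auto
  then have "negligible N"
    by (simp add: negligible_iff_null_sets null_sets_completionI)
  then have "N = {}" using open_not_negligible[OF \<open>open N\<close>] by blast
  then show ?thesis using \<open>x \<in> U\<close> by (auto simp: N_def)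
qed

text \<open>Euler's integral for Gamma after the substitution t = \<mu> r.\<close>

lemma nn_integral_powr_exp:
  fixes a \<mu> :: real
  assumes "a < 1" "\<mu> > 0"
  shows "(\<integral>\<^sup>+r. ennreal (indicator {0<..} r * (r powr (- a) * exp (- \<mu> * r))) \<partial>lborel)
    = ennreal (Gamma (1 - a) * \<mu> powr (a - 1))"
proof -
  let ?I = "\<integral>\<^sup>+r. ennreal (indicator {0<..} r * (r powr (- a) * exp (- \<mu> * r))) \<partial>lborel"
  have "ennreal (Gamma (1 - a)) = \<integral>\<^sup>+t. ennreal (indicator {0..} t * t powr (1 - a - 1) / exp t) \<partial>lborel"
    using assms by (intro Gamma_conv_nn_integral_real) simp
  also have "\<dots> = ennreal \<bar>\<mu>\<bar> * (\<integral>\<^sup>+r. ennreal (indicator {0..} (0 + \<mu> * r) * (0 + \<mu> * r) powr (1 - a - 1) / exp (0 + \<mu> * r)) \<partial>lborel)"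
    using assms by (intro nn_integral_real_affine) auto
  also have "(\<lambda>r. ennreal (indicator {0..} (0 + \<mu> * r) * (0 + \<mu> * r) powr (1 - a - 1) / exp (0 + \<mu> * r)))
     = (\<lambda>r. ennreal (\<mu> powr (- a)) * ennreal (indicator {0<..} r * (r powr (- a) * exp (- \<mu> * r))))"
    using assms
    by (auto simp: fun_eq_iff indicator_def ennreal_mult[symmetric] powr_mult exp_minus field_simps zero_le_mult_iff)
  also have "ennreal \<bar>\<mu>\<bar> * (\<integral>\<^sup>+r. ennreal (\<mu> powr (- a)) * ennreal (indicator {0<..} r * (r powr (- a) * exp (- \<mu> * r))) \<partial>lborel)
     = ennreal (\<mu> powr (1 - a)) * ?I"
  proof -
    have "\<mu> * \<mu> powr (- a) = \<mu> powr (1 - a)"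
      using assms by (simp add: powr_diff powr_minus field_simps)
    moreover have "(\<integral>\<^sup>+r. ennreal (\<mu> powr (- a)) * ennreal (indicator {0<..} r * (r powr (- a) * exp (- \<mu> * r))) \<partial>lborel)
        = ennreal (\<mu> powr (- a)) * ?I"
      by (intro nn_integral_cmult) measurable
    ultimately show ?thesis using assms by (simp only: mult.assoc[symmetric]) (simp add: ennreal_mult[symmetric])
  qed
  finally have "ennreal (\<mu> powr (a - 1)) * ennreal (Gamma (1 - a)) = ennreal (\<mu> powr (a - 1)) * (ennreal (\<mu> powr (1 - a)) * ?I)"
    by simp
  also have "\<dots> = ?I"
    using assms by (simp add: mult.assoc[symmetric] ennreal_mult[symmetric] powr_add[symmetric])
  finally show ?thesis using assms by (simp add: ennreal_mult[symmetric] mult.commute)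
qed

context stable_sum
begin

text \<open>\<open>s\<close> is the point in space and \<open>y\<close> the time of the sum; the
  inversion integral converges absolutely for y > 0.\<close>

definition space_density :: "real \<Rightarrow> real \<Rightarrow> real" where
  "space_density s y = inversion_density (char_fun y) s"

lemma measurable_space_density [measurable]: "(\<lambda>(s, y). space_density s y) \<in> borel_measurable (borel \<Otimes>\<^sub>M borel)"
  unfolding space_density_def inversion_density_def case_prod_beta by measurable

lemma continuous_on_space_density: "y > 0 \<Longrightarrow> continuous_on A (\<lambda>s. space_density s y)"
  unfolding space_density_def by (intro continuous_inversion_density integrable_char_fun)

text \<open>The integrand takes conjugate values at \<xi> and - \<xi>, so its real part is even and
  the line folds onto the half-line treated by \<open>half_inversion_bound\<close>.\<close>

lemma space_density_half:
  assumes "y > 0"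
  shows "space_density s y = Re (LINT \<xi>:{0<..}|lborel. iexp (- (s * \<xi>)) * char_fun y \<xi>) / pi"
proof -
  define E where "E \<xi> = iexp (- (s * \<xi>)) * char_fun y \<xi>" for \<xi>
  have E: "integrable lborel E"
    unfolding E_def[abs_def] by (rule integrable_iexp_mult[OF integrable_char_fun[OF assms]])
  define f where "f \<xi> = Re (E \<xi>)" for \<xi>
  have f: "integrable lborel f" unfolding f_def[abs_def] using E by (rule integrable_Re)
  have f_neg: "f (- \<xi>) = f \<xi>" for \<xi>
  proof -
    have "E (- \<xi>) = cnj (E \<xi>)"
      by (simp add: E_def char_fun_cnj exp_cnj)
    then show ?thesis by (simp add: f_def)
  qed
  have "(LINT \<xi>|lborel. f \<xi>) = (LINT \<xi>|lborel. indicator {0<..} \<xi> *\<^sub>R f \<xi> + indicator {..<0} \<xi> *\<^sub>R f \<xi>)"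
  proof (rule integral_cong_AE)
    show "AE \<xi> in lborel. f \<xi> = indicator {0<..} \<xi> *\<^sub>R f \<xi> + indicator {..<0} \<xi> *\<^sub>R f \<xi>"
      using AE_lborel_singleton[of 0] by eventually_elim (auto simp: indicator_def)
  qed (use f in auto)
  also have "\<dots> = (LINT \<xi>|lborel. indicator {0<..} \<xi> *\<^sub>R f \<xi>) + (LINT \<xi>|lborel. indicator {..<0} \<xi> *\<^sub>R f \<xi>)"
    using f by (intro Bochner_Integration.integral_add integrable_mult_indicator) auto
  also have "(LINT \<xi>|lborel. indicator {..<0} \<xi> *\<^sub>R f \<xi>) = (LINT \<xi>|lborel. indicator {0<..} \<xi> *\<^sub>R f \<xi>)"
    by (subst lborel_integral_real_affine[of "-1" _ 0]) (auto simp: f_neg indicator_def)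
  also have "(LINT \<xi>|lborel. indicator {0<..} \<xi> *\<^sub>R f \<xi>) = Re (LINT \<xi>:{0<..}|lborel. E \<xi>)"
    unfolding set_lebesgue_integral_def f_def using E
    by (subst integral_Re[symmetric]) (auto intro!: integrable_mult_indicator)
  also have "(LINT \<xi>|lborel. f \<xi>) = Re (LINT \<xi>|lborel. E \<xi>)"
    unfolding f_def using E by simp
  finally show ?thesis
    unfolding space_density_def inversion_density_def E_def by simp
qed

text \<open>The constant 1 / cos_min of the half-line estimate, times the inversion factor 1 / pi
  left after folding.\<close>

definition decay :: real where "decay = 1 / (pi * cos_min)"

lemma decay_pos: "decay > 0" using cos_min by (simp add: decay_def)

lemma space_density_le_decay:
  assumes "y > 0" "s > 0"
  shows "space_density s y \<le> decay / s"
proof -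
  have "space_density s y \<le> (1 / (cos_min * s)) / pi"
    unfolding space_density_half[OF assms(1)]
    using half_inversion_bound[OF assms] by (intro divide_right_mono) auto
  then show ?thesis by (simp add: decay_def mult_ac)
qed

lemma space_density_bounded:
  assumes "y > 0"
  obtains B where "B > 0" "\<And>s. \<bar>space_density s y\<bar> \<le> B"
proof
  let ?B = "(LINT t|lborel. norm (char_fun y t)) / (2 * pi)"
  show "\<bar>space_density s y\<bar> \<le> ?B + 1" for s
    using inversion_density_le[OF integrable_char_fun[OF assms], of s] by (simp add: space_density_def)
  have "?B \<ge> 0" by simp
  then show "?B + 1 > 0" by linarith
qed

section \<open>The tail kernel and the convolution density\<close>

text \<open>On r > 0 this is also the boundary datum of the time problem. The indicator lets the
  convolution be written over the whole line.\<close>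

definition levy_tail :: "real \<Rightarrow> real" where
  "levy_tail r = indicator {0<..} r * (\<Sum>j=1..m. lam j * (r powr (- \<nu> j) / Gamma (1 - \<nu> j)))"

lemma Gamma_pos: "j \<in> {1..m} \<Longrightarrow> Gamma (1 - \<nu> j) > 0"
  using \<nu>[of j] by (intro Gamma_real_pos) auto

lemma levy_tail_nonneg: "levy_tail r \<ge> 0"
  unfolding levy_tail_def using lam Gamma_pos
  by (intro mult_nonneg_nonneg sum_nonneg divide_nonneg_pos) (auto intro: less_imp_le)

lemma measurable_levy_tail [measurable]: "levy_tail \<in> borel_measurable borel"
  unfolding levy_tail_def[abs_def] by measurable

lemma levy_tail_antimono:
  assumes "0 < r" "r \<le> r'"
  shows "levy_tail r' \<le> levy_tail r"
proof -
  have "(\<Sum>j=1..m. lam j * (r' powr (- \<nu> j) / Gamma (1 - \<nu> j))) \<le> (\<Sum>j=1..m. lam j * (r powr (- \<nu> j) / Gamma (1 - \<nu> j)))"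
  proof (intro sum_mono mult_left_mono divide_right_mono)
    fix j assume j: "j \<in> {1..m}"
    show "r' powr - \<nu> j \<le> r powr - \<nu> j"
      using assms \<nu>[OF j] by (intro powr_mono2') auto
  qed (use lam Gamma_pos in \<open>auto intro: less_imp_le\<close>)
  then show ?thesis using assms by (simp add: levy_tail_def)
qed

lemma isCont_levy_tail: "r > 0 \<Longrightarrow> isCont levy_tail r"
proof -
  assume r: "r > 0"
  have "isCont (\<lambda>r. \<Sum>j=1..m. lam j * (r powr (- \<nu> j) / Gamma (1 - \<nu> j))) r"
    using r Gamma_pos by (intro continuous_intros) (auto simp: less_le)
  moreover have "\<forall>\<^sub>F x in nhds r. levy_tail x = (\<Sum>j=1..m. lam j * (x powr (- \<nu> j) / Gamma (1 - \<nu> j)))"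
    using eventually_nhds_in_open[of "{0<..}" r] r by (auto elim!: eventually_mono simp: levy_tail_def)
  ultimately show ?thesis by (simp add: isCont_cong)
qed

text \<open>The transform of r^(-\<nu>) is Gamma (1 - \<nu>) \<mu>^(\<nu> - 1), so the Gamma factors
  cancel and the exponent divided by \<mu> remains.\<close>

lemma nn_integral_levy_tail_laplace:
  assumes "\<mu> > 0"
  shows "(\<integral>\<^sup>+r. ennreal (exp (- \<mu> * r) * levy_tail r) \<partial>lborel) = ennreal (psi_real \<mu> / \<mu>)"
proof -
  define g where "g j r = indicator {0<..} r * (r powr (- \<nu> j) * exp (- \<mu> * r))" for j and r :: real
  have [measurable]: "g j \<in> borel_measurable borel" for j unfolding g_def[abs_def] by measurable
  have g: "g j r \<ge> 0" for j r by (simp add: g_def)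
  have c: "lam j / Gamma (1 - \<nu> j) \<ge> 0" if "j \<in> {1..m}" for j
    using lam[OF that] Gamma_pos[OF that] by simp
  have eq: "exp (- \<mu> * r) * levy_tail r = (\<Sum>j=1..m. lam j / Gamma (1 - \<nu> j) * g j r)" for r
    unfolding levy_tail_def g_def by (simp add: sum_distrib_left mult_ac)
  have "(\<integral>\<^sup>+r. ennreal (exp (- \<mu> * r) * levy_tail r) \<partial>lborel)
      = (\<integral>\<^sup>+r. (\<Sum>j=1..m. ennreal (lam j / Gamma (1 - \<nu> j)) * ennreal (g j r)) \<partial>lborel)"
  proof (intro nn_integral_cong)
    fix r
    have "(\<Sum>j=1..m. ennreal (lam j / Gamma (1 - \<nu> j)) * ennreal (g j r)) = (\<Sum>j=1..m. ennreal (lam j / Gamma (1 - \<nu> j) * g j r))"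
      using c g by (intro sum.cong refl ennreal_mult[symmetric])
    also have "\<dots> = ennreal (\<Sum>j=1..m. lam j / Gamma (1 - \<nu> j) * g j r)"
      by (intro sum_ennreal mult_nonneg_nonneg c g)
    finally show "ennreal (exp (- \<mu> * r) * levy_tail r) = (\<Sum>j=1..m. ennreal (lam j / Gamma (1 - \<nu> j)) * ennreal (g j r))"
      by (simp only: eq)
  qed
  also have "\<dots> = (\<Sum>j=1..m. ennreal (lam j / Gamma (1 - \<nu> j)) * (\<integral>\<^sup>+r. ennreal (g j r) \<partial>lborel))"
    by (simp add: nn_integral_sum nn_integral_cmult)
  also have "\<dots> = (\<Sum>j=1..m. ennreal (lam j * \<mu> powr \<nu> j / \<mu>))"
  proof (intro sum.cong refl)
    fix j assume j: "j \<in> {1..m}"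
    have "ennreal (lam j / Gamma (1 - \<nu> j)) * (\<integral>\<^sup>+r. ennreal (g j r) \<partial>lborel)
      = ennreal (lam j / Gamma (1 - \<nu> j)) * ennreal (Gamma (1 - \<nu> j) * \<mu> powr (\<nu> j - 1))"
      unfolding g_def using \<nu>[OF j] assms by (subst nn_integral_powr_exp) auto
    also have "\<dots> = ennreal (lam j * \<mu> powr \<nu> j / \<mu>)"
      using c[OF j] Gamma_pos[OF j] assms by (simp add: ennreal_mult[symmetric] powr_diff)
    finally show "ennreal (lam j / Gamma (1 - \<nu> j)) * (\<integral>\<^sup>+r. ennreal (g j r) \<partial>lborel) = ennreal (lam j * \<mu> powr \<nu> j / \<mu>)" .
  qed
  also have "\<dots> = ennreal (psi_real \<mu> / \<mu>)"
    unfolding psi_real_def sum_divide_distrib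
    by (rule sum_ennreal) (use assms lam in \<open>auto intro!: divide_nonneg_pos mult_nonneg_nonneg intro: less_imp_le\<close>)
  finally show ?thesis .
qed

lemma integrable_exp_levy_tail: "\<mu> > 0 \<Longrightarrow> integrable lborel (\<lambda>r. exp (- \<mu> * r) * levy_tail r)"
proof (rule integrableI_nonneg)
  show "\<mu> > 0 \<Longrightarrow> (\<integral>\<^sup>+r. ennreal (exp (- \<mu> * r) * levy_tail r) \<partial>lborel) < \<infinity>"
    by (subst nn_integral_levy_tail_laplace) auto
qed (auto simp: levy_tail_nonneg)

text \<open>On r \<le> T the weight exp (T - r) is at least 1, so the exponentially damped kernel
  dominates the truncated one, singularity at 0 included.\<close>

lemma integrable_levy_tail: "integrable lborel (\<lambda>r. indicator {..T} r * levy_tail r)"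
proof (rule Bochner_Integration.integrable_bound)
  show "integrable lborel (\<lambda>r. exp T * (exp (- 1 * r) * levy_tail r))"
    using integrable_exp_levy_tail[of 1] by (intro integrable_mult_right) auto
  have "1 \<le> exp T * exp (- r)" if "r \<le> T" for r
    using that by (simp add: exp_add[symmetric])
  then have "levy_tail r \<le> exp T * exp (- r) * levy_tail r" if "r \<le> T" for r
    using mult_right_mono[OF _ levy_tail_nonneg[of r], of 1 "exp T * exp (- r)"] that by simp
  then show "AE r in lborel. norm (indicator {..T} r * levy_tail r) \<le> norm (exp T * (exp (- 1 * r) * levy_tail r))"
    by (auto simp: levy_tail_nonneg indicator_def mult.assoc)
qed measurable

definition levy_tail_int :: "real \<Rightarrow> real" where
  "levy_tail_int T = (LINT r|lborel. indicator {..T} r * levy_tail r)"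

lemma levy_tail_int_tendsto: "(levy_tail_int \<longlongrightarrow> 0) (at_right 0)"
proof -
  have "((\<lambda>T. LINT r|lborel. indicator {..T} r * levy_tail r) \<longlongrightarrow> integral\<^sup>L lborel (\<lambda>r :: real. 0 :: real)) (at 0 within {0<..<1})"
  proof (rule integral_dominated_convergence_within[where w = "\<lambda>r. indicator {..1} r * levy_tail r"])
    show "AE r in lborel. ((\<lambda>T. indicator {..T} r * levy_tail r) \<longlongrightarrow> 0) (at 0 within {0<..<1})"
    proof (rule AE_I2, rule tendsto_eventually)
      fix r :: real
      show "\<forall>\<^sub>F T in at 0 within {0<..<1}. indicator {..T} r * levy_tail r = 0"
      proof (cases "r > 0")
        case True
        then have "\<forall>\<^sub>F T in at 0 within {0<..<1}. T < r"
          by (intro order_tendstoD(2)[OF tendsto_ident_at])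
        then show ?thesis by eventually_elim simp
      qed (simp add: levy_tail_def)
    qed
    show "AE r in lborel. norm (indicator {..T} r * levy_tail r) \<le> indicator {..1} r * levy_tail r" if "T \<in> {0<..<1} - {0}" for T
      using that by (auto simp: levy_tail_nonneg indicator_def)
  qed (use integrable_levy_tail in auto)
  moreover have "at 0 within {0<..<1} = at_right (0::real)"
    by (rule at_within_nhd[of _ "{..<1}"]) auto
  ultimately show ?thesis by (simp add: levy_tail_int_def[abs_def])
qed

text \<open>\<open>y\<close> is the space variable of the inverse and at the same time the clock of
  the sum; \<open>t\<close> is the level. Heuristically the sum sits at t - r at time
  \<open>y\<close> and then crosses \<open>t\<close> by a jump of size at least r.\<close>

definition time_density :: "real \<Rightarrow> real \<Rightarrow> real" where
  "time_density y t = (LINT r|lborel. space_density (t - r) y * levy_tail r)"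

lemma measurable_time_density [measurable]: "(\<lambda>(y, t). time_density y t) \<in> borel_measurable (borel \<Otimes>\<^sub>M borel)"
  unfolding time_density_def case_prod_beta by measurable

end

section \<open>The one-dimensional laws\<close>

text \<open>Both problems involve the sum only through its law at each fixed time; paths enter only
  when the hitting time is related to these laws.\<close>

locale stable_sum_laws = stable_sum +
  fixes P :: "real \<Rightarrow> real measure"
  assumes real_distribution_P: "\<And>y. y > 0 \<Longrightarrow> real_distribution (P y)"
    and nonneg_P: "\<And>y. y > 0 \<Longrightarrow> AE x in P y. x \<ge> 0"
    and laplace_P: "\<And>y \<mu>. y > 0 \<Longrightarrow> \<mu> > 0 \<Longrightarrow> (LINT x|P y. exp (- \<mu> * x)) = exp (- y * psi_real \<mu>)"
begin

text \<open>Both sides are holomorphic on the right half-plane and agree on the positive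
  axis.\<close>

lemma laplace_P_complex:
  assumes y: "y > 0" and z: "Re z > 0"
  shows "(LINT x|P y. exp (- z * complex_of_real x)) = exp (- of_real y * psi z)"
proof -
  interpret real_distribution "P y" by (rule real_distribution_P[OF y])
  have [measurable_cong]: "sets (P y) = sets borel" by simp
  have bounded: "integrable (P y) (\<lambda>x. exp (- \<mu> * x) * 1)" if "\<mu> > 0" for \<mu> :: real
    using nonneg_P[OF y] that
    by (intro integrable_const_bound[of _ 1]) auto
  have hol: "(\<lambda>z. LINT x|P y. exp (- z * complex_of_real x) * complex_of_real 1) holomorphic_on {z. Re z > 0}"
    by (rule laplace_transform_holomorphic) (use bounded nonneg_P[OF y] in auto)
  show ?thesis
  proof (rule halfplane_identity[OF _ _ _ z])
    show "(\<lambda>z. LINT x|P y. exp (- z * complex_of_real x)) holomorphic_on {z. Re z > 0}"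
      using hol by simp
    show "(\<lambda>z. exp (- of_real y * psi z)) holomorphic_on {z. Re z > 0}"
      by (intro holomorphic_intros holomorphic_psi)
    fix x :: real assume x: "x > 0"
    have "(LINT s|P y. exp (- of_real x * complex_of_real s)) = (LINT s|P y. complex_of_real (exp (- x * s)))"
      by (simp add: exp_of_real[symmetric])
    also have "\<dots> = exp (- of_real y * psi (of_real x))"
      unfolding integral_complex_of_real laplace_P[OF y x] using x by (simp add: psi_of_real exp_of_real[symmetric])
    finally show "(LINT s|P y. exp (- of_real x * complex_of_real s)) = exp (- of_real y * psi (of_real x))" .
  qed
qed

text \<open>The imaginary axis is approached from the right along \<epsilon> - i \<xi>. The
  integrands are bounded by 1 because the law lives on x \<ge> 0, and \<open>psi\<close> is
  continuous up to the axis.\<close>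

lemma char_P:
  assumes y: "y > 0"
  shows "char (P y) = char_fun y"
proof
  fix \<xi> :: real
  interpret real_distribution "P y" by (rule real_distribution_P[OF y])
  have [measurable_cong]: "sets (P y) = sets borel" by simp
  let ?z = "\<lambda>\<epsilon>. of_real \<epsilon> - \<i> * complex_of_real \<xi>"
  have lim_z: "(?z \<longlongrightarrow> of_real 0 - \<i> * complex_of_real \<xi>) (at_right 0)"
    by (intro tendsto_intros)
  have lim1: "((\<lambda>\<epsilon>. LINT x|P y. exp (- ?z \<epsilon> * complex_of_real x)) \<longlongrightarrow> (LINT x|P y. iexp (\<xi> * x))) (at_right 0)"
  proof (rule integral_dominated_convergence_within[where w = "\<lambda>_. 1"])
    have "((\<lambda>\<epsilon>. exp (- ?z \<epsilon> * complex_of_real x)) \<longlongrightarrow> exp (- ?z 0 * complex_of_real x)) (at_right 0)" for x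
      by (intro tendsto_intros lim_z)
    then show "AE x in P y. ((\<lambda>\<epsilon>. exp (- ?z \<epsilon> * complex_of_real x)) \<longlongrightarrow> iexp (\<xi> * x)) (at_right 0)"
      by (simp add: mult.assoc)
    show "AE x in P y. norm (exp (- ?z \<epsilon> * complex_of_real x)) \<le> 1" if "\<epsilon> \<in> {0<..} - {0}" for \<epsilon>
      using nonneg_P[OF y] by eventually_elim (use that in auto)
  qed auto
  have ev: "\<forall>\<^sub>F \<epsilon> in at_right 0. exp (- of_real y * psi (?z \<epsilon>)) = (LINT x|P y. exp (- ?z \<epsilon> * complex_of_real x))"
    using eventually_at_right_less[of 0] by eventually_elim (rule laplace_P_complex[OF y, symmetric], simp)
  have "((\<lambda>\<epsilon>. exp (- of_real y * psi (?z \<epsilon>))) \<longlongrightarrow> exp (- of_real y * psi (- \<i> * of_real \<xi>))) (at_right 0)"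
    using lim_z by (intro tendsto_intros tendsto_psi imag_nonpos) auto
  then have "((\<lambda>\<epsilon>. LINT x|P y. exp (- ?z \<epsilon> * complex_of_real x)) \<longlongrightarrow> exp (- of_real y * psi (- \<i> * of_real \<xi>))) (at_right 0)"
    by (rule Lim_transform_eventually[OF _ ev])
  then have "(LINT x|P y. iexp (\<xi> * x)) = exp (- of_real y * psi (- \<i> * of_real \<xi>))"
    by (rule tendsto_unique[OF trivial_limit_at_right_real lim1])
  then show "char (P y) \<xi> = char_fun y \<xi>"
    by (simp add: char_def char_fun_def)
qed

lemma P_density:
  assumes y: "y > 0"
  shows "P y = density lborel (\<lambda>s. ennreal (space_density s y))"
  using real_distribution.density_of_integrable_char[OF real_distribution_P[OF y]] integrable_char_fun[OF y]
  unfolding char_P[OF y] space_density_def by blast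

lemma space_density_nonneg: "y > 0 \<Longrightarrow> space_density s y \<ge> 0"
  using real_distribution.inversion_density_nonneg[OF real_distribution_P] integrable_char_fun
  unfolding space_density_def by (metis char_P)

text \<open>Nonnegativity of the law gives this almost everywhere on the negative axis; continuity
  makes it pointwise and reaches s = 0, which is the boundary condition of the space
  problem.\<close>

lemma space_density_eq_0:
  assumes y: "y > 0" and "s \<le> 0"
  shows "space_density s y = 0"
proof -
  have "AE x in density lborel (\<lambda>s. ennreal (space_density s y)). x \<ge> 0"
    unfolding P_density[OF y, symmetric] by (rule nonneg_P[OF y])
  then have "AE x in lborel. space_density x y > 0 \<longrightarrow> x \<ge> 0"
    by (subst (asm) AE_density) auto
  then have "AE x in lborel. x \<in> {..<0} \<longrightarrow> space_density x y = 0"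
  proof eventually_elim
    case (elim x)
    then show ?case using space_density_nonneg[OF y, of x] by auto
  qed
  then have neg: "space_density x y = 0" if "x < 0" for x
    using that
    by (intro continuous_AE_eq_imp_eq[of "{..<0}" "\<lambda>s. space_density s y" "\<lambda>_. 0"] continuous_on_space_density y) auto
  have "((\<lambda>s. space_density s y) \<longlongrightarrow> space_density 0 y) (at_left 0)"
    using continuous_on_space_density[OF y, of UNIV] by (auto simp: continuous_on_def filterlim_at_split)
  moreover have "((\<lambda>s. space_density s y) \<longlongrightarrow> 0) (at_left 0)"
    by (rule tendsto_eventually, subst eventually_at_left[of "-1"]) (use neg in \<open>auto intro!: exI[of _ "-1"]\<close>)
  ultimately have "space_density 0 y = 0"
    using tendsto_unique[OF trivial_limit_at_left_real] by blast
  then show ?thesis using neg assms by (cases "s = 0") auto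
qed

lemma nn_integral_P:
  assumes "y > 0" "f \<in> borel_measurable borel"
  shows "(\<integral>\<^sup>+s. f s \<partial>P y) = (\<integral>\<^sup>+s. ennreal (space_density s y) * f s \<partial>lborel)"
  unfolding P_density[OF assms(1)] using assms(2) by (intro nn_integral_density) auto

lemma nn_integral_space_density: "y > 0 \<Longrightarrow> (\<integral>\<^sup>+s. ennreal (space_density s y) \<partial>lborel) = 1"
  using nn_integral_P[of y "\<lambda>_. 1"] prob_space.emeasure_space_1[of "P y"] real_distribution_P[of y]
  by (simp add: real_distribution_def)

lemma integrable_space_density: "y > 0 \<Longrightarrow> integrable lborel (\<lambda>s. space_density s y)"
  by (rule integrableI_nonneg) (auto simp: space_density_nonneg nn_integral_space_density)

lemma nn_integral_space_density_laplace:
  assumes "y > 0" "\<mu> > 0"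
  shows "(\<integral>\<^sup>+s. ennreal (exp (- \<mu> * s) * space_density s y) \<partial>lborel) = ennreal (exp (- y * psi_real \<mu>))"
proof -
  interpret real_distribution "P y" by (rule real_distribution_P[OF assms(1)])
  have [measurable_cong]: "sets (P y) = sets borel" by simp
  have "(\<integral>\<^sup>+s. ennreal (exp (- \<mu> * s) * space_density s y) \<partial>lborel) = (\<integral>\<^sup>+s. ennreal (exp (- \<mu> * s)) \<partial>P y)"
    using assms space_density_nonneg by (subst nn_integral_P) (auto simp: ennreal_mult mult.commute)
  also have "\<dots> = ennreal (LINT s|P y. exp (- \<mu> * s))"
    using nonneg_P[OF assms(1)] assms(2)
    by (intro nn_integral_eq_integral integrable_const_bound[of _ 1]) auto
  also have "\<dots> = ennreal (exp (- y * psi_real \<mu>))" by (simp only: laplace_P[OF assms])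
  finally show ?thesis .
qed

text \<open>The density factor is bounded for fixed \<open>y\<close> and vanishes for r \<ge> t, so
  only the locally integrable part of the kernel matters.\<close>

lemma integrable_conv:
  assumes "y > 0"
  shows "integrable lborel (\<lambda>r. space_density (t - r) y * levy_tail r)"
proof -
  obtain B where B: "B > 0" "\<And>s. \<bar>space_density s y\<bar> \<le> B" using space_density_bounded[OF assms] by blast
  show ?thesis
  proof (rule Bochner_Integration.integrable_bound)
    show "integrable lborel (\<lambda>r. B * (indicator {..t} r * levy_tail r))"
      by (intro integrable_mult_right integrable_levy_tail)
    have "\<bar>space_density (t - r) y * levy_tail r\<bar> \<le> B * (indicator {..t} r * levy_tail r)" for r
      using B(2)[of "t - r"] levy_tail_nonneg[of r] space_density_eq_0[OF assms, of "t - r"]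
      by (cases "r \<le> t") (auto simp: abs_mult intro!: mult_right_mono)
    then show "AE r in lborel. norm (space_density (t - r) y * levy_tail r) \<le> norm (B * (indicator {..t} r * levy_tail r))"
      by (auto intro: order_trans[OF _ abs_ge_self])
  qed measurable
qed

lemma time_density_nonneg: "y > 0 \<Longrightarrow> time_density y t \<ge> 0"
  unfolding time_density_def by (intro Bochner_Integration.integral_nonneg mult_nonneg_nonneg space_density_nonneg levy_tail_nonneg)

lemma ennreal_time_density:
  assumes "y > 0"
  shows "ennreal (time_density y t) = (\<integral>\<^sup>+r. ennreal (space_density (t - r) y * levy_tail r) \<partial>lborel)"
  unfolding time_density_def using assms
  by (intro nn_integral_eq_integral[symmetric] integrable_conv) (auto simp: space_density_nonneg levy_tail_nonneg)

lemma time_density_eq_0: "y > 0 \<Longrightarrow> t \<le> 0 \<Longrightarrow> time_density y t = 0"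
proof -
  assume "y > 0" "t \<le> 0"
  then have "space_density (t - r) y * levy_tail r = 0" for r
    by (cases "r > 0") (auto simp: space_density_eq_0 levy_tail_def)
  then show ?thesis unfolding time_density_def by (subst Bochner_Integration.integral_cong[OF refl, of _ _ "\<lambda>_. 0"]) auto
qed

text \<open>The convolution theorem by Tonelli: exp (- \<mu> t) splits into the weights at t - r and
  at r, and the two transforms multiply.\<close>

lemma nn_integral_time_density_laplace:
  assumes y: "y > 0" and \<mu>: "\<mu> > 0"
  shows "(\<integral>\<^sup>+t. ennreal (exp (- \<mu> * t) * time_density y t) \<partial>lborel) = ennreal (psi_real \<mu> / \<mu> * exp (- y * psi_real \<mu>))"
proof -
  have "(\<integral>\<^sup>+t. ennreal (exp (- \<mu> * t) * time_density y t) \<partial>lborel)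
      = (\<integral>\<^sup>+t. \<integral>\<^sup>+r. ennreal (exp (- \<mu> * (t - r)) * space_density (t - r) y) * ennreal (exp (- \<mu> * r) * levy_tail r) \<partial>lborel \<partial>lborel)"
  proof (intro nn_integral_cong)
    fix t
    have "ennreal (exp (- \<mu> * t) * time_density y t) = ennreal (exp (- \<mu> * t)) * (\<integral>\<^sup>+r. ennreal (space_density (t - r) y * levy_tail r) \<partial>lborel)"
      using y by (simp add: ennreal_mult time_density_nonneg ennreal_time_density)
    also have "\<dots> = (\<integral>\<^sup>+r. ennreal (exp (- \<mu> * t)) * ennreal (space_density (t - r) y * levy_tail r) \<partial>lborel)"
      by (intro nn_integral_cmult[symmetric]) measurable
    also have "\<dots> = (\<integral>\<^sup>+r. ennreal (exp (- \<mu> * (t - r)) * space_density (t - r) y) * ennreal (exp (- \<mu> * r) * levy_tail r) \<partial>lborel)"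
    proof (intro nn_integral_cong)
      fix r
      have "exp (- \<mu> * t) * (space_density (t - r) y * levy_tail r) = (exp (- \<mu> * (t - r)) * space_density (t - r) y) * (exp (- \<mu> * r) * levy_tail r)"
        by (simp add: exp_add[symmetric] algebra_simps mult_exp_exp)
      then show "ennreal (exp (- \<mu> * t)) * ennreal (space_density (t - r) y * levy_tail r)
        = ennreal (exp (- \<mu> * (t - r)) * space_density (t - r) y) * ennreal (exp (- \<mu> * r) * levy_tail r)"
        using y by (simp only: ennreal_mult[symmetric] space_density_nonneg levy_tail_nonneg mult_nonneg_nonneg exp_ge_zero)
    qed
    finally show "ennreal (exp (- \<mu> * t) * time_density y t)
      = (\<integral>\<^sup>+r. ennreal (exp (- \<mu> * (t - r)) * space_density (t - r) y) * ennreal (exp (- \<mu> * r) * levy_tail r) \<partial>lborel)" .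
  qed
  also have "\<dots> = (\<integral>\<^sup>+r. \<integral>\<^sup>+t. ennreal (exp (- \<mu> * (t - r)) * space_density (t - r) y) * ennreal (exp (- \<mu> * r) * levy_tail r) \<partial>lborel \<partial>lborel)"
    by (rule lborel_pair.Fubini') measurable
  also have "\<dots> = (\<integral>\<^sup>+r. ennreal (exp (- y * psi_real \<mu>)) * ennreal (exp (- \<mu> * r) * levy_tail r) \<partial>lborel)"
  proof (intro nn_integral_cong)
    fix r
    have "(\<integral>\<^sup>+t. ennreal (exp (- \<mu> * (t - r)) * space_density (t - r) y) * ennreal (exp (- \<mu> * r) * levy_tail r) \<partial>lborel)
      = (\<integral>\<^sup>+t. ennreal (exp (- \<mu> * (t - r)) * space_density (t - r) y) \<partial>lborel) * ennreal (exp (- \<mu> * r) * levy_tail r)"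
      by (intro nn_integral_multc) measurable
    also have "(\<integral>\<^sup>+t. ennreal (exp (- \<mu> * (t - r)) * space_density (t - r) y) \<partial>lborel) = (\<integral>\<^sup>+s. ennreal (exp (- \<mu> * s) * space_density s y) \<partial>lborel)"
      by (subst nn_integral_real_affine[where c = 1 and t = r]) auto
    finally show "(\<integral>\<^sup>+t. ennreal (exp (- \<mu> * (t - r)) * space_density (t - r) y) * ennreal (exp (- \<mu> * r) * levy_tail r) \<partial>lborel)
      = ennreal (exp (- y * psi_real \<mu>)) * ennreal (exp (- \<mu> * r) * levy_tail r)"
      by (simp only: nn_integral_space_density_laplace[OF y \<mu>])
  qed
  also have "\<dots> = ennreal (exp (- y * psi_real \<mu>)) * ennreal (psi_real \<mu> / \<mu>)"
    by (subst nn_integral_cmult) (auto simp: nn_integral_levy_tail_laplace[OF \<mu>, simplified])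
  also have "\<dots> = ennreal (psi_real \<mu> / \<mu> * exp (- y * psi_real \<mu>))"
    using psi_real_pos[OF \<mu>] \<mu> by (simp add: ennreal_mult[symmetric] mult.commute)
  finally show ?thesis .
qed

end

section \<open>Behaviour of the density of the inverse\<close>

context stable_sum_laws
begin

lemma measure_P:
  assumes "y > 0" "A \<in> sets borel"
  shows "integrable lborel (\<lambda>s. space_density s y * indicator A s)"
    and "measure (P y) A = (LINT s|lborel. space_density s y * indicator A s)"
proof -
  interpret real_distribution "P y" by (rule real_distribution_P[OF assms(1)])
  show int: "integrable lborel (\<lambda>s. space_density s y * indicator A s)"
    using integrable_mult_indicator[of A lborel "\<lambda>s. space_density s y"] integrable_space_density[OF assms(1)] assms(2)
    by (simp add: mult.commute)
  have "ennreal (measure (P y) A) = emeasure (P y) A" by (simp add: emeasure_eq_measure)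
  also have "\<dots> = (\<integral>\<^sup>+s. indicator A s \<partial>P y)" using assms(2) by simp
  also have "\<dots> = (\<integral>\<^sup>+s. ennreal (space_density s y * indicator A s) \<partial>lborel)"
    using assms by (subst nn_integral_P) (auto intro!: nn_integral_cong simp: indicator_def)
  also have "\<dots> = ennreal (LINT s|lborel. space_density s y * indicator A s)"
    using int space_density_nonneg[OF assms(1)] by (intro nn_integral_eq_integral) auto
  finally show "measure (P y) A = (LINT s|lborel. space_density s y * indicator A s)"
    using space_density_nonneg[OF assms(1)] by (subst (asm) ennreal_inj) (auto intro!: Bochner_Integration.integral_nonneg)
qed

lemma integrable_exp_P:
  assumes "y > 0" "\<mu> > 0"
  shows "integrable (P y) (\<lambda>x. exp (- \<mu> * x))"
proof -
  interpret real_distribution "P y" by (rule real_distribution_P[OF assms(1)])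
  have [measurable_cong]: "sets (P y) = sets borel" by simp
  show ?thesis
    using nonneg_P[OF assms(1)] assms(2) by (intro integrable_const_bound[of _ 1]) auto
qed

text \<open>Markov's inequality for 1 - exp (- x): stable laws of order below 1 have no mean, but
  this bounded increasing function has an explicit expectation.\<close>

lemma P_tail_le:
  assumes "y > 0" "\<delta> > 0"
  shows "measure (P y) {\<delta>..} \<le> (1 - exp (- y * psi_real 1)) / (1 - exp (- \<delta>))"
proof -
  interpret real_distribution "P y" by (rule real_distribution_P[OF assms(1)])
  have int: "integrable (P y) (\<lambda>x. exp (- x))" using integrable_exp_P[OF assms(1), of 1] by simp
  have pos: "1 - exp (- \<delta>) > 0" using assms by simp
  have "(1 - exp (- \<delta>)) * measure (P y) {\<delta>..} = (LINT x|P y. (1 - exp (- \<delta>)) * indicator {\<delta>..} x)"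
    by simp
  also have "\<dots> \<le> (LINT x|P y. 1 - exp (- x))"
  proof (rule integral_mono_AE)
    show "AE x in P y. (1 - exp (- \<delta>)) * indicator {\<delta>..} x \<le> 1 - exp (- x)"
      using nonneg_P[OF assms(1)] by eventually_elim (auto simp: indicator_def)
  qed (use int in \<open>auto simp: emeasure_eq_measure\<close>)
  also have "\<dots> = 1 - exp (- y * psi_real 1)"
    using laplace_P[OF assms(1), of 1] int by (simp add: prob_space[simplified])
  finally show ?thesis using pos by (simp add: pos_le_divide_eq mult.commute)
qed

lemma P_tail_tendsto:
  assumes "\<delta> > 0"
  shows "((\<lambda>y. measure (P y) {\<delta>..}) \<longlongrightarrow> 0) (at_right 0)"
proof (rule tendsto_sandwich[where f = "\<lambda>_. 0"])
  show "\<forall>\<^sub>F y in at_right 0. measure (P y) {\<delta>..} \<le> (1 - exp (- y * psi_real 1)) / (1 - exp (- \<delta>))"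
    using eventually_at_right_less[of 0] by eventually_elim (use P_tail_le assms in auto)
  have "((\<lambda>y. (1 - exp (- y * psi_real 1)) / (1 - exp (- \<delta>))) \<longlongrightarrow> (1 - exp (- 0 * psi_real 1)) / (1 - exp (- \<delta>))) (at_right 0)"
    using assms by (intro tendsto_intros) auto
  then show "((\<lambda>y. (1 - exp (- y * psi_real 1)) / (1 - exp (- \<delta>))) \<longlongrightarrow> 0) (at_right 0)" by simp
qed auto

text \<open>Chernoff's bound: exp (t - x) is at least 1 where x < t.\<close>

lemma P_less_le:
  assumes "y > 0"
  shows "measure (P y) {..<t} \<le> exp t * exp (- y * psi_real 1)"
proof -
  interpret real_distribution "P y" by (rule real_distribution_P[OF assms(1)])
  have int: "integrable (P y) (\<lambda>x. exp (- x))" using integrable_exp_P[OF assms(1), of 1] by simp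
  have "measure (P y) {..<t} = (LINT x|P y. indicator {..<t} x)" by simp
  also have "\<dots> \<le> (LINT x|P y. exp t * exp (- x))"
  proof (intro integral_mono integrable_mult_right int integrable_real_indicator)
    show "indicator {..<t} x \<le> exp t * exp (- x)" for x
      by (auto simp: indicator_def exp_add[symmetric])
  qed (auto simp: emeasure_eq_measure)
  also have "\<dots> = exp t * exp (- y * psi_real 1)"
    using laplace_P[OF assms(1), of 1] by simp
  finally show ?thesis .
qed

lemma P_less_tendsto: "((\<lambda>y. measure (P y) {..<t}) \<longlongrightarrow> 0) at_top"
proof (rule tendsto_sandwich[where f = "\<lambda>_. 0"])
  show "\<forall>\<^sub>F y in at_top. measure (P y) {..<t} \<le> exp t * exp (- y * psi_real 1)"
    using eventually_gt_at_top[of 0] by eventually_elim (rule P_less_le)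
  show "((\<lambda>y. exp t * exp (- y * psi_real 1)) \<longlongrightarrow> 0) at_top"
  proof -
    have "((\<lambda>y. exp t * exp (- y * c)) \<longlongrightarrow> 0) at_top" if "c > 0" for c :: real
      using that by real_asymp
    then show ?thesis using psi_real_pos[of 1] by simp
  qed
qed auto

lemma P_measure_split:
  assumes "y > 0"
  shows "measure (P y) {..<t} = 1 - measure (P y) {t..}"
proof -
  interpret real_distribution "P y" by (rule real_distribution_P[OF assms(1)])
  have "{..<t} = UNIV - {t..}" by auto
  then show ?thesis using prob_compl[of "{t..}"] by simp
qed

lemma measure_P_reflect:
  assumes "y > 0" "A \<in> sets borel"
  shows "integrable lborel (\<lambda>r. space_density (t - r) y * indicator A (t - r))"
    and "(LINT r|lborel. space_density (t - r) y * indicator A (t - r)) = measure (P y) A"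
  using lborel_integrable_real_affine[OF measure_P(1)[OF assms], of "-1" t]
    lborel_integral_real_affine[of "-1" "\<lambda>s. space_density s y * indicator A s" t] measure_P(2)[OF assms]
  by auto

text \<open>The convolution integral is cut into three parts: \<open>r \<le> \<eta>\<close>, where the density is at most
  \<open>decay / (t - \<eta>)\<close>; \<open>t - r \<ge> \<delta>\<close>, which has small mass for small \<open>y\<close>; and \<open>t - r < \<delta>\<close>, where
  the kernel is close to its value at \<open>t\<close>.\<close>

lemma time_density_le:
  assumes y: "y > 0" and \<eta>: "0 < \<eta>" "\<eta> < t" and \<delta>: "0 < \<delta>" "\<delta> < t"
  shows "time_density y t \<le> decay / (t - \<eta>) * levy_tail_int \<eta> + levy_tail \<eta> * measure (P y) {\<delta>..} + levy_tail (t - \<delta>)"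
proof -
  interpret real_distribution "P y" by (rule real_distribution_P[OF y])
  \<comment> \<open>One summand per region. The last is allowed to extend over the whole line, where
    the density has total mass 1.\<close>
  let ?b = "\<lambda>r. decay / (t - \<eta>) * (indicator {..\<eta>} r * levy_tail r)
      + levy_tail \<eta> * (space_density (t - r) y * indicator {\<delta>..} (t - r))
      + levy_tail (t - \<delta>) * (space_density (t - r) y * indicator UNIV (t - r))"
  have le: "space_density (t - r) y * levy_tail r \<le> ?b r" for r
  proof -
    have nn: "0 \<le> decay / (t - \<eta>) * (indicator {..\<eta>} r * levy_tail r)"
      "0 \<le> levy_tail \<eta> * (space_density (t - r) y * indicator {\<delta>..} (t - r))"
      "0 \<le> levy_tail (t - \<delta>) * (space_density (t - r) y * indicator UNIV (t - r))"
      using \<eta> decay_pos levy_tail_nonneg space_density_nonneg[OF y] by auto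
    consider "r \<le> 0" | "0 < r" "r \<le> \<eta>" | "\<eta> < r" "t - r \<ge> \<delta>" | "\<eta> < r" "t - r < \<delta>"
      by linarith
    then show ?thesis
    proof cases
      case 1
      then have "levy_tail r = 0" by (simp add: levy_tail_def)
      then show ?thesis using nn by simp
    next
      case 2
      have "space_density (t - r) y \<le> decay / (t - r)" using 2 \<eta> by (intro space_density_le_decay y) auto
      also have "\<dots> \<le> decay / (t - \<eta>)" using 2 \<eta> decay_pos by (intro divide_left_mono) auto
      finally have "space_density (t - r) y * levy_tail r \<le> decay / (t - \<eta>) * levy_tail r"
        by (rule mult_right_mono[OF _ levy_tail_nonneg])
      then show ?thesis using nn 2 by simp
    next
      case 3
      have "space_density (t - r) y * levy_tail r \<le> space_density (t - r) y * levy_tail \<eta>"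
        using 3 \<eta> by (intro mult_left_mono levy_tail_antimono space_density_nonneg y) auto
      then show ?thesis using nn 3 by (simp add: mult.commute)
    next
      case 4
      have "space_density (t - r) y * levy_tail r \<le> space_density (t - r) y * levy_tail (t - \<delta>)"
        using 4 \<delta> by (intro mult_left_mono levy_tail_antimono space_density_nonneg y) auto
      then show ?thesis using nn 4 by (simp add: mult.commute)
    qed
  qed
  have int: "integrable lborel (\<lambda>r. decay / (t - \<eta>) * (indicator {..\<eta>} r * levy_tail r))"
    "integrable lborel (\<lambda>r. levy_tail \<eta> * (space_density (t - r) y * indicator {\<delta>..} (t - r)))"
    "integrable lborel (\<lambda>r. levy_tail (t - \<delta>) * (space_density (t - r) y * indicator UNIV (t - r)))"
    by (intro integrable_mult_right integrable_levy_tail measure_P_reflect y; simp)+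
  have "time_density y t \<le> (LINT r|lborel. ?b r)"
    unfolding time_density_def using le int
    by (intro integral_mono integrable_conv y Bochner_Integration.integrable_add) auto
  also have "\<dots> = (LINT r|lborel. decay / (t - \<eta>) * (indicator {..\<eta>} r * levy_tail r))
      + (LINT r|lborel. levy_tail \<eta> * (space_density (t - r) y * indicator {\<delta>..} (t - r)))
      + (LINT r|lborel. levy_tail (t - \<delta>) * (space_density (t - r) y * indicator UNIV (t - r)))"
    using Bochner_Integration.integral_add[OF Bochner_Integration.integrable_add[OF int(1,2)] int(3)]
      Bochner_Integration.integral_add[OF int(1,2)] by simp
  also have "(LINT r|lborel. levy_tail \<eta> * (space_density (t - r) y * indicator {\<delta>..} (t - r))) = levy_tail \<eta> * measure (P y) {\<delta>..}"
    unfolding integral_mult_right_zero by (subst measure_P_reflect(2)[OF y]) auto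
  also have "(LINT r|lborel. levy_tail (t - \<delta>) * (space_density (t - r) y * indicator UNIV (t - r))) = levy_tail (t - \<delta>) * measure (P y) UNIV"
    unfolding integral_mult_right_zero by (subst measure_P_reflect(2)[OF y]) auto
  also have "(LINT r|lborel. decay / (t - \<eta>) * (indicator {..\<eta>} r * levy_tail r)) = decay / (t - \<eta>) * levy_tail_int \<eta>"
    unfolding integral_mult_right_zero levy_tail_int_def ..
  also have "measure (P y) UNIV = 1" using prob_space by simp
  finally show ?thesis by simp
qed

text \<open>The kernel decreases, so for 0 < r < t it is at least its value at \<open>t\<close>; the
  remaining density factor integrates to the mass below \<open>t\<close>.\<close>

lemma time_density_ge:
  assumes y: "y > 0" and t: "t > 0"
  shows "time_density y t \<ge> levy_tail t * measure (P y) {..<t}"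
proof -
  have "levy_tail t * (LINT r|lborel. space_density (t - r) y * indicator {0<..<t} (t - r)) \<le> time_density y t"
  proof -
    have "(LINT r|lborel. levy_tail t * (space_density (t - r) y * indicator {0<..<t} (t - r))) \<le> time_density y t"
      unfolding time_density_def
    proof (intro integral_mono integrable_mult_right measure_P_reflect(1) y integrable_conv)
      fix r
      show "levy_tail t * (space_density (t - r) y * indicator {0<..<t} (t - r)) \<le> space_density (t - r) y * levy_tail r"
        using levy_tail_antimono[of r t] space_density_nonneg[OF y, of "t - r"] levy_tail_nonneg[of r]
        by (auto simp: indicator_def mult.commute intro!: mult_left_mono mult_right_mono)
    qed simp
    then show ?thesis by simp
  qed
  moreover have "measure (P y) {..<t} = measure (P y) {0<..<t}"
    unfolding measure_P(2)[OF y borel_open[OF open_lessThan]] measure_P(2)[OF y borel_open[OF open_greaterThanLessThan]]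
    using space_density_eq_0[OF y] by (intro Bochner_Integration.integral_cong) (auto simp: indicator_def)
  ultimately show ?thesis by (simp add: measure_P_reflect(2)[OF y])
qed

text \<open>\<open>time_density_le\<close> with both cuts at t / 2. The bound is free of
  \<open>y\<close> and locally uniform in \<open>t\<close>, which permits integration over
  \<open>y\<close> down to 0 and dominated convergence in \<open>t\<close>.\<close>

lemma time_density_bounded:
  assumes y: "y > 0" and "0 < a" "a \<le> t" "t \<le> b"
  shows "time_density y t \<le> decay / (a / 2) * levy_tail_int b + 2 * levy_tail (a / 2)"
proof -
  interpret real_distribution "P y" by (rule real_distribution_P[OF y])
  have t: "t > 0" using assms by simp
  have mono: "levy_tail_int (t / 2) \<le> levy_tail_int b"
    unfolding levy_tail_int_def using assms
    by (intro integral_mono integrable_levy_tail) (auto simp: indicator_def levy_tail_nonneg)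
  have nn: "levy_tail_int b \<ge> 0"
    unfolding levy_tail_int_def by (intro Bochner_Integration.integral_nonneg) (auto simp: levy_tail_nonneg)
  have "time_density y t \<le> decay / (t - t / 2) * levy_tail_int (t / 2) + levy_tail (t / 2) * measure (P y) {t / 2..} + levy_tail (t - t / 2)"
    using t by (intro time_density_le y) auto
  also have "\<dots> \<le> decay / (a / 2) * levy_tail_int b + levy_tail (a / 2) * 1 + levy_tail (a / 2)"
  proof (intro add_mono)
    have "decay / (t - t / 2) * levy_tail_int (t / 2) \<le> decay / (t - t / 2) * levy_tail_int b"
      using mono t decay_pos by (intro mult_left_mono) auto
    also have "\<dots> \<le> decay / (a / 2) * levy_tail_int b"
      using assms nn decay_pos by (intro mult_right_mono divide_left_mono) auto
    finally show "decay / (t - t / 2) * levy_tail_int (t / 2) \<le> decay / (a / 2) * levy_tail_int b" .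
    show "levy_tail (t / 2) * measure (P y) {t / 2..} \<le> levy_tail (a / 2) * 1"
      using assms by (intro mult_mono levy_tail_antimono prob_le_1) (auto simp: levy_tail_nonneg)
    show "levy_tail (t - t / 2) \<le> levy_tail (a / 2)"
      using assms by (intro levy_tail_antimono) auto
  qed
  finally show ?thesis by simp
qed

text \<open>For levels below t + 1 the integrands vanish beyond r = t + 1 and share one dominating
  function; the continuity in the level comes from the density factor.\<close>

lemma isCont_time_density:
  assumes y: "y > 0"
  shows "isCont (time_density y) t"
proof -
  obtain B where B: "B > 0" "\<And>s. \<bar>space_density s y\<bar> \<le> B" using space_density_bounded[OF y] by blast
  have "((\<lambda>t'. LINT r|lborel. space_density (t' - r) y * levy_tail r) \<longlongrightarrow> (LINT r|lborel. space_density (t - r) y * levy_tail r)) (at t within {..<t+1})"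
  proof (rule integral_dominated_convergence_within[where w = "\<lambda>r. B * (indicator {..t+1} r * levy_tail r)"])
    show "integrable lborel (\<lambda>r. B * (indicator {..t+1} r * levy_tail r))"
      by (intro integrable_mult_right integrable_levy_tail)
    show "AE r in lborel. ((\<lambda>t'. space_density (t' - r) y * levy_tail r) \<longlongrightarrow> space_density (t - r) y * levy_tail r) (at t within {..<t+1})"
    proof (rule AE_I2)
      fix r
      have "isCont (\<lambda>s. space_density s y) (t - r)"
        using continuous_on_space_density[OF y, of UNIV] by (simp add: continuous_on_eq_continuous_at)
      then have "((\<lambda>t'. space_density (t' - r) y) \<longlongrightarrow> space_density (t - r) y) (at t within {..<t+1})"
        by (rule isCont_tendsto_compose) (intro tendsto_intros)
      then show "((\<lambda>t'. space_density (t' - r) y * levy_tail r) \<longlongrightarrow> space_density (t - r) y * levy_tail r) (at t within {..<t+1})"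
        by (intro tendsto_intros)
    qed
    fix t' assume t': "t' \<in> {..<t+1} - {t}"
    have "\<bar>space_density (t' - r) y * levy_tail r\<bar> \<le> B * (indicator {..t+1} r * levy_tail r)" for r
      using B(2)[of "t' - r"] levy_tail_nonneg[of r] space_density_eq_0[OF y, of "t' - r"] t'
      by (cases "r \<le> t + 1") (auto simp: abs_mult intro!: mult_right_mono)
    then show "AE r in lborel. norm (space_density (t' - r) y * levy_tail r) \<le> B * (indicator {..t+1} r * levy_tail r)"
      by auto
  qed measurable
  moreover have "at t within {..<t+1} = at t"
    by (rule at_within_open) auto
  ultimately show ?thesis by (simp add: isCont_def time_density_def[abs_def])
qed

text \<open>The lower bound comes from \<open>time_density_ge\<close>, the upper one from
  \<open>time_density_le\<close>, whose cuts are fixed before \<open>y\<close> tends to 0: the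
  factor \<open>levy_tail \<eta>\<close> may be huge, but it is constant while the tail of the law
  vanishes.\<close>

lemma time_density_tendsto_levy_tail:
  assumes t: "t > 0"
  shows "((\<lambda>y. time_density y t) \<longlongrightarrow> levy_tail t) (at_right 0)"
proof (rule order_tendstoI)
  fix a assume "a < levy_tail t"
  have "((\<lambda>y. levy_tail t * (1 - measure (P y) {t..})) \<longlongrightarrow> levy_tail t * (1 - 0)) (at_right 0)"
    by (intro tendsto_intros P_tail_tendsto t)
  then have "\<forall>\<^sub>F y in at_right 0. a < levy_tail t * (1 - measure (P y) {t..})"
    using \<open>a < levy_tail t\<close> by (intro order_tendstoD(1)) auto
  then show "\<forall>\<^sub>F y in at_right 0. a < time_density y t"
    using eventually_at_right_less[of 0]
  proof eventually_elim
    case (elim y)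
    then show ?case using time_density_ge[OF elim(2) t] P_measure_split[OF elim(2), of t] by simp
  qed
next
  fix a assume a: "levy_tail t < a"
  \<comment> \<open>A third of the gap for each error: replacing the kernel near \<open>t\<close>,
    its singular part near 0, and the tail of the law.\<close>
  define e where "e = (a - levy_tail t) / 3"
  have e: "e > 0" using a by (simp add: e_def)
  have "((\<lambda>\<delta>. levy_tail (t - \<delta>)) \<longlongrightarrow> levy_tail t) (at_right 0)"
    by (rule isCont_tendsto_compose[OF isCont_levy_tail[OF t]]) (auto intro!: tendsto_eq_intros)
  then have "\<forall>\<^sub>F \<delta> in at_right 0. levy_tail (t - \<delta>) < levy_tail t + e"
    using e by (intro order_tendstoD(2)) auto
  moreover have "\<forall>\<^sub>F \<delta> in at_right 0. \<delta> < t"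
    using t by (intro order_tendstoD(2)[OF tendsto_ident_at])
  ultimately have "\<forall>\<^sub>F \<delta> in at_right 0. levy_tail (t - \<delta>) < levy_tail t + e \<and> \<delta> < t \<and> 0 < \<delta>"
    using eventually_at_right_less[of 0] by eventually_elim auto
  then obtain \<delta> where \<delta>: "levy_tail (t - \<delta>) < levy_tail t + e" "\<delta> < t" "0 < \<delta>"
    using eventually_happens'[OF trivial_limit_at_right_real] by blast
  have "((\<lambda>\<eta>. decay / (t - \<eta>) * levy_tail_int \<eta>) \<longlongrightarrow> decay / (t - 0) * 0) (at_right 0)"
    using t by (intro tendsto_intros levy_tail_int_tendsto) auto
  then have "\<forall>\<^sub>F \<eta> in at_right 0. decay / (t - \<eta>) * levy_tail_int \<eta> < e"
    using e by (intro order_tendstoD(2)) auto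
  moreover have "\<forall>\<^sub>F \<eta> in at_right 0. \<eta> < t"
    using t by (intro order_tendstoD(2)[OF tendsto_ident_at])
  ultimately have "\<forall>\<^sub>F \<eta> in at_right 0. decay / (t - \<eta>) * levy_tail_int \<eta> < e \<and> \<eta> < t \<and> 0 < \<eta>"
    using eventually_at_right_less[of 0] by eventually_elim auto
  then obtain \<eta> where \<eta>: "decay / (t - \<eta>) * levy_tail_int \<eta> < e" "\<eta> < t" "0 < \<eta>"
    using eventually_happens'[OF trivial_limit_at_right_real] by blast
  have "((\<lambda>y. levy_tail \<eta> * measure (P y) {\<delta>..}) \<longlongrightarrow> levy_tail \<eta> * 0) (at_right 0)"
    by (intro tendsto_intros P_tail_tendsto \<delta>)
  then have "\<forall>\<^sub>F y in at_right 0. levy_tail \<eta> * measure (P y) {\<delta>..} < e"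
    using e by (intro order_tendstoD(2)) auto
  then show "\<forall>\<^sub>F y in at_right 0. time_density y t < a"
    using eventually_at_right_less[of 0]
  proof eventually_elim
    case (elim y)
    then show ?case using time_density_le[OF elim(2) \<eta>(3,2) \<delta>(3,2)] \<eta>(1) \<delta>(1) by (simp add: e_def field_simps)
  qed
qed

lemma integrable_time_density_Ioo:
  assumes "t > 0"
  shows "integrable lborel (\<lambda>y. indicator {0<..<x} y * time_density y t)"
proof (rule Bochner_Integration.integrable_bound)
  show "integrable lborel (\<lambda>y. (decay / (t / 2) * levy_tail_int t + 2 * levy_tail (t / 2)) * indicator {0<..<x} y)"
    by (intro integrable_mult_right integrable_real_indicator) (cases "0 \<le> x"; simp)+
  have "\<bar>indicator {0<..<x} y * time_density y t\<bar> \<le> (decay / (t / 2) * levy_tail_int t + 2 * levy_tail (t / 2)) * indicator {0<..<x} y" for y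
    using time_density_bounded[of y t t t] time_density_nonneg[of y t] assms by (auto simp: indicator_def)
  then show "AE y in lborel. norm (indicator {0<..<x} y * time_density y t)
      \<le> norm ((decay / (t / 2) * levy_tail_int t + 2 * levy_tail (t / 2)) * indicator {0<..<x} y)"
    by (auto intro: order_trans[OF _ abs_ge_self])
qed measurable

section \<open>Continuity of the two distribution functions in the level\<close>

definition time_cdf :: "real \<Rightarrow> real \<Rightarrow> real" where
  "time_cdf x t = (LINT y|lborel. indicator {0<..<x} y * time_density y t)"

lemma time_cdf_nonneg: "time_cdf x t \<ge> 0"
  unfolding time_cdf_def by (intro Bochner_Integration.integral_nonneg) (auto simp: indicator_def time_density_nonneg)

lemma ennreal_time_cdf: "t > 0 \<Longrightarrow> ennreal (time_cdf x t) = (\<integral>\<^sup>+y. ennreal (indicator {0<..<x} y * time_density y t) \<partial>lborel)"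
  unfolding time_cdf_def
  by (intro nn_integral_eq_integral[symmetric] integrable_time_density_Ioo) (auto simp: indicator_def time_density_nonneg)

lemma measurable_time_cdf [measurable]: "time_cdf x \<in> borel_measurable borel"
  unfolding time_cdf_def[abs_def] by measurable

text \<open>The window from t / 2 to t + 1 stays away from 0, so a single constant bounds the
  density for all levels in it and all \<open>y\<close>.\<close>

lemma isCont_time_cdf:
  assumes t: "t > 0"
  shows "isCont (time_cdf x) t"
proof -
  define K where "K = decay / (t / 2 / 2) * levy_tail_int (t + 1) + 2 * levy_tail (t / 2 / 2)"
  have "((\<lambda>t'. LINT y|lborel. indicator {0<..<x} y * time_density y t') \<longlongrightarrow> (LINT y|lborel. indicator {0<..<x} y * time_density y t)) (at t within {t/2<..<t+1})"
  proof (rule integral_dominated_convergence_within[where w = "\<lambda>y. K * indicator {0<..<x} y"])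
    show "integrable lborel (\<lambda>y. K * indicator {0<..<x} y)"
      by (intro integrable_mult_right integrable_real_indicator) (cases "0 \<le> x"; simp)+
    show "AE y in lborel. ((\<lambda>t'. indicator {0<..<x} y * time_density y t') \<longlongrightarrow> indicator {0<..<x} y * time_density y t) (at t within {t/2<..<t+1})"
    proof (rule AE_I2)
      fix y :: real
      show "((\<lambda>t'. indicator {0<..<x} y * time_density y t') \<longlongrightarrow> indicator {0<..<x} y * time_density y t) (at t within {t/2<..<t+1})"
      proof (cases "y > 0")
        case True
        then show ?thesis
          by (intro tendsto_intros isCont_tendsto_compose[OF isCont_time_density])
      qed simp
    qed
    fix t' assume t': "t' \<in> {t/2<..<t+1} - {t}"
    have "\<bar>indicator {0<..<x} y * time_density y t'\<bar> \<le> K * indicator {0<..<x} y" for y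
      using time_density_bounded[of y "t / 2" t' "t + 1"] time_density_nonneg[of y t'] t t' by (auto simp: indicator_def K_def)
    then show "AE y in lborel. norm (indicator {0<..<x} y * time_density y t') \<le> K * indicator {0<..<x} y"
      by auto
  qed measurable
  moreover have "at t within {t/2<..<t+1} = at t"
    by (rule at_within_open) (use t in auto)
  ultimately show ?thesis by (simp add: isCont_def time_cdf_def[abs_def])
qed

lemma no_atom_P: "y > 0 \<Longrightarrow> measure (P y) {s} = 0"
  by (rule real_distribution.no_atom_of_integrable_char[OF real_distribution_P]) (simp_all add: char_P integrable_char_fun)

text \<open>The law has no atoms, so the closed tail is the complement of a continuous distribution
  function.\<close>

lemma isCont_P_tail:
  assumes "y > 0"
  shows "isCont (\<lambda>t. measure (P y) {t..}) t"
proof -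
  interpret real_distribution "P y" by (rule real_distribution_P[OF assms])
  have "measure (P y) {t..} = 1 - cdf (P y) t" for t
  proof -
    have "measure (P y) {..t} = measure (P y) {..<t} + measure (P y) {t}"
      by (subst finite_measure_Union[symmetric]) (auto intro!: arg_cong[of _ _ "measure (P y)"])
    then show ?thesis using P_measure_split[OF assms, of t] no_atom_P[OF assms, of t] by (simp add: cdf_def)
  qed
  then show ?thesis using isCont_cdf[of t] no_atom_P[OF assms, of t] by (auto intro!: continuous_intros)
qed

end

section \<open>The time problem\<close>

text \<open>Tonelli computes nonnegative integrals without prior integrability; this returns both
  integrability and the value of the real transform.\<close>

lemma laplace_eq_of_nn_integral:
  fixes f :: "real \<Rightarrow> real"
  assumes [measurable]: "f \<in> borel_measurable borel" and "\<And>t. t > 0 \<Longrightarrow> f t \<ge> 0" "c \<ge> 0"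
    and nn: "(\<integral>\<^sup>+t. ennreal (indicator {0<..} t * (exp (- \<mu> * t) * f t)) \<partial>lborel) = ennreal c"
  shows "set_integrable lborel {0<..} (\<lambda>t. exp (- \<mu> * t) * f t)" and "laplace f \<mu> = c"
proof -
  have nonneg: "0 \<le> indicator {0<..} t * (exp (- \<mu> * t) * f t)" for t
    using assms by (auto simp: indicator_def)
  have int: "integrable lborel (\<lambda>t. indicator {0<..} t * (exp (- \<mu> * t) * f t))"
  proof (rule integrableI_nonneg)
    show "(\<integral>\<^sup>+t. ennreal (indicator {0<..} t * (exp (- \<mu> * t) * f t)) \<partial>lborel) < \<infinity>"
      by (simp only: nn) simp
  qed (use nonneg in \<open>auto intro: AE_I2\<close>)
  then show "set_integrable lborel {0<..} (\<lambda>t. exp (- \<mu> * t) * f t)"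
    by (simp add: set_integrable_def)
  have "ennreal c = ennreal (LINT t|lborel. indicator {0<..} t * (exp (- \<mu> * t) * f t))"
    unfolding nn[symmetric] using nonneg by (intro nn_integral_eq_integral int) auto
  then have "c = (LINT t|lborel. indicator {0<..} t * (exp (- \<mu> * t) * f t))"
    using assms nonneg by (subst (asm) ennreal_inj) (auto intro!: Bochner_Integration.integral_nonneg)
  then show "laplace f \<mu> = c"
    by (simp add: laplace_def set_lebesgue_integral_def)
qed

lemma nn_integral_exp_Ioo:
  fixes c x :: real
  assumes "c > 0" "x \<ge> 0"
  shows "(\<integral>\<^sup>+y. ennreal (indicator {0<..<x} y * exp (- c * y)) \<partial>lborel) = ennreal ((1 - exp (- c * x)) / c)"
proof -
  have "(\<integral>\<^sup>+y. ennreal (exp (- c * y)) * indicator {0..x} y \<partial>lborel) = ennreal (- (exp (- c * x) / c) - - (exp (- c * 0) / c))"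
    using assms
    by (intro nn_integral_FTC_Icc[where F = "\<lambda>y. - (exp (- c * y) / c)"]) (auto intro!: derivative_eq_intros)
  also have "- (exp (- c * x) / c) - - (exp (- c * 0) / c) = (1 - exp (- c * x)) / c"
    by (simp add: diff_divide_distrib)
  also have "(\<integral>\<^sup>+y. ennreal (exp (- c * y)) * indicator {0..x} y \<partial>lborel)
      = (\<integral>\<^sup>+y. ennreal (indicator {0<..<x} y * exp (- c * y)) \<partial>lborel)"
  proof (rule nn_integral_cong_AE)
    show "AE y in lborel. ennreal (exp (- c * y)) * indicator {0..x} y = ennreal (indicator {0<..<x} y * exp (- c * y))"
      using AE_lborel_singleton[of 0] AE_lborel_singleton[of x]
      by eventually_elim (auto simp: indicator_def)
  qed
  finally show ?thesis .
qed

lemma nn_integral_exp_Ioi: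
  fixes c :: real
  assumes "c > 0"
  shows "(\<integral>\<^sup>+y. ennreal (indicator {0<..} y * exp (- c * y)) \<partial>lborel) = ennreal (1 / c)"
proof -
  have "((\<lambda>y. - (exp (- c * y) / c)) \<longlongrightarrow> 0) at_top"
    using assms by real_asymp
  then have "(\<integral>\<^sup>+y. ennreal (exp (- c * y)) * indicator {0..} y \<partial>lborel) = ennreal (0 - - (exp (- c * 0) / c))"
    using assms
    by (intro nn_integral_FTC_atLeast[where F = "\<lambda>y. - (exp (- c * y) / c)"]) (auto intro!: derivative_eq_intros)
  also have "(\<integral>\<^sup>+y. ennreal (exp (- c * y)) * indicator {0..} y \<partial>lborel)
      = (\<integral>\<^sup>+y. ennreal (indicator {0<..} y * exp (- c * y)) \<partial>lborel)"
  proof (rule nn_integral_cong_AE)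
    show "AE y in lborel. ennreal (exp (- c * y)) * indicator {0..} y = ennreal (indicator {0<..} y * exp (- c * y))"
      using AE_lborel_singleton[of 0] by eventually_elim (auto simp: indicator_def)
  qed
  finally show ?thesis by simp
qed

context stable_sum
begin

lemma laplace_levy_tail:
  assumes "\<mu> > 0"
  shows "laplace levy_tail \<mu> = psi_real \<mu> / \<mu>"
proof (rule laplace_eq_of_nn_integral)
  have "indicator {0<..} t * (exp (- \<mu> * t) * levy_tail t) = exp (- \<mu> * t) * levy_tail t" for t
    by (simp add: levy_tail_def indicator_def)
  then show "(\<integral>\<^sup>+t. ennreal (indicator {0<..} t * (exp (- \<mu> * t) * levy_tail t)) \<partial>lborel) = ennreal (psi_real \<mu> / \<mu>)"
    by (simp only: nn_integral_levy_tail_laplace[OF assms])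
  show "psi_real \<mu> / \<mu> \<ge> 0" using assms psi_real_pos[OF assms] by simp
qed (auto simp: levy_tail_nonneg)

end

context stable_sum_laws
begin

text \<open>The common transform is (1 - exp (- x \<psi>(\<mu>))) / \<mu>. Laplace injectivity gives
  equality for almost every level, and continuity removes the exception.\<close>

lemma time_cdf_eq_P:
  assumes x: "x > 0" and t: "t > 0"
  shows "time_cdf x t = measure (P x) {t..}"
proof -
  interpret real_distribution "P x" by (rule real_distribution_P[OF x])
  have Pborel [measurable_cong]: "sets (P x) = sets borel" by simp
  define tail where "tail t = measure (P x) {t..}" for t
  have cont_tail: "isCont tail t" for t
    unfolding tail_def[abs_def] by (rule isCont_P_tail[OF x])
  have [measurable]: "tail \<in> borel_measurable borel"
    using cont_tail by (intro borel_measurable_continuous_onI continuous_at_imp_continuous_on) auto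
  have lap_time_cdf: "(\<integral>\<^sup>+t. ennreal (indicator {0<..} t * (exp (- \<mu> * t) * time_cdf x t)) \<partial>lborel) = ennreal ((1 - exp (- x * psi_real \<mu>)) / \<mu>)"
    if \<mu>: "\<mu> > 0" for \<mu>
  proof -
    have "(\<integral>\<^sup>+t. ennreal (indicator {0<..} t * (exp (- \<mu> * t) * time_cdf x t)) \<partial>lborel)
      = (\<integral>\<^sup>+t. \<integral>\<^sup>+y. ennreal (indicator {0<..} t * exp (- \<mu> * t)) * ennreal (indicator {0<..<x} y * time_density y t) \<partial>lborel \<partial>lborel)"
    proof (intro nn_integral_cong)
      fix t :: real
      have "ennreal (indicator {0<..} t * (exp (- \<mu> * t) * time_cdf x t)) = ennreal (indicator {0<..} t * exp (- \<mu> * t)) * ennreal (time_cdf x t)"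
        by (auto simp: indicator_def ennreal_mult time_cdf_nonneg)
      also have "\<dots> = ennreal (indicator {0<..} t * exp (- \<mu> * t)) * (\<integral>\<^sup>+y. ennreal (indicator {0<..<x} y * time_density y t) \<partial>lborel)"
        by (cases "t > 0") (simp_all add: ennreal_time_cdf)
      also have "\<dots> = (\<integral>\<^sup>+y. ennreal (indicator {0<..} t * exp (- \<mu> * t)) * ennreal (indicator {0<..<x} y * time_density y t) \<partial>lborel)"
        by (rule nn_integral_cmult[symmetric]) measurable
      finally show "ennreal (indicator {0<..} t * (exp (- \<mu> * t) * time_cdf x t))
        = (\<integral>\<^sup>+y. ennreal (indicator {0<..} t * exp (- \<mu> * t)) * ennreal (indicator {0<..<x} y * time_density y t) \<partial>lborel)" .
    qed
    also have "\<dots> = (\<integral>\<^sup>+y. \<integral>\<^sup>+t. ennreal (indicator {0<..} t * exp (- \<mu> * t)) * ennreal (indicator {0<..<x} y * time_density y t) \<partial>lborel \<partial>lborel)"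
      by (rule lborel_pair.Fubini') measurable
    \<comment> \<open>For fixed \<open>y\<close> the integral over the level is the transform of the
      convolution; what is left is an elementary exponential integral over 0 < y < x.\<close>
    also have "\<dots> = (\<integral>\<^sup>+y. ennreal (psi_real \<mu> / \<mu>) * ennreal (indicator {0<..<x} y * exp (- psi_real \<mu> * y)) \<partial>lborel)"
    proof (intro nn_integral_cong)
      fix y :: real
      show "(\<integral>\<^sup>+t. ennreal (indicator {0<..} t * exp (- \<mu> * t)) * ennreal (indicator {0<..<x} y * time_density y t) \<partial>lborel)
        = ennreal (psi_real \<mu> / \<mu>) * ennreal (indicator {0<..<x} y * exp (- psi_real \<mu> * y))"
      proof (cases "0 < y \<and> y < x")
        case True
        then have "(\<integral>\<^sup>+t. ennreal (indicator {0<..} t * exp (- \<mu> * t)) * ennreal (indicator {0<..<x} y * time_density y t) \<partial>lborel)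
          = (\<integral>\<^sup>+t. ennreal (exp (- \<mu> * t) * time_density y t) \<partial>lborel)"
          using time_density_eq_0[of y]
          by (intro nn_integral_cong) (auto simp: indicator_def ennreal_mult time_density_nonneg not_less)
        also have "\<dots> = ennreal (psi_real \<mu> / \<mu> * exp (- y * psi_real \<mu>))"
          using True by (intro nn_integral_time_density_laplace \<mu>) auto
        also have "\<dots> = ennreal (psi_real \<mu> / \<mu>) * ennreal (indicator {0<..<x} y * exp (- psi_real \<mu> * y))"
          using True \<mu> psi_real_pos[OF \<mu>] by (simp add: ennreal_mult[symmetric] mult.commute)
        finally show ?thesis .
      qed auto
    qed
    also have "\<dots> = ennreal (psi_real \<mu> / \<mu>) * ennreal ((1 - exp (- psi_real \<mu> * x)) / psi_real \<mu>)"
      using x psi_real_pos[OF \<mu>] by (subst nn_integral_cmult, measurable) (subst nn_integral_exp_Ioo, auto)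
    also have "\<dots> = ennreal ((1 - exp (- x * psi_real \<mu>)) / \<mu>)"
      using x \<mu> psi_real_pos[OF \<mu>] by (simp add: ennreal_mult[symmetric] mult.commute)
    finally show ?thesis .
  qed
  have lap_tail: "(\<integral>\<^sup>+t. ennreal (indicator {0<..} t * (exp (- \<mu> * t) * tail t)) \<partial>lborel) = ennreal ((1 - exp (- x * psi_real \<mu>)) / \<mu>)"
    if \<mu>: "\<mu> > 0" for \<mu>
  proof -
    have "(\<integral>\<^sup>+t. ennreal (indicator {0<..} t * (exp (- \<mu> * t) * tail t)) \<partial>lborel)
      = (\<integral>\<^sup>+t. \<integral>\<^sup>+s. ennreal (indicator {0<..} t * exp (- \<mu> * t)) * (ennreal (space_density s x) * indicator {t..} s) \<partial>lborel \<partial>lborel)"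
    proof (intro nn_integral_cong)
      fix t :: real
      have "ennreal (tail t) = (\<integral>\<^sup>+s. indicator {t..} s \<partial>P x)"
        by (simp add: tail_def emeasure_eq_measure)
      also have "\<dots> = (\<integral>\<^sup>+s. ennreal (space_density s x) * indicator {t..} s \<partial>lborel)"
        by (rule nn_integral_P[OF x]) measurable
      finally have "ennreal (indicator {0<..} t * (exp (- \<mu> * t) * tail t))
        = ennreal (indicator {0<..} t * exp (- \<mu> * t)) * (\<integral>\<^sup>+s. ennreal (space_density s x) * indicator {t..} s \<partial>lborel)"
        by (auto simp: indicator_def ennreal_mult tail_def)
      also have "\<dots> = (\<integral>\<^sup>+s. ennreal (indicator {0<..} t * exp (- \<mu> * t)) * (ennreal (space_density s x) * indicator {t..} s) \<partial>lborel)"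
        by (rule nn_integral_cmult[symmetric]) measurable
      finally show "ennreal (indicator {0<..} t * (exp (- \<mu> * t) * tail t))
        = (\<integral>\<^sup>+s. ennreal (indicator {0<..} t * exp (- \<mu> * t)) * (ennreal (space_density s x) * indicator {t..} s) \<partial>lborel)" .
    qed
    also have "\<dots> = (\<integral>\<^sup>+t. \<integral>\<^sup>+s. ennreal (space_density s x) * (ennreal (indicator {0<..} t * exp (- \<mu> * t)) * (if t \<le> s then 1 else 0)) \<partial>lborel \<partial>lborel)"
      by (intro nn_integral_cong) (auto simp: indicator_def mult_ac)
    also have "\<dots> = (\<integral>\<^sup>+s. \<integral>\<^sup>+t. ennreal (space_density s x) * (ennreal (indicator {0<..} t * exp (- \<mu> * t)) * (if t \<le> s then 1 else 0)) \<partial>lborel \<partial>lborel)"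
      by (rule lborel_pair.Fubini') measurable
    \<comment> \<open>For fixed \<open>s\<close> the condition t \<le> s cuts the exponential at
      \<open>s\<close>, so that the law is integrated against (1 - exp (- \<mu> s)) / \<mu>.\<close>
    also have "\<dots> = (\<integral>\<^sup>+s. ennreal (space_density s x) * ennreal ((1 - exp (- \<mu> * s)) / \<mu>) \<partial>lborel)"
    proof (intro nn_integral_cong)
      fix s :: real
      show "(\<integral>\<^sup>+t. ennreal (space_density s x) * (ennreal (indicator {0<..} t * exp (- \<mu> * t)) * (if t \<le> s then 1 else 0)) \<partial>lborel)
        = ennreal (space_density s x) * ennreal ((1 - exp (- \<mu> * s)) / \<mu>)"
      proof (cases "s > 0")
        case True
        have "(\<integral>\<^sup>+t. ennreal (space_density s x) * (ennreal (indicator {0<..} t * exp (- \<mu> * t)) * (if t \<le> s then 1 else 0)) \<partial>lborel)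
          = ennreal (space_density s x) * (\<integral>\<^sup>+t. ennreal (indicator {0<..} t * exp (- \<mu> * t)) * (if t \<le> s then 1 else 0) \<partial>lborel)"
          by (rule nn_integral_cmult) measurable
        also have "(\<integral>\<^sup>+t. ennreal (indicator {0<..} t * exp (- \<mu> * t)) * (if t \<le> s then 1 else 0) \<partial>lborel)
            = (\<integral>\<^sup>+t. ennreal (indicator {0<..<s} t * exp (- \<mu> * t)) \<partial>lborel)"
        proof (rule nn_integral_cong_AE)
          show "AE t in lborel. ennreal (indicator {0<..} t * exp (- \<mu> * t)) * (if t \<le> s then 1 else 0) = ennreal (indicator {0<..<s} t * exp (- \<mu> * t))"
            using AE_lborel_singleton[of s] by eventually_elim (auto simp: indicator_def)
        qed
        also have "\<dots> = ennreal ((1 - exp (- \<mu> * s)) / \<mu>)"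
          using True by (intro nn_integral_exp_Ioo \<mu>) auto
        finally show ?thesis .
      qed (simp add: space_density_eq_0[OF x])
    qed
    also have "\<dots> = (\<integral>\<^sup>+s. ennreal ((1 - exp (- \<mu> * s)) / \<mu>) \<partial>P x)"
      by (rule nn_integral_P[OF x, symmetric]) measurable
    also have "\<dots> = ennreal (LINT s|P x. (1 - exp (- \<mu> * s)) / \<mu>)"
    proof (rule nn_integral_eq_integral)
      show "integrable (P x) (\<lambda>s. (1 - exp (- \<mu> * s)) / \<mu>)"
        using integrable_exp_P[OF x \<mu>] by auto
      show "AE s in P x. 0 \<le> (1 - exp (- \<mu> * s)) / \<mu>"
        using nonneg_P[OF x] by eventually_elim (use \<mu> in auto)
    qed
    also have "(LINT s|P x. (1 - exp (- \<mu> * s)) / \<mu>) = (1 - (LINT s|P x. exp (- \<mu> * s))) / \<mu>"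
      using integrable_exp_P[OF x \<mu>] prob_space by simp
    also have "\<dots> = (1 - exp (- x * psi_real \<mu>)) / \<mu>"
      by (simp only: laplace_P[OF x \<mu>])
    finally show ?thesis .
  qed
  have pos: "(1 - exp (- x * psi_real \<mu>)) / \<mu> \<ge> 0" if "\<mu> > 0" for \<mu>
    using that x psi_real_pos[OF that] by simp
  note L1 = laplace_eq_of_nn_integral[of "time_cdf x", OF measurable_time_cdf time_cdf_nonneg pos lap_time_cdf]
  note L2 = laplace_eq_of_nn_integral[of tail, OF _ _ pos lap_tail]
  have tail: "tail t \<ge> 0" for t by (simp add: tail_def)
  have "AE t in lborel. t > 0 \<longrightarrow> time_cdf x t - tail t = 0"
  proof (rule laplace_injective)
    fix \<mu> :: real assume \<mu>: "\<mu> > 0"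
    have int: "set_integrable lborel {0<..} (\<lambda>t. exp (- \<mu> * t) * time_cdf x t)" "set_integrable lborel {0<..} (\<lambda>t. exp (- \<mu> * t) * tail t)"
      using L1(1)[OF \<mu> \<mu>] L2(1)[OF _ _ \<mu> \<mu>] tail by auto
    show "set_integrable lborel {0<..} (\<lambda>t. exp (- \<mu> * t) * (time_cdf x t - tail t))"
      unfolding right_diff_distrib by (intro set_integral_diff int)
    have "laplace (\<lambda>t. time_cdf x t - tail t) \<mu> = laplace (time_cdf x) \<mu> - laplace tail \<mu>"
      unfolding laplace_def right_diff_distrib by (intro set_integral_diff int)
    then show "laplace (\<lambda>t. time_cdf x t - tail t) \<mu> = 0"
      using L1(2)[OF \<mu> \<mu>] L2(2)[OF _ _ \<mu> \<mu>] tail by auto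
  qed
  then have AE: "AE t in lborel. t \<in> {0<..} \<longrightarrow> time_cdf x t = tail t"
    by eventually_elim auto
  have "continuous_on {0<..} (time_cdf x)" "continuous_on {0<..} tail"
    using isCont_time_cdf cont_tail by (auto intro!: continuous_at_imp_continuous_on)
  from continuous_AE_eq_imp_eq[OF _ this AE] t show ?thesis
    by (simp add: tail_def)
qed

lemma nn_integral_time_density_Ioo:
  assumes "t > 0" "x > 0"
  shows "(\<integral>\<^sup>+y. ennreal (time_density y t) * indicator {0<..<x} y \<partial>lborel) = ennreal (measure (P x) {t..})"
proof -
  have "(\<integral>\<^sup>+y. ennreal (time_density y t) * indicator {0<..<x} y \<partial>lborel) = (\<integral>\<^sup>+y. ennreal (indicator {0<..<x} y * time_density y t) \<partial>lborel)"
    by (intro nn_integral_cong) (auto simp: indicator_def)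
  then show ?thesis
    using assms by (simp add: ennreal_time_cdf[symmetric] time_cdf_eq_P)
qed

text \<open>Monotone convergence in the cut-off: the sum exceeds any fixed level with probability
  tending to 1, so no mass is lost at infinity.\<close>

lemma nn_integral_time_density_total:
  assumes t: "t > 0"
  shows "(\<integral>\<^sup>+y. ennreal (time_density y t) * indicator {0<..} y \<partial>lborel) = 1"
proof -
  \<comment> \<open>Cutting at \<open>Suc n\<close> keeps the time positive, as the facts about
    \<open>P\<close> require.\<close>
  have "(\<lambda>n. \<integral>\<^sup>+y. ennreal (time_density y t) * indicator {0<..<real (Suc n)} y \<partial>lborel)
      \<longlonglongrightarrow> (\<integral>\<^sup>+y. ennreal (time_density y t) * indicator {0<..} y \<partial>lborel)"
  proof (rule nn_integral_LIMSEQ)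
    show "incseq (\<lambda>n y. ennreal (time_density y t) * indicator {0<..<real (Suc n)} y)"
      by (auto simp: incseq_def le_fun_def indicator_def)
    show "(\<lambda>n. ennreal (time_density y t) * indicator {0<..<real (Suc n)} y) \<longlonglongrightarrow> ennreal (time_density y t) * indicator {0<..} y" for y
    proof (rule tendsto_eventually)
      obtain N :: nat where "y < real N" using reals_Archimedean2 by blast
      then show "\<forall>\<^sub>F n in sequentially. ennreal (time_density y t) * indicator {0<..<real (Suc n)} y = ennreal (time_density y t) * indicator {0<..} y"
        by (intro eventually_sequentiallyI[of N]) (auto simp: indicator_def)
    qed
  qed measurable
  moreover have "(\<lambda>n. \<integral>\<^sup>+y. ennreal (time_density y t) * indicator {0<..<real (Suc n)} y \<partial>lborel) \<longlonglongrightarrow> ennreal 1"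
  proof -
    have "(\<lambda>n. measure (P (real (Suc n))) {..<t}) \<longlonglongrightarrow> 0"
      by (rule filterlim_compose[OF P_less_tendsto])
        (rule filterlim_compose[OF filterlim_real_sequentially filterlim_Suc])
    then have "(\<lambda>n. 1 - measure (P (real (Suc n))) {..<t}) \<longlonglongrightarrow> 1 - 0"
      by (intro tendsto_intros)
    then have "(\<lambda>n. ennreal (measure (P (real (Suc n))) {t..})) \<longlonglongrightarrow> ennreal 1"
      by (intro tendsto_ennrealI) (simp add: P_measure_split del: of_nat_Suc)
    then show ?thesis using t by (simp add: nn_integral_time_density_Ioo del: of_nat_Suc)
  qed
  ultimately show ?thesis using LIMSEQ_unique by fastforce
qed

text \<open>The complement of the previous two integrals, in the half-line form used to identify the
  law of the hitting time.\<close>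

lemma nn_integral_time_density_tail:
  assumes t: "t > 0" and x: "x > 0"
  shows "(\<integral>\<^sup>+y. ennreal (time_density y t) * indicator {x<..} y \<partial>lborel) = ennreal (measure (P x) {..<t})"
proof -
  let ?T = "\<integral>\<^sup>+y. ennreal (time_density y t) * indicator {x<..} y \<partial>lborel"
  have "1 = (\<integral>\<^sup>+y. ennreal (time_density y t) * indicator {0<..} y \<partial>lborel)"
    by (simp only: nn_integral_time_density_total[OF t])
  also have "\<dots> = (\<integral>\<^sup>+y. ennreal (time_density y t) * indicator {0<..<x} y + ennreal (time_density y t) * indicator {x<..} y \<partial>lborel)"
  proof (rule nn_integral_cong_AE)
    show "AE y in lborel. ennreal (time_density y t) * indicator {0<..} y
        = ennreal (time_density y t) * indicator {0<..<x} y + ennreal (time_density y t) * indicator {x<..} y"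
      using AE_lborel_singleton[of x] by eventually_elim (use x in \<open>auto simp: indicator_def\<close>)
  qed
  also have "\<dots> = ennreal (measure (P x) {t..}) + ?T"
    by (subst nn_integral_add) (auto simp: nn_integral_time_density_Ioo[OF t x])
  finally have *: "ennreal (measure (P x) {t..}) + ?T = 1" by simp
  then have "?T \<noteq> \<infinity>" by auto
  then obtain c where c: "?T = ennreal c" "c \<ge> 0"
    by (cases ?T) auto
  then have "measure (P x) {t..} + c = 1"
    using * by (simp flip: ennreal_plus)
  then show ?thesis using P_measure_split[OF x, of t] c by simp
qed

section \<open>The solution of the time problem and its uniqueness\<close>

text \<open>The value on the single line x = 0 is the boundary datum, which is also the limit of the
  density from the right; it does not affect the law.\<close>

definition time_solution :: "real \<Rightarrow> real \<Rightarrow> real" where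
  "time_solution x t = (if x > 0 then time_density x t else if x = 0 then levy_tail t else 0)"

lemma measurable_time_solution [measurable]: "(\<lambda>(x, t). time_solution x t) \<in> borel_measurable (borel \<Otimes>\<^sub>M borel)"
  unfolding time_solution_def case_prod_beta by measurable

lemma time_solution_nonneg: "time_solution x t \<ge> 0"
  by (simp add: time_solution_def time_density_nonneg levy_tail_nonneg)

lemma time_solution_continuous:
  assumes "t > 0"
  shows "continuous (at_right 0) (\<lambda>x. time_solution x t)"
proof -
  have "((\<lambda>x. time_solution x t) \<longlongrightarrow> levy_tail t) (at_right 0)"
    by (rule Lim_transform_eventually[OF time_density_tendsto_levy_tail[OF assms]])
      (use eventually_at_right_less[of 0] in eventually_elim, simp add: time_solution_def)
  then show ?thesis by (simp add: continuous_within time_solution_def)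
qed

lemma time_solution_boundary: "t > 0 \<Longrightarrow> time_solution 0 t = (\<Sum>j=1..m. lam j * (t powr (- \<nu> j) / Gamma (1 - \<nu> j)))"
  by (simp add: time_solution_def levy_tail_def)

text \<open>Tonelli allows the t-integral to be taken inside, where it is already known, although
  \<open>double_laplace\<close> integrates over x inside; an exponential in x remains.\<close>

lemma time_solution_double_laplace:
  assumes \<gamma>: "\<gamma> > 0" and \<mu>: "\<mu> > 0"
  shows "set_integrable (lborel \<Otimes>\<^sub>M lborel) ({0<..} \<times> {0<..}) (\<lambda>(x, t). exp (- \<gamma> * x - \<mu> * t) * time_solution x t)"
    and "double_laplace time_solution \<gamma> \<mu> = psi_real \<mu> / \<mu> / (\<gamma> + psi_real \<mu>)"
proof -
  define k where "k = (\<lambda>p :: real \<times> real. indicator ({0<..} \<times> {0<..}) p *\<^sub>R (case p of (x, t) \<Rightarrow> exp (- \<gamma> * x - \<mu> * t) * time_solution x t))"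
  have [measurable]: "k \<in> borel_measurable (lborel \<Otimes>\<^sub>M lborel)"
    unfolding k_def by measurable
  have k_nonneg: "k p \<ge> 0" for p
    by (auto simp: k_def indicator_def time_solution_nonneg split: prod.splits)
  define c where "c = psi_real \<mu> / \<mu> / (\<gamma> + psi_real \<mu>)"
  have "c \<ge> 0" using assms psi_real_pos[OF \<mu>] by (simp add: c_def)
  have "(\<integral>\<^sup>+p. ennreal (k p) \<partial>(lborel \<Otimes>\<^sub>M lborel)) = (\<integral>\<^sup>+x. \<integral>\<^sup>+t. ennreal (k (x, t)) \<partial>lborel \<partial>lborel)"
    by (rule lborel.nn_integral_fst[symmetric]) measurable
  also have "\<dots> = (\<integral>\<^sup>+x. ennreal (psi_real \<mu> / \<mu>) * ennreal (indicator {0<..} x * exp (- (\<gamma> + psi_real \<mu>) * x)) \<partial>lborel)"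
  proof (intro nn_integral_cong)
    fix x :: real
    show "(\<integral>\<^sup>+t. ennreal (k (x, t)) \<partial>lborel) = ennreal (psi_real \<mu> / \<mu>) * ennreal (indicator {0<..} x * exp (- (\<gamma> + psi_real \<mu>) * x))"
    proof (cases "x > 0")
      case True
      have "k (x, t) = exp (- \<gamma> * x) * (exp (- \<mu> * t) * time_density x t)" for t
        using True time_density_eq_0[OF True, of t]
        by (cases "t > 0") (auto simp: k_def time_solution_def exp_diff exp_minus field_simps)
      then have "(\<integral>\<^sup>+t. ennreal (k (x, t)) \<partial>lborel) = (\<integral>\<^sup>+t. ennreal (exp (- \<gamma> * x)) * ennreal (exp (- \<mu> * t) * time_density x t) \<partial>lborel)"
        using True by (simp add: ennreal_mult[symmetric] time_density_nonneg)
      also have "\<dots> = ennreal (exp (- \<gamma> * x)) * (\<integral>\<^sup>+t. ennreal (exp (- \<mu> * t) * time_density x t) \<partial>lborel)"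
        by (rule nn_integral_cmult) measurable
      also have "\<dots> = ennreal (exp (- \<gamma> * x)) * ennreal (psi_real \<mu> / \<mu> * exp (- x * psi_real \<mu>))"
        by (simp only: nn_integral_time_density_laplace[OF True \<mu>])
      also have "\<dots> = ennreal (psi_real \<mu> / \<mu> * (exp (- \<gamma> * x) * exp (- x * psi_real \<mu>)))"
        using \<mu> psi_real_pos[OF \<mu>] by (simp add: ennreal_mult[symmetric] mult_ac)
      also have "exp (- \<gamma> * x) * exp (- x * psi_real \<mu>) = exp (- (\<gamma> + psi_real \<mu>) * x)"
        by (simp add: mult_exp_exp algebra_simps)
      also have "ennreal (psi_real \<mu> / \<mu> * exp (- (\<gamma> + psi_real \<mu>) * x))
          = ennreal (psi_real \<mu> / \<mu>) * ennreal (indicator {0<..} x * exp (- (\<gamma> + psi_real \<mu>) * x))"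
        using True \<mu> psi_real_pos[OF \<mu>] by (simp add: ennreal_mult[symmetric])
      finally show ?thesis .
    qed (simp add: k_def)
  qed
  also have "\<dots> = ennreal (psi_real \<mu> / \<mu>) * (\<integral>\<^sup>+x. ennreal (indicator {0<..} x * exp (- (\<gamma> + psi_real \<mu>) * x)) \<partial>lborel)"
    by (rule nn_integral_cmult) measurable
  also have "\<dots> = ennreal (psi_real \<mu> / \<mu>) * ennreal (1 / (\<gamma> + psi_real \<mu>))"
    using \<gamma> psi_real_pos[OF \<mu>] by (subst nn_integral_exp_Ioi) auto
  also have "\<dots> = ennreal c"
    using \<gamma> \<mu> psi_real_pos[OF \<mu>] by (simp add: ennreal_mult[symmetric] c_def)
  finally have nn: "(\<integral>\<^sup>+p. ennreal (k p) \<partial>(lborel \<Otimes>\<^sub>M lborel)) = ennreal c" .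
  have int: "integrable (lborel \<Otimes>\<^sub>M lborel) k"
    by (rule integrableI_nonneg) (use k_nonneg nn in auto)
  then show *: "set_integrable (lborel \<Otimes>\<^sub>M lborel) ({0<..} \<times> {0<..}) (\<lambda>(x, t). exp (- \<gamma> * x - \<mu> * t) * time_solution x t)"
    by (simp add: set_integrable_def k_def)
  have "ennreal c = ennreal (integral\<^sup>L (lborel \<Otimes>\<^sub>M lborel) k)"
    unfolding nn[symmetric] by (rule nn_integral_eq_integral[OF int]) (use k_nonneg in auto)
  then have "c = integral\<^sup>L (lborel \<Otimes>\<^sub>M lborel) k"
    using \<open>c \<ge> 0\<close> k_nonneg by (subst (asm) ennreal_inj) (auto intro!: Bochner_Integration.integral_nonneg)
  then show "double_laplace time_solution \<gamma> \<mu> = psi_real \<mu> / \<mu> / (\<gamma> + psi_real \<mu>)"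
    unfolding double_laplace_eq_integral(2)[OF *] by (simp add: c_def k_def set_lebesgue_integral_def)
qed

lemma laplace_boundary:
  assumes "\<And>t. t > 0 \<Longrightarrow> f t = (\<Sum>j=1..m. lam j * (t powr (- \<nu> j) / Gamma (1 - \<nu> j)))" "\<mu> > 0"
  shows "laplace f \<mu> = psi_real \<mu> / \<mu>"
proof -
  have "laplace f \<mu> = laplace levy_tail \<mu>"
    unfolding laplace_def by (rule set_lebesgue_integral_cong) (auto simp: assms(1) levy_tail_def)
  then show ?thesis by (simp only: laplace_levy_tail[OF assms(2)])
qed

lemma psi_real_mult: "(\<Sum>j=1..m. lam j * (\<mu> powr \<nu> j * a)) = psi_real \<mu> * a"
  by (simp add: psi_real_def sum_distrib_right mult.assoc)

lemma time_solution_solves: "solves_time_problem m \<nu> lam time_solution"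
  unfolding solves_time_problem_def
proof (intro conjI allI impI)
  fix \<gamma> \<mu> :: real assume "\<gamma> > 0" "\<mu> > 0"
  have D: "double_laplace time_solution \<gamma> \<mu> * (\<gamma> + psi_real \<mu>) = psi_real \<mu> / \<mu>"
    using \<open>\<gamma> > 0\<close> psi_real_pos[OF \<open>\<mu> > 0\<close>] time_solution_double_laplace(2)[OF \<open>\<gamma> > 0\<close> \<open>\<mu> > 0\<close>] by simp
  show "(\<Sum>j=1..m. lam j * (\<mu> powr \<nu> j * double_laplace time_solution \<gamma> \<mu>)) =
      - (\<gamma> * double_laplace time_solution \<gamma> \<mu> - laplace (\<lambda>t. time_solution 0 t) \<mu>)"
    unfolding psi_real_mult using D by (simp add: laplace_boundary[of "time_solution 0", OF time_solution_boundary \<open>\<mu> > 0\<close>] algebra_simps)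
qed (use time_solution_boundary time_solution_double_laplace(1) in auto)

text \<open>The transformed equation reads D (\<gamma> + \<psi>(\<mu>)) = \<psi>(\<mu>) / \<mu> for
  the double transform D. The factor is positive, so D is determined.\<close>

lemma time_problem_unique:
  assumes "solves_time_problem m \<nu> lam u"
  shows "AE (x, t) in lborel \<Otimes>\<^sub>M lborel. x > 0 \<and> t > 0 \<longrightarrow> u x t = time_solution x t"
proof -
  have bdry: "\<And>t. t > 0 \<Longrightarrow> u 0 t = (\<Sum>j=1..m. lam j * (t powr (- \<nu> j) / Gamma (1 - \<nu> j)))"
    and int: "\<And>\<gamma> \<mu>. \<gamma> > 0 \<Longrightarrow> \<mu> > 0 \<Longrightarrow> set_integrable (lborel \<Otimes>\<^sub>M lborel) ({0<..} \<times> {0<..})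
        (\<lambda>(x, t). exp (- \<gamma> * x - \<mu> * t) * u x t)"
    and eq: "\<And>\<gamma> \<mu>. \<gamma> > 0 \<Longrightarrow> \<mu> > 0 \<Longrightarrow> (\<Sum>j=1..m. lam j * (\<mu> powr \<nu> j * double_laplace u \<gamma> \<mu>)) =
          - (\<gamma> * double_laplace u \<gamma> \<mu> - laplace (\<lambda>t. u 0 t) \<mu>)"
    using assms unfolding solves_time_problem_def by blast+
  have "AE (x, t) in lborel \<Otimes>\<^sub>M lborel. x > 0 \<and> t > 0 \<longrightarrow> u x t - time_solution x t = 0"
  proof (rule double_laplace_injective)
    fix \<gamma> \<mu> :: real assume pos: "\<gamma> > 0" "\<mu> > 0"
    have diff: "(\<lambda>(x, t). exp (- \<gamma> * x - \<mu> * t) * (u x t - time_solution x t))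
      = (\<lambda>p. (case p of (x, t) \<Rightarrow> exp (- \<gamma> * x - \<mu> * t) * u x t) - (case p of (x, t) \<Rightarrow> exp (- \<gamma> * x - \<mu> * t) * time_solution x t))"
      by (auto simp: fun_eq_iff right_diff_distrib)
    note ints = int[OF pos] time_solution_double_laplace(1)[OF pos]
    show i: "set_integrable (lborel \<Otimes>\<^sub>M lborel) ({0<..} \<times> {0<..}) (\<lambda>(x, t). exp (- \<gamma> * x - \<mu> * t) * (u x t - time_solution x t))"
      unfolding diff by (rule set_integral_diff(1)[OF ints])
    have "double_laplace (\<lambda>x t. u x t - time_solution x t) \<gamma> \<mu> = double_laplace u \<gamma> \<mu> - double_laplace time_solution \<gamma> \<mu>"
      unfolding double_laplace_eq_integral(2)[OF i] double_laplace_eq_integral(2)[OF ints(1)] double_laplace_eq_integral(2)[OF ints(2)]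
      unfolding diff by (rule set_integral_diff(2)[OF ints])
    moreover have "double_laplace u \<gamma> \<mu> * (\<gamma> + psi_real \<mu>) = psi_real \<mu> / \<mu>"
      using eq[OF pos, unfolded psi_real_mult] by (simp add: laplace_boundary[of "u 0", OF bdry pos(2)] algebra_simps)
    then have "double_laplace u \<gamma> \<mu> = psi_real \<mu> / \<mu> / (\<gamma> + psi_real \<mu>)"
      using pos psi_real_pos[OF pos(2)] by (simp add: eq_divide_eq mult_ac)
    ultimately show "double_laplace (\<lambda>x t. u x t - time_solution x t) \<gamma> \<mu> = 0"
      by (simp add: time_solution_double_laplace(2)[OF pos])
  qed
  then show ?thesis by eventually_elim auto
qed

end

section \<open>The processes\<close>

text \<open>If f t < f s, right-continuity at both points yields rationals q < r, just right of s
  and of t, with f r < f q.\<close>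

lemma right_continuous_mono:
  fixes f :: "real \<Rightarrow> real"
  assumes rat: "\<And>p q. p \<in> \<rat> \<Longrightarrow> q \<in> \<rat> \<Longrightarrow> 0 \<le> p \<Longrightarrow> 0 \<le> q \<Longrightarrow> f p \<le> f (p + q)"
    and cont: "\<And>t. t \<ge> 0 \<Longrightarrow> continuous (at_right t) f" and "0 \<le> s" "s \<le> t"
  shows "f s \<le> f t"
proof (rule ccontr)
  assume "\<not> f s \<le> f t"
  then have lt: "f t < f s" and "s < t" using \<open>s \<le> t\<close> by (auto simp: less_le)
  define c where "c = (f s + f t) / 2"
  have c: "f t < c" "c < f s" using lt by (auto simp: c_def)
  have "\<forall>\<^sub>F x in at_right s. c < f x"
    using cont[of s] \<open>0 \<le> s\<close> c by (intro order_tendstoD(1)) (auto simp: continuous_within)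
  then obtain b where b: "s < b" "\<And>x. s < x \<Longrightarrow> x < b \<Longrightarrow> c < f x"
    unfolding eventually_at_right_field by blast
  obtain q where q: "q \<in> \<rat>" "s < q" "q < min b t"
    using Rats_dense_in_real[of s "min b t"] b \<open>s < t\<close> by auto
  have "\<forall>\<^sub>F x in at_right t. f x < c"
    using cont[of t] \<open>0 \<le> s\<close> \<open>s \<le> t\<close> c by (intro order_tendstoD(2)) (auto simp: continuous_within)
  then obtain b' where b': "t < b'" "\<And>x. t < x \<Longrightarrow> x < b' \<Longrightarrow> f x < c"
    unfolding eventually_at_right_field by blast
  obtain r where r: "r \<in> \<rat>" "t < r" "r < b'"
    using Rats_dense_in_real[of t b'] b' by auto
  have "f q \<le> f (q + (r - q))"
    using q r \<open>0 \<le> s\<close> by (intro rat) auto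
  then show False using b(2)[of q] b'(2)[of r] q r by auto
qed

text \<open>By stationarity an increment has the law of a nonnegative variable. This holds off one
  null set for all rational times, and right-continuity extends it to real times.\<close>

lemma stable_subordinator_mono:
  assumes "prob_space M" and H: "stable_subordinator M a H"
  shows "AE \<omega> in M. \<forall>s t. 0 \<le> s \<and> s \<le> t \<longrightarrow> H s \<omega> \<le> H t \<omega>"
proof -
  interpret prob_space M by fact
  have meas: "\<And>t. t \<ge> 0 \<Longrightarrow> H t \<in> borel_measurable M"
    and zero: "AE \<omega> in M. H 0 \<omega> = 0"
    and nonneg: "AE \<omega> in M. \<forall>t\<ge>0. 0 \<le> H t \<omega>"
    and rc: "AE \<omega> in M. \<forall>t\<ge>0. continuous (at_right t) (\<lambda>s. H s \<omega>)"
    and stat: "\<And>s t. s \<ge> 0 \<Longrightarrow> t \<ge> 0 \<Longrightarrow> distr M borel (\<lambda>\<omega>. H (s + t) \<omega> - H s \<omega>) = distr M borel (\<lambda>\<omega>. H t \<omega> - H 0 \<omega>)"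
    using H unfolding stable_subordinator_def by blast+
  have "AE \<omega> in M. H p \<omega> \<le> H (p + q) \<omega>" if pq: "p \<ge> 0" "q \<ge> 0" for p q
  proof -
    have [measurable]: "H p \<in> borel_measurable M" "H (p + q) \<in> borel_measurable M" "H q \<in> borel_measurable M" "H 0 \<in> borel_measurable M"
      using meas pq by auto
    have "AE \<omega> in M. 0 \<le> H q \<omega> - H 0 \<omega>"
      using zero nonneg by eventually_elim (use pq in auto)
    then have "AE x in distr M borel (\<lambda>\<omega>. H q \<omega> - H 0 \<omega>). 0 \<le> x"
      by (subst AE_distr_iff) auto
    then have "AE x in distr M borel (\<lambda>\<omega>. H (p + q) \<omega> - H p \<omega>). 0 \<le> x"
      by (simp only: stat[OF pq])
    then show ?thesis
      by (subst (asm) AE_distr_iff) auto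
  qed
  then have "AE \<omega> in M. \<forall>p\<in>\<rat> \<inter> {0..}. \<forall>q\<in>\<rat> \<inter> {0..}. H p \<omega> \<le> H (p + q) \<omega>"
    by (subst AE_ball_countable, intro countable_Int1 countable_rat, intro ballI,
        subst AE_ball_countable, intro countable_Int1 countable_rat, intro ballI) auto
  then show ?thesis
    using rc
  proof eventually_elim
    case (elim \<omega>)
    have "H s \<omega> \<le> H t \<omega>" if "0 \<le> s" "s \<le> t" for s t
      by (rule right_continuous_mono[of "\<lambda>t. H t \<omega>"]) (use elim that in auto)
    then show ?case by blast
  qed
qed

text \<open>If f is below \<open>t\<close> at a point, right-continuity keeps it below on an
  interval to the right, so the infimum is strictly larger than that point; without it the infimum
  could equal \<open>x\<close>.\<close>

lemma less_Inf_level_iff: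
  fixes f :: "real \<Rightarrow> real"
  assumes zero: "f 0 = 0" and mono: "\<And>s t. 0 \<le> s \<Longrightarrow> s \<le> t \<Longrightarrow> f s \<le> f t"
    and cont: "\<And>t. t \<ge> 0 \<Longrightarrow> continuous (at_right t) f"
    and ex: "s > 0" "f s \<ge> t" and t: "t > 0"
  shows "x < Inf {s. s > 0 \<and> f s \<ge> t} \<longleftrightarrow> x \<le> 0 \<or> f x < t"
proof
  let ?S = "{s. s > 0 \<and> f s \<ge> t}"
  assume less: "x < Inf ?S"
  show "x \<le> 0 \<or> f x < t"
  proof (rule ccontr)
    assume "\<not> (x \<le> 0 \<or> f x < t)"
    then have "Inf ?S \<le> x" by (intro cInf_lower bdd_belowI[of _ 0]) auto
    then show False using less by simp
  qed
next
  let ?S = "{s. s > 0 \<and> f s \<ge> t}"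
  assume "x \<le> 0 \<or> f x < t"
  \<comment> \<open>Negative \<open>x\<close> is moved to 0, where f vanishes and so is still below
    the positive level.\<close>
  define x' where "x' = max 0 x"
  have x': "x' \<ge> 0" "f x' < t" "x \<le> x'"
    using \<open>x \<le> 0 \<or> f x < t\<close> zero t by (auto simp: x'_def max_def)
  have "\<forall>\<^sub>F y in at_right x'. f y < t"
    using cont[OF x'(1)] x' by (intro order_tendstoD(2)) (auto simp: continuous_within)
  then obtain b where b: "x' < b" "\<And>y. x' < y \<Longrightarrow> y < b \<Longrightarrow> f y < t"
    unfolding eventually_at_right_field by blast
  have "b \<le> Inf ?S"
  proof (rule cInf_greatest)
    show "?S \<noteq> {}" using ex by auto
    fix s assume s: "s \<in> ?S"
    show "b \<le> s"
    proof (rule ccontr)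
      assume "\<not> b \<le> s"
      then have "f s < t"
        using b(2)[of s] mono[of s x'] s x' by (cases "x' < s") auto
      then show False using s by auto
    qed
  qed
  then show "x < Inf ?S" using b x' by linarith
qed

section \<open>The sum of the subordinators and its hitting time\<close>

locale subordinator_family = prob_space M + stable_sum m \<nu> lam
  for M :: "'a measure" and m :: nat and \<nu> lam :: "nat \<Rightarrow> real" +
  fixes H :: "nat \<Rightarrow> real \<Rightarrow> 'a \<Rightarrow> real"
  assumes sub: "\<And>j. j \<in> {1..m} \<Longrightarrow> stable_subordinator M (\<nu> j) (H j)"
    and indep: "independent_processes M {1..m} H"
begin

abbreviation X :: "real \<Rightarrow> 'a \<Rightarrow> real" where
  "X \<equiv> subordinator_sum m \<nu> lam H"

definition law :: "real \<Rightarrow> real measure" where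
  "law y = distr M borel (X y)"

lemma measurable_H: "j \<in> {1..m} \<Longrightarrow> t \<ge> 0 \<Longrightarrow> H j t \<in> borel_measurable M"
  using sub unfolding stable_subordinator_def by blast

lemma measurable_X [measurable]: "t \<ge> 0 \<Longrightarrow> X t \<in> borel_measurable M"
  unfolding subordinator_sum_def[abs_def] using measurable_H by measurable

lemma X_paths:
  "AE \<omega> in M. X 0 \<omega> = 0 \<and> (\<forall>s t. 0 \<le> s \<and> s \<le> t \<longrightarrow> X s \<omega> \<le> X t \<omega>) \<and> (\<forall>t\<ge>0. continuous (at_right t) (\<lambda>s. X s \<omega>))"
proof -
  have "AE \<omega> in M. H j 0 \<omega> = 0 \<and> (\<forall>s t. 0 \<le> s \<and> s \<le> t \<longrightarrow> H j s \<omega> \<le> H j t \<omega>) \<and> (\<forall>t\<ge>0. continuous (at_right t) (\<lambda>s. H j s \<omega>))"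
    if j: "j \<in> {1..m}" for j
  proof -
    have "AE \<omega> in M. H j 0 \<omega> = 0" "AE \<omega> in M. \<forall>t\<ge>0. continuous (at_right t) (\<lambda>s. H j s \<omega>)"
      using sub[OF j] unfolding stable_subordinator_def by blast+
    then show ?thesis
      using stable_subordinator_mono[OF prob_space_axioms sub[OF j]] by eventually_elim blast
  qed
  then have "AE \<omega> in M. \<forall>j\<in>{1..m}. H j 0 \<omega> = 0 \<and> (\<forall>s t. 0 \<le> s \<and> s \<le> t \<longrightarrow> H j s \<omega> \<le> H j t \<omega>) \<and> (\<forall>t\<ge>0. continuous (at_right t) (\<lambda>s. H j s \<omega>))"
    by (intro AE_finite_allI) auto
  then show ?thesis
  proof eventually_elim
    case (elim \<omega>)
    have "X s \<omega> \<le> X t \<omega>" if "0 \<le> s" "s \<le> t" for s t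
      unfolding subordinator_sum_def using elim that by (intro sum_mono mult_left_mono) auto
    moreover have "continuous (at_right t) (\<lambda>s. X s \<omega>)" if "0 \<le> t" for t
      unfolding subordinator_sum_def using elim that by (intro continuous_intros) auto
    ultimately show ?case using elim by (auto simp: subordinator_sum_def)
  qed
qed

text \<open>Independence factors the expectation. The weights
  \<open>lam j powr (1 / \<nu> j)\<close> enter with the power \<open>\<nu> j\<close> and become the
  coefficients of the exponent.\<close>

lemma laplace_X:
  assumes y: "y > 0" and \<mu>: "\<mu> > 0"
  shows "(LINT \<omega>|M. exp (- \<mu> * X y \<omega>)) = exp (- y * psi_real \<mu>)"
proof -
  define c where "c j = \<mu> * lam j powr (1 / \<nu> j)" for j
  define E where "E j \<omega> = exp (- c j * H j y \<omega>)" for j \<omega>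
  have E: "(LINT \<omega>|M. E j \<omega>) = exp (- y * (lam j * \<mu> powr \<nu> j))" if j: "j \<in> {1..m}" for j
  proof -
    have "c j > 0" using \<mu> lam[OF j] by (simp add: c_def)
    then have "(LINT \<omega>|M. E j \<omega>) = exp (- y * c j powr \<nu> j)"
      using sub[OF j] y unfolding stable_subordinator_def E_def by blast
    also have "c j powr \<nu> j = lam j * \<mu> powr \<nu> j"
      using \<mu> lam[OF j] \<nu>[OF j] by (simp add: c_def powr_mult powr_powr)
    finally show ?thesis .
  qed
  \<comment> \<open>A nonintegrable function has Bochner integral 0 by convention, whereas this
    integral is a positive exponential.\<close>
  have int: "integrable M (E j)" if "j \<in> {1..m}" for j
    using E[OF that] not_integrable_integral_eq[of M "E j"] by fastforce
  \<comment> \<open>Evaluation at time \<open>y\<close> is a measurable coordinate map on path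
    space, so independence of processes passes to their values.\<close>
  have ind: "indep_vars (\<lambda>_. borel) E {1..m}"
  proof -
    have "indep_vars (\<lambda>_. borel) (\<lambda>j \<omega>. exp (- c j * (\<lambda>t\<in>{0..}. H j t \<omega>) y)) {1..m}"
    proof (rule indep_vars_compose2[OF indep[unfolded independent_processes_def]])
      show "(\<lambda>f. exp (- c j * f y)) \<in> borel_measurable (\<Pi>\<^sub>M t\<in>{0::real..}. borel)" for j
      proof -
        have "(\<lambda>f. f y) \<in> (\<Pi>\<^sub>M t\<in>{0::real..}. borel) \<rightarrow>\<^sub>M (borel :: real measure)"
          by (rule measurable_component_singleton) (use y in auto)
        then show ?thesis by measurable
      qed
    qed
    then show ?thesis using y by (simp add: E_def[abs_def])
  qed
  have "(\<lambda>\<omega>. exp (- \<mu> * X y \<omega>)) = (\<lambda>\<omega>. \<Prod>j\<in>{1..m}. E j \<omega>)"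
    by (simp add: fun_eq_iff E_def c_def exp_sum[symmetric] subordinator_sum_def sum_distrib_left sum_negf mult.assoc)
  then have "(LINT \<omega>|M. exp (- \<mu> * X y \<omega>)) = (\<Prod>j\<in>{1..m}. LINT \<omega>|M. E j \<omega>)"
    using indep_vars_lebesgue_integral[OF _ ind int] by simp
  also have "\<dots> = (\<Prod>j\<in>{1..m}. exp (- y * (lam j * \<mu> powr \<nu> j)))"
    by (intro prod.cong refl E)
  also have "\<dots> = exp (- y * psi_real \<mu>)"
    by (simp add: exp_sum[symmetric] psi_real_def sum_distrib_left sum_negf)
  finally show ?thesis .
qed

sublocale stable_sum_laws m \<nu> lam law
proof (rule stable_sum_laws.intro[OF stable_sum_axioms], rule stable_sum_laws_axioms.intro)
  fix y :: real assume y: "y > 0"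
  then have [measurable]: "X y \<in> borel_measurable M" by simp
  show "real_distribution (law y)"
    unfolding law_def by (rule real_distribution_distr) simp
  have "AE \<omega> in M. X y \<omega> \<ge> 0"
    using X_paths
  proof eventually_elim
    case (elim \<omega>)
    then have "X 0 \<omega> \<le> X y \<omega>" using y by (meson less_imp_le order_refl)
    then show ?case using elim by simp
  qed
  then show "AE x in law y. x \<ge> 0"
    unfolding law_def by (subst AE_distr_iff) auto
  fix \<mu> :: real assume \<mu>: "\<mu> > 0"
  have "(LINT x|law y. exp (- \<mu> * x)) = (LINT \<omega>|M. exp (- \<mu> * X y \<omega>))"
    unfolding law_def by (rule integral_distr) measurable
  then show "(LINT x|law y. exp (- \<mu> * x)) = exp (- y * psi_real \<mu>)"
    by (simp only: laplace_X[OF y \<mu>])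
qed

lemma measure_law: "y > 0 \<Longrightarrow> A \<in> sets borel \<Longrightarrow> measure (law y) A = prob {\<omega> \<in> space M. X y \<omega> \<in> A}"
  unfolding law_def by (subst measure_distr) (auto intro!: arg_cong[of _ _ prob])

text \<open>Ensures that the set in the hitting time is almost surely nonempty, so that
  \<open>Inf\<close> is a genuine infimum. The probability of staying below the level is at most
  that at each integer time, which tends to 0.\<close>

lemma X_unbounded: "AE \<omega> in M. \<exists>s>0. X s \<omega> \<ge> t"
proof -
  define N where "N = {\<omega> \<in> space M. \<forall>n::nat. X (real (Suc n)) \<omega> < t}"
  have meas: "{\<omega> \<in> space M. X (real (Suc n)) \<omega> < t} \<in> sets M" for n by measurable
  have N [measurable]: "N \<in> sets M"
    unfolding N_def by measurable
  have "prob N \<le> 0"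
  proof (rule LIMSEQ_le_const)
    show "(\<lambda>n. measure (law (real (Suc n))) {..<t}) \<longlonglongrightarrow> 0"
      by (rule filterlim_compose[OF P_less_tendsto])
        (rule filterlim_compose[OF filterlim_real_sequentially filterlim_Suc])
    have "prob N \<le> measure (law (real (Suc n))) {..<t}" for n
    proof -
      have "prob N \<le> prob {\<omega> \<in> space M. X (real (Suc n)) \<omega> < t}"
        using meas by (intro finite_measure_mono) (auto simp: N_def)
      then show ?thesis by (simp add: measure_law del: of_nat_Suc)
    qed
    then show "\<exists>N'. \<forall>n\<ge>N'. prob N \<le> measure (law (real (Suc n))) {..<t}" by blast
  qed
  then have "prob N = 0" using measure_nonneg[of M N] by linarith
  then have "AE \<omega> in M. \<omega> \<notin> N" by (simp add: prob_eq_0[OF N])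
  then show ?thesis
    using AE_space
  proof eventually_elim
    case (elim \<omega>)
    then obtain n :: nat where "\<not> X (real (Suc n)) \<omega> < t" by (auto simp: N_def)
    then show ?case by (intro exI[of _ "real (Suc n)"]) (auto simp del: of_nat_Suc)
  qed
qed

lemma inverse_process_iff:
  assumes "t > 0"
  shows "AE \<omega> in M. \<forall>x. x < inverse_process X t \<omega> \<longleftrightarrow> x \<le> 0 \<or> X x \<omega> < t"
  using X_paths X_unbounded[of t]
proof eventually_elim
  case (elim \<omega>)
  then obtain s where s: "s > 0" "X s \<omega> \<ge> t" by blast
  show ?case
    unfolding inverse_process_def
    using elim(1) by (intro allI less_Inf_level_iff[where f = "\<lambda>s. X s \<omega>", OF _ _ _ s assms]) auto
qed

text \<open>The event agrees almost surely with one about the sum at the single time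
  \<open>x\<close>; the difference lies in a null set and is measurable in the completion.\<close>

lemma pred_inverse_process:
  assumes "t > 0"
  shows "Measurable.pred (completion M) (\<lambda>\<omega>. x < inverse_process X t \<omega>)"
proof -
  define A B where "A \<omega> = (x < inverse_process X t \<omega>)" and "B \<omega> = (x \<le> 0 \<or> X x \<omega> < t)" for \<omega>
  have [measurable]: "Measurable.pred M B"
    unfolding B_def by (cases "x \<le> 0") auto
  then have "Measurable.pred (completion M) B" by (rule measurable_completion)
  moreover have "AE \<omega> in M. \<not> (A \<omega> \<noteq> B \<omega>)"
    using inverse_process_iff[OF assms] by eventually_elim (simp add: A_def B_def)
  then have "Measurable.pred (completion M) (\<lambda>\<omega>. A \<omega> \<noteq> B \<omega>)"
    by (rule sets_completion_AE)
  \<comment> \<open>A double symmetric difference: taking it with \<open>B\<close> twice recovers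
    \<open>A\<close>.\<close>
  ultimately have "Measurable.pred (completion M) (\<lambda>\<omega>. (A \<omega> \<noteq> B \<omega>) \<noteq> B \<omega>)" by measurable
  moreover have "(\<lambda>\<omega>. (A \<omega> \<noteq> B \<omega>) \<noteq> B \<omega>) = A" by auto
  ultimately show ?thesis by (simp add: A_def[abs_def])
qed

text \<open>Laws are compared on half-lines. For x > 0 the hitting time exceeds x exactly when the
  sum at time x is below the level, up to null sets.\<close>

lemma inverse_process_density:
  assumes t: "t > 0"
  shows "prob_density (completion M) (inverse_process X t) (zero_ext (\<lambda>x. time_solution x t))"
proof -
  let ?L = "inverse_process X t" and ?f = "zero_ext (\<lambda>x. time_solution x t)"
  interpret C: prob_space "completion M" by (rule prob_space_completion)
  have L [measurable]: "?L \<in> borel_measurable (completion M)"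
    using pred_inverse_process[OF t] by (intro borel_measurable_iff_greater[THEN iffD2]) (auto simp: pred_def)
  have f [measurable]: "?f \<in> borel_measurable borel"
    unfolding zero_ext_def[abs_def] by measurable
  have tail: "emeasure (completion M) {\<omega> \<in> space M. x < ?L \<omega>} = (\<integral>\<^sup>+y. ennreal (?f y) * indicator {x<..} y \<partial>lborel)" for x
  proof (cases "x > 0")
    case True
    then have [measurable]: "X x \<in> borel_measurable M" by simp
    have B: "{\<omega> \<in> space M. X x \<omega> < t} \<in> sets M" by measurable
    have "emeasure (completion M) {\<omega> \<in> space M. x < ?L \<omega>} = emeasure (completion M) {\<omega> \<in> space M. X x \<omega> < t}"
    proof (rule emeasure_eq_AE)
      show "AE \<omega> in completion M. \<omega> \<in> {\<omega> \<in> space M. x < ?L \<omega>} \<longleftrightarrow> \<omega> \<in> {\<omega> \<in> space M. X x \<omega> < t}"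
        using AE_completion[OF inverse_process_iff[OF t]] by eventually_elim (use True in auto)
    qed (use B pred_inverse_process[OF t, of x] in \<open>auto simp: pred_def\<close>)
    also have "\<dots> = emeasure M {\<omega> \<in> space M. X x \<omega> < t}"
      using B by simp
    also have "\<dots> = ennreal (measure (law x) {..<t})"
      using True by (simp add: emeasure_eq_measure measure_law)
    also have "\<dots> = (\<integral>\<^sup>+y. ennreal (time_density y t) * indicator {x<..} y \<partial>lborel)"
      by (rule nn_integral_time_density_tail[OF t True, symmetric])
    also have "\<dots> = (\<integral>\<^sup>+y. ennreal (?f y) * indicator {x<..} y \<partial>lborel)"
      using True by (intro nn_integral_cong) (auto simp: indicator_def zero_ext_def time_solution_def)
    finally show ?thesis .
  next
    \<comment> \<open>For x \<le> 0 the event is almost sure, and the total mass 1 of the density is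
      needed.\<close>
    case False
    have "emeasure (completion M) {\<omega> \<in> space M. x < ?L \<omega>} = 1"
    proof -
      have "AE \<omega> in completion M. \<omega> \<in> {\<omega> \<in> space M. x < ?L \<omega>}"
        using AE_completion[OF inverse_process_iff[OF t]] AE_space by eventually_elim (use False in auto)
      then show ?thesis
        by (rule C.emeasure_eq_1_AE[rotated]) (use pred_inverse_process[OF t, of x] in \<open>simp add: pred_def\<close>)
    qed
    also have "\<dots> = (\<integral>\<^sup>+y. ennreal (time_density y t) * indicator {0<..} y \<partial>lborel)"
      by (simp only: nn_integral_time_density_total[OF t])
    also have "\<dots> = (\<integral>\<^sup>+y. ennreal (?f y) * indicator {x<..} y \<partial>lborel)"
    proof (rule nn_integral_cong_AE)
      show "AE y in lborel. ennreal (time_density y t) * indicator {0<..} y = ennreal (?f y) * indicator {x<..} y"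
        using AE_lborel_singleton[of 0]
        by eventually_elim (use False in \<open>auto simp: indicator_def zero_ext_def time_solution_def\<close>)
    qed
    finally show ?thesis .
  qed
  have "distr (completion M) lborel ?L = density lborel (\<lambda>x. ennreal (?f x))"
  proof (rule measure_eqI_lessThan)
    fix x
    have eq: "emeasure (distr (completion M) lborel ?L) {x<..} = emeasure (completion M) {\<omega> \<in> space M. x < ?L \<omega>}"
      by (subst emeasure_distr) (auto intro!: arg_cong[of _ _ "emeasure (completion M)"])
    then show "emeasure (distr (completion M) lborel ?L) {x<..} < \<infinity>"
      using C.emeasure_finite unfolding eq by (simp only: less_top infinity_ennreal_def)
    show "emeasure (distr (completion M) lborel ?L) {x<..} = emeasure (density lborel (\<lambda>x. ennreal (?f x))) {x<..}"
      unfolding eq tail by (subst emeasure_density) auto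
  qed auto
  then have "distributed (completion M) lborel ?L (\<lambda>x. ennreal (?f x))"
    unfolding distributed_def by auto
  then show ?thesis
    unfolding prob_density_def by (auto simp: zero_ext_def time_solution_nonneg)
qed

section \<open>The space problem and its uniqueness\<close>

lemma zero_ext_space_density: "t > 0 \<Longrightarrow> zero_ext (\<lambda>x. space_density x t) = (\<lambda>x. space_density x t)"
  by (auto simp: zero_ext_def fun_eq_iff space_density_eq_0)

lemma X_density:
  assumes t: "t > 0"
  shows "prob_density M (X t) (zero_ext (\<lambda>x. space_density x t))"
proof -
  have [measurable]: "X t \<in> borel_measurable M" using t by simp
  have "distr M lborel (X t) = law t"
    unfolding law_def by (rule distr_cong) auto
  then have "distributed M lborel (X t) (\<lambda>x. ennreal (space_density x t))"
    unfolding distributed_def using P_density[OF t] by auto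
  then show ?thesis
    unfolding prob_density_def zero_ext_space_density[OF t] using space_density_nonneg[OF t] by auto
qed

lemma fourier_space_density:
  assumes t: "t > 0"
  shows "fourier (zero_ext (\<lambda>x. space_density x t)) \<xi> = char_fun t \<xi>"
proof -
  have "char_fun t \<xi> = (CLINT x|density lborel (\<lambda>s. ennreal (space_density s t)). iexp (\<xi> * x))"
    by (simp only: char_P[OF t, symmetric] char_def P_density[OF t, symmetric])
  also have "\<dots> = (CLINT x|lborel. space_density x t *\<^sub>R iexp (\<xi> * x))"
    using space_density_nonneg[OF t] by (intro integral_density) auto
  also have "\<dots> = fourier (zero_ext (\<lambda>x. space_density x t)) \<xi>"
    unfolding zero_ext_space_density[OF t] fourier_def by (simp add: scaleR_conv_of_real mult.commute)
  finally show ?thesis ..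
qed

lemma char_fun_has_vector_derivative:
  "((\<lambda>s. char_fun s \<xi>) has_vector_derivative - (psi (- \<i> * of_real \<xi>) * char_fun t \<xi>)) (at t)"
proof -
  have "((\<lambda>z. exp (- z * psi (- \<i> * of_real \<xi>))) has_field_derivative - (psi (- \<i> * of_real \<xi>) * char_fun t \<xi>)) (at (of_real t))"
    by (auto intro!: derivative_eq_intros simp: char_fun_def)
  then show ?thesis
    unfolding char_fun_def by (rule has_vector_derivative_real_field)
qed

lemma char_fun_tendsto: "((\<lambda>s. char_fun s \<xi>) \<longlongrightarrow> 1) (at_right 0)"
proof -
  have "((\<lambda>s. char_fun s \<xi>) \<longlongrightarrow> exp (- of_real 0 * psi (- \<i> * of_real \<xi>))) (at_right 0)"
    unfolding char_fun_def by (intro tendsto_intros)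
  then show ?thesis by simp
qed

lemma sum_powr_eq_psi:
  "(\<Sum>j=1..m. complex_of_real (lam j) * (- \<i> * complex_of_real \<xi>) powr complex_of_real (\<nu> j) * a) = psi (- \<i> * of_real \<xi>) * a"
  by (simp add: psi_def sum_distrib_right)

lemma space_density_solves: "solves_space_problem m \<nu> lam (\<lambda>x t. space_density x t)"
  unfolding solves_space_problem_def sum_powr_eq_psi
proof (intro conjI allI impI)
  fix t :: real assume t: "t > 0"
  show "space_density 0 t = 0" using space_density_eq_0[OF t, of 0] by simp
  show "integrable lborel (zero_ext (\<lambda>x. space_density x t))"
    unfolding zero_ext_space_density[OF t] by (rule integrable_space_density[OF t])
  fix \<xi>
  show "((\<lambda>s. fourier (zero_ext (\<lambda>x. space_density x s)) \<xi>) has_vector_derivative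
      - (psi (- \<i> * of_real \<xi>) * fourier (zero_ext (\<lambda>x. space_density x t)) \<xi>)) (at t)"
  proof (rule has_vector_derivative_transform_within_open[of "\<lambda>s. char_fun s \<xi>" _ _ "{0<..}"])
    show "((\<lambda>s. char_fun s \<xi>) has_vector_derivative - (psi (- \<i> * of_real \<xi>) * fourier (zero_ext (\<lambda>x. space_density x t)) \<xi>)) (at t)"
      unfolding fourier_space_density[OF t] by (rule char_fun_has_vector_derivative)
  qed (use t fourier_space_density in auto)
next
  fix \<xi>
  show "((\<lambda>t. fourier (zero_ext (\<lambda>x. space_density x t)) \<xi>) \<longlongrightarrow> 1) (at_right 0)"
    by (rule Lim_transform_eventually[OF char_fun_tendsto])
      (use eventually_at_right_less[of 0] in eventually_elim, simp add: fourier_space_density)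
qed

text \<open>Integrating factor: the transform times exp (s w) has derivative 0 on s > 0, and the
  limit at 0 fixes the constant as 1.\<close>

lemma space_problem_fourier:
  assumes u: "solves_space_problem m \<nu> lam u" and t: "t > 0"
  shows "fourier (zero_ext (\<lambda>x. u x t)) \<xi> = char_fun t \<xi>"
proof -
  define w where "w = psi (- \<i> * of_real \<xi>)"
  define F where "F s = fourier (zero_ext (\<lambda>x. u x s)) \<xi>" for s
  have der: "(F has_vector_derivative - (w * F s)) (at s)" if "s > 0" for s
    using u that unfolding solves_space_problem_def sum_powr_eq_psi F_def[abs_def] w_def by blast
  have lim: "(F \<longlongrightarrow> 1) (at_right 0)"
    using u unfolding solves_space_problem_def F_def[abs_def] by blast
  define G where "G s = F s * exp (of_real s * w)" for s
  have der_G: "(G has_vector_derivative 0) (at s within {0<..})" if "s > 0" for s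
  proof -
    have "((\<lambda>z. exp (z * w)) has_field_derivative w * exp (of_real s * w)) (at (of_real s))"
      by (auto intro!: derivative_eq_intros)
    then have "((\<lambda>s. exp (of_real s * w)) has_vector_derivative w * exp (of_real s * w)) (at s)"
      by (rule has_vector_derivative_real_field)
    from has_vector_derivative_mult[OF der[OF that] this]
    have "(G has_vector_derivative 0) (at s)"
      by (simp add: G_def[abs_def] algebra_simps)
    then show ?thesis by (rule has_vector_derivative_at_within)
  qed
  obtain c where c: "\<And>s. s \<in> {0<..} \<Longrightarrow> G s = c"
    by (rule has_vector_derivative_zero_constant[of "{0<..}" G]) (use der_G in auto)
  have "(G \<longlongrightarrow> 1 * exp (of_real 0 * w)) (at_right 0)"
    unfolding G_def[abs_def] by (intro tendsto_intros lim)
  moreover have "(G \<longlongrightarrow> c) (at_right 0)"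
    by (rule tendsto_eventually) (use eventually_at_right_less[of 0] in eventually_elim, rule c, simp)
  ultimately have "c = 1" using tendsto_unique[OF trivial_limit_at_right_real] by fastforce
  then have "F t * exp (of_real t * w) = 1" using c[of t] t by (simp add: G_def)
  then have "F t = exp (- (of_real t * w))"
    by (simp add: exp_minus field_simps)
  then show ?thesis by (simp add: F_def char_fun_def w_def)
qed

lemma space_problem_unique:
  assumes u: "solves_space_problem m \<nu> lam u" and t: "t > 0"
  shows "AE x in lborel. x > 0 \<longrightarrow> u x t = space_density x t"
proof -
  let ?u = "zero_ext (\<lambda>x. u x t)" and ?h = "zero_ext (\<lambda>x. space_density x t)"
  have int: "integrable lborel ?u" "integrable lborel ?h"
    using u space_density_solves t unfolding solves_space_problem_def by blast+
  have intF: "integrable lborel (\<lambda>x. exp (\<i> * complex_of_real (\<xi> * x)) * complex_of_real (g x))"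
    if "integrable lborel g" for g \<xi>
    using integrable_iexp_mult[of "\<lambda>x. complex_of_real (g x)" "- \<xi>"] that by simp
  have "AE x in lborel. ?u x - ?h x = 0"
  proof (rule fourier_injective)
    show "integrable lborel (\<lambda>x. ?u x - ?h x)" using int by simp
    fix \<xi>
    have "fourier (\<lambda>x. ?u x - ?h x) \<xi> = fourier ?u \<xi> - fourier ?h \<xi>"
      unfolding fourier_def of_real_diff right_diff_distrib
      by (rule Bochner_Integration.integral_diff[OF intF[OF int(1)] intF[OF int(2)]])
    then show "fourier (\<lambda>x. ?u x - ?h x) \<xi> = 0"
      by (simp add: space_problem_fourier[OF u t] fourier_space_density[OF t])
  qed
  then show ?thesis by eventually_elim (auto simp: zero_ext_def)
qed

end

text \<open>Right-continuity at 0 ties the boundary values to the densities, which alone are fixed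
  only almost everywhere. Uniqueness is likewise up to null sets: in x for each t in the first
  problem, jointly in (x, t) in the second, where both variables are transformed.\<close>

theorem theorem2p1:
  fixes M :: "'a measure"
    and m :: nat
    and \<nu> lam :: "nat \<Rightarrow> real"
    and H :: "nat \<Rightarrow> real \<Rightarrow> 'a \<Rightarrow> real"
  assumes "prob_space M"
    and "m \<ge> 1"
    and "\<And>j. j \<in> {1..m} \<Longrightarrow> 0 < \<nu> j \<and> \<nu> j < 1"
    and "\<And>j. j \<in> {1..m} \<Longrightarrow> lam j > 0"
    and "\<And>j. j \<in> {1..m} \<Longrightarrow> stable_subordinator M (\<nu> j) (H j)"
    and "independent_processes M {1..m} H"
  shows
    "(\<exists>h. (\<forall>t>0. prob_density M (subordinator_sum m \<nu> lam H t) (zero_ext (\<lambda>x. h x t))) \<and>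
          (\<forall>t>0. continuous (at_right 0) (\<lambda>x. h x t)) \<and>
          solves_space_problem m \<nu> lam h \<and>
          (\<forall>u. solves_space_problem m \<nu> lam u \<longrightarrow>
             (\<forall>t>0. AE x in lborel. x > 0 \<longrightarrow> u x t = h x t))) \<and>
     (\<exists>l. (\<forall>t>0. prob_density (completion M)
             (inverse_process (subordinator_sum m \<nu> lam H) t) (zero_ext (\<lambda>x. l x t))) \<and>
          (\<forall>t>0. continuous (at_right 0) (\<lambda>x. l x t)) \<and>
          solves_time_problem m \<nu> lam l \<and>
          (\<forall>u. solves_time_problem m \<nu> lam u \<longrightarrow>
             (AE (x, t) in lborel \<Otimes>\<^sub>M lborel. x > 0 \<and> t > 0 \<longrightarrow> u x t = l x t)))"
proof -
  interpret prob_space M by fact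
  interpret subordinator_family M m \<nu> lam H
    by unfold_locales (use assms in auto)
  have "continuous (at_right 0) (\<lambda>x. space_density x t)" if "t > 0" for t
    using continuous_on_space_density[OF that, of UNIV]
    by (auto simp: continuous_on_eq_continuous_at intro: continuous_at_imp_continuous_at_within)
  then show ?thesis
    by (intro conjI exI[of _ space_density] exI[of _ time_solution] allI impI X_density space_density_solves space_problem_unique
      inverse_process_density time_solution_continuous time_solution_solves time_problem_unique) auto
qed

end
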